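(* Let $\Omega\subset\mathbb{R}$ be an open interval, let $\sigma\ge1/2$, let $\varphi\in H^{3/2}(\Omega)\cap H^1_0(\Omega)$ and $T>0$. If $u$ and $v$ are two solutions of $$i\partial_t u+\partial_x^2u+i|u|^{2\sigma}\partial_xu=0\ \text{ in }(-T,T)\times\Omega,\qquad u|_{\partial\Omega}=0,$$ in $L^\infty((-T,T);H^{3/2}(\Omega)\cap H^1_0(\Omega))$ with the same initial data $u(0)=v(0)=\varphi$, then $u=v$.
   Context: $\Omega\subset\mathbb{R}$ is an open interval (bounded or unbounded); functions are complex-valued. The Dirichlet boundary condition is encoded by membership in $H^1_0(\Omega)$, the closure of $C_c^\infty(\Omega)$ in $H^1(\Omega)$. Solutions satisfy the equation in the sense of distributions on $(-T,T)\times\Omega$; such a solution in $L^\infty((-T,T);H^{3/2}(\Omega)\cap H^1_0(\Omega))$ belongs to $W^{1,\infty}((-T,T);H^{-1}(\Omega))$ (with $H^{-1}(\Omega)$ the dual of $H^1_0(\Omega)$), so that the initial condition at $t=0$ makes sense. The space $H^{3/2}(\Omega)$ is normed by $\|f\|_{H^{3/2}}^2=\|f\|_{H^1}^2+\int_\Omega\int_\Omega\frac{|\partial_xf(x)-\partial_xf(y)|^2}{|x-y|^{2}}\,dx\,dy$. *)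

theory Defs
  imports "HOL-Analysis.Analysis"
begin

text \<open>Elements of \<open>L\<^sup>2(\<Omega>)\<close> and of its subspaces are represented by functions
  \<open>real \<Rightarrow> complex\<close>, of which only the restriction to \<open>\<Omega>\<close>, up to null sets, is relevant;
  all notions below are invariant under almost everywhere equality on \<open>\<Omega>\<close>.\<close>

subsection \<open>Test functions\<close>

definition dir_deriv :: "'a::real_normed_vector \<Rightarrow> ('a \<Rightarrow> 'b::real_normed_vector) \<Rightarrow> 'a \<Rightarrow> 'b"
  where "dir_deriv e f = (\<lambda>z. frechet_derivative f (at z) e)"

primrec C_k :: "nat \<Rightarrow> ('a::real_normed_vector \<Rightarrow> 'b::real_normed_vector) \<Rightarrow> bool" where
  "C_k 0 f \<longleftrightarrow> continuous_on UNIV f"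
| "C_k (Suc k) f \<longleftrightarrow> (\<forall>z. f differentiable at z) \<and> (\<forall>e. C_k k (dir_deriv e f))"

definition test_functions :: "'a::euclidean_space set \<Rightarrow> ('a \<Rightarrow> complex) set"
  where "test_functions S =
    {\<psi>. (\<forall>k. C_k k \<psi>) \<and> compact (closure {z. \<psi> z \<noteq> 0}) \<and> closure {z. \<psi> z \<noteq> 0} \<subseteq> S}"

subsection \<open>Sobolev spaces on an open subset of the line\<close>

definition L2 :: "real set \<Rightarrow> (real \<Rightarrow> complex) set"
  where "L2 \<Omega> = {f. f \<in> borel_measurable (lebesgue_on \<Omega>) \<and>
                    integrable (lebesgue_on \<Omega>) (\<lambda>x. (cmod (f x))\<^sup>2)}"

definition L2_norm :: "real set \<Rightarrow> (real \<Rightarrow> complex) \<Rightarrow> real"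
  where "L2_norm \<Omega> f = sqrt (LINT x|lebesgue_on \<Omega>. (cmod (f x))\<^sup>2)"

definition has_L2_weak_deriv :: "real set \<Rightarrow> (real \<Rightarrow> complex) \<Rightarrow> (real \<Rightarrow> complex) \<Rightarrow> bool"
  where "has_L2_weak_deriv \<Omega> f g \<longleftrightarrow> g \<in> L2 \<Omega> \<and>
    (\<forall>\<psi>\<in>test_functions \<Omega>.
       (LINT x|lebesgue_on \<Omega>. f x * dir_deriv 1 \<psi> x) = - (LINT x|lebesgue_on \<Omega>. g x * \<psi> x))"

definition H1 :: "real set \<Rightarrow> (real \<Rightarrow> complex) set"
  where "H1 \<Omega> = {f \<in> L2 \<Omega>. \<exists>g. has_L2_weak_deriv \<Omega> f g}"

text \<open>The weak derivative is determined up to a null set; some representative is chosen.\<close>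

definition weak_deriv :: "real set \<Rightarrow> (real \<Rightarrow> complex) \<Rightarrow> real \<Rightarrow> complex"
  where "weak_deriv \<Omega> f = (SOME g. has_L2_weak_deriv \<Omega> f g)"

definition H1_norm :: "real set \<Rightarrow> (real \<Rightarrow> complex) \<Rightarrow> real"
  where "H1_norm \<Omega> f = sqrt ((L2_norm \<Omega> f)\<^sup>2 + (L2_norm \<Omega> (weak_deriv \<Omega> f))\<^sup>2)"

definition H1_0 :: "real set \<Rightarrow> (real \<Rightarrow> complex) set"
  where "H1_0 \<Omega> =
    {f \<in> H1 \<Omega>. \<forall>\<epsilon>>0. \<exists>\<psi>\<in>test_functions \<Omega>. H1_norm \<Omega> (\<lambda>x. f x - \<psi> x) < \<epsilon>}"

definition gagliardo :: "real set \<Rightarrow> (real \<Rightarrow> complex) \<Rightarrow> ennreal"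
  where "gagliardo \<Omega> g =
    (\<integral>\<^sup>+x. (\<integral>\<^sup>+y. ennreal ((cmod (g x - g y))\<^sup>2 / \<bar>x - y\<bar>\<^sup>2) \<partial>lebesgue_on \<Omega>) \<partial>lebesgue_on \<Omega>)"

definition H32 :: "real set \<Rightarrow> (real \<Rightarrow> complex) set"
  where "H32 \<Omega> = {f \<in> H1 \<Omega>. gagliardo \<Omega> (weak_deriv \<Omega> f) < \<infinity>}"

definition H32_norm :: "real set \<Rightarrow> (real \<Rightarrow> complex) \<Rightarrow> real"
  where "H32_norm \<Omega> f =
    sqrt ((H1_norm \<Omega> f)\<^sup>2 + enn2real (gagliardo \<Omega> (weak_deriv \<Omega> f)))"

text \<open>\<open>H\<^sup>-\<^sup>1(\<Omega>)\<close>: bounded linear functionals on \<open>H1_0 \<Omega>\<close>. An \<open>L\<^sup>2\<close> function is identified with the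
  functional \<open>L2_functional \<Omega> f\<close>; the pairing is bilinear, as for distributions.\<close>

definition Hminus1 :: "real set \<Rightarrow> ((real \<Rightarrow> complex) \<Rightarrow> complex) set"
  where "Hminus1 \<Omega> =
    {l. (\<forall>g\<in>H1_0 \<Omega>. \<forall>h\<in>H1_0 \<Omega>. \<forall>a b. l (\<lambda>x. a * g x + b * h x) = a * l g + b * l h) \<and>
        (\<exists>C. \<forall>g\<in>H1_0 \<Omega>. cmod (l g) \<le> C * H1_norm \<Omega> g)}"

definition Hminus1_norm :: "real set \<Rightarrow> ((real \<Rightarrow> complex) \<Rightarrow> complex) \<Rightarrow> real"
  where "Hminus1_norm \<Omega> l = (SUP g\<in>{g \<in> H1_0 \<Omega>. H1_norm \<Omega> g \<le> 1}. cmod (l g))"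

definition L2_functional :: "real set \<Rightarrow> (real \<Rightarrow> complex) \<Rightarrow> (real \<Rightarrow> complex) \<Rightarrow> complex"
  where "L2_functional \<Omega> f g = (LINT x|lebesgue_on \<Omega>. f x * g x)"

subsection \<open>Functions of time with values in a function space\<close>

text \<open>\<open>L\<^sup>\<infinity>(I; X)\<close> for a function space \<open>X\<close> with norm \<open>N\<close>: strongly measurable (almost everywhere
  the limit in \<open>X\<close> of a sequence of \<open>X\<close>-valued simple functions) and essentially bounded.\<close>

definition Linfty :: "real set \<Rightarrow> 'f::minus set \<Rightarrow> ('f \<Rightarrow> real) \<Rightarrow> (real \<Rightarrow> 'f) set"
  where "Linfty I X N =
    {u. (\<exists>s. (\<forall>n. simple_function (lebesgue_on I) (s n) \<and> (\<forall>t\<in>I. s n t \<in> X)) \<and>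
             (AE t in lebesgue_on I. (\<lambda>n. N (s n t - u t)) \<longlonglongrightarrow> 0)) \<and>
        (\<exists>C. AE t in lebesgue_on I. u t \<in> X \<and> N (u t) \<le> C)}"

text \<open>The iterated integral depends only on the class of \<open>F t\<close> for almost every \<open>t\<close>, so no jointly
  measurable choice of the representatives \<open>F t\<close> is required.\<close>

definition pairing ::
  "real set \<Rightarrow> real set \<Rightarrow> (real \<Rightarrow> real \<Rightarrow> complex) \<Rightarrow> (real \<times> real \<Rightarrow> complex) \<Rightarrow> complex"
  where "pairing I \<Omega> F \<psi> = (LINT t|lebesgue_on I. (LINT x|lebesgue_on \<Omega>. F t x * \<psi> (t, x)))"

text \<open>\<open>\<i> \<partial>\<^sub>t u + \<partial>\<^sub>x\<^sup>2 u + \<i> \<bar>u\<bar>\<^sup>2\<^sup>\<sigma> \<partial>\<^sub>x u = 0\<close> in the sense of distributions on \<open>I \<times> \<Omega>\<close>.\<close>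

definition dnls_distributional ::
  "real set \<Rightarrow> real set \<Rightarrow> real \<Rightarrow> (real \<Rightarrow> real \<Rightarrow> complex) \<Rightarrow> bool"
  where "dnls_distributional I \<Omega> \<sigma> u \<longleftrightarrow>
    (\<forall>\<psi>\<in>test_functions (I \<times> \<Omega>).
       \<i> * (- pairing I \<Omega> u (dir_deriv (1, 0) \<psi>))
       + pairing I \<Omega> u (dir_deriv (0, 1) (dir_deriv (0, 1) \<psi>))
       + \<i> * pairing I \<Omega>
           (\<lambda>t x. complex_of_real (cmod (u t x) powr (2 * \<sigma>)) * weak_deriv \<Omega> (u t) x) \<psi> = 0)"

definition dnls_solution ::
  "real \<Rightarrow> real set \<Rightarrow> real \<Rightarrow> (real \<Rightarrow> real \<Rightarrow> complex) \<Rightarrow> bool"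
  where "dnls_solution T \<Omega> \<sigma> u \<longleftrightarrow>
    u \<in> Linfty {-T<..<T} (H32 \<Omega> \<inter> H1_0 \<Omega>) (H32_norm \<Omega>) \<and>
    dnls_distributional {-T<..<T} \<Omega> \<sigma> u"

text \<open>\<open>u(0) = \<phi>\<close>, where \<open>u(0)\<close> is the value at \<open>0\<close> of the representative \<open>w\<close> of \<open>u\<close> that is continuous
  from \<open>I\<close> to \<open>H\<^sup>-\<^sup>1(\<Omega>)\<close>.\<close>

definition initial_data ::
  "real set \<Rightarrow> real set \<Rightarrow> (real \<Rightarrow> real \<Rightarrow> complex) \<Rightarrow> (real \<Rightarrow> complex) \<Rightarrow> bool"
  where "initial_data I \<Omega> u \<phi> \<longleftrightarrow>
    (\<exists>w. (\<forall>t\<in>I. w t \<in> Hminus1 \<Omega>) \<and>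
         (\<forall>t\<in>I. ((\<lambda>s. Hminus1_norm \<Omega> (\<lambda>g. w s g - w t g)) \<longlongrightarrow> 0) (at t within I)) \<and>
         (AE t in lebesgue_on I. \<forall>g\<in>H1_0 \<Omega>. w t g = L2_functional \<Omega> (u t) g) \<and>
         (\<forall>g\<in>H1_0 \<Omega>. w 0 g = L2_functional \<Omega> \<phi> g))"

end

theory Submission
  imports Defs
begin

text \<open>
Write \<open>z = u - v\<close>. Multiplying the equation for \<open>z\<close> by \<open>cnj z\<close> and taking real parts removes the
second-order term. After one integration by parts the rest is bounded by
\<open>K \<integral> (\<bar>u\<^sub>x\<bar> + \<bar>v\<^sub>x\<bar>) \<bar>z\<bar>\<^sup>2\<close>, because for \<open>\<sigma> \<ge> 1/2\<close> the function \<open>r \<mapsto> r\<^sup>2\<^sup>\<sigma>\<close> is Lipschitz on bounded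
sets (\<open>dnls_form_energy\<close>). Were \<open>u\<^sub>x\<close> and \<open>v\<^sub>x\<close> bounded, Gronwall's inequality would give \<open>z = 0\<close>.
They are only of class \<open>H\<^sup>1\<^sup>/\<^sup>2\<close>, which misses \<open>L\<^sup>\<infinity>\<close>, but by no more than a logarithm. Compare
\<open>g = u\<^sub>x\<close> at a point \<open>x\<close> with its mean over an interval of length comparable to \<open>h / 4\<^sup>n\<close> at distance
comparable to \<open>h / 4\<^sup>n\<close> from \<open>x\<close>. The error is at most \<open>C 2\<^sup>-\<^sup>n\<close> times the square root of the density at \<open>x\<close>
of the Gagliardo seminorm, and the mean is at most \<open>C (1 + sqrt n)\<close>, since the means over \<open>n\<close>
successive disjoint intervals have square-summable differences (\<open>pointwise_log_bound\<close>). Therefore,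
for every \<open>n\<close>,

  \<open>d/dt \<parallel>z\<parallel>\<^sup>2 \<le> (a + b sqrt n) \<parallel>z\<parallel>\<^sup>2 + c 2\<^sup>-\<^sup>n\<close>,

and \<open>\<parallel>z(0)\<parallel> = 0\<close> yields \<open>\<parallel>z(t)\<parallel>\<^sup>2 \<le> c \<bar>t\<bar> 2\<^sup>-\<^sup>n exp ((a + b sqrt n) \<bar>t\<bar>)\<close>, which tends to \<open>0\<close> as
\<open>n \<rightarrow> \<infinity>\<close>, whatever \<open>t\<close> is.

The differential inequality has to be read off from a distributional equation. Testing with products
\<open>\<eta>(t) \<xi>(x)\<close> controls the increments of \<open>t \<mapsto> \<integral> u(t) \<xi>\<close> (\<open>weak_time_derivative_bound\<close>,
\<open>trajectory_increment\<close>). Applied to \<open>\<xi> = cnj (u(t) - u(s))\<close> this gives continuity in \<open>L\<^sup>2\<close>, and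
interpolation with the bounded \<open>H\<^sup>3\<^sup>/\<^sup>2\<close> norm turns it into uniform continuity in \<open>H\<^sup>1\<close>
(\<open>gradient_interpolation\<close>, \<open>trajectory_H1_continuous\<close>). It follows that the increment of \<open>\<parallel>z\<parallel>\<^sup>2\<close>
between \<open>s\<close> and \<open>t\<close> is at most \<open>\<bar>t - s\<bar>\<close> times the right-hand side of the differential inequality at
time \<open>s\<close>, up to an error \<open>o(\<bar>t - s\<bar>)\<close> (\<open>energy_increment\<close>). All this holds on a set
of times of full measure, to which \<open>0\<close> may be added with the value \<open>\<phi>\<close>; on such a dense set
Gronwall's lemma still works (\<open>dense_Gronwall\<close>).

Elements of \<open>H\<^sup>1\<^sub>0\<close> are handled as limits of test functions together with their derivatives
(\<open>H1_0_grad\<close>), which reduces integration by parts, the bound of the supremum and the chain rule to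
smooth functions.
\<close>

section \<open>Square-integrable functions\<close>

lemma L2_meas [measurable_dest]: "f \<in> L2 \<Omega> \<Longrightarrow> f \<in> borel_measurable (lebesgue_on \<Omega>)"
  by (simp add: L2_def)

lemma L2_integrable_square: "f \<in> L2 \<Omega> \<Longrightarrow> integrable (lebesgue_on \<Omega>) (\<lambda>x. (cmod (f x))\<^sup>2)"
  by (simp add: L2_def)

lemma L2_integrable_norm_mult:
  assumes "f \<in> L2 \<Omega>" "g \<in> L2 \<Omega>"
  shows "integrable (lebesgue_on \<Omega>) (\<lambda>x. cmod (f x) * cmod (g x))"
proof (rule Bochner_Integration.integrable_bound)
  show "integrable (lebesgue_on \<Omega>) (\<lambda>x. (cmod (f x))\<^sup>2 + (cmod (g x))\<^sup>2)"
    using assms by (intro Bochner_Integration.integrable_add L2_integrable_square)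
  show "(\<lambda>x. cmod (f x) * cmod (g x)) \<in> borel_measurable (lebesgue_on \<Omega>)"
    using assms[THEN L2_meas] by measurable
  have *: "a * b \<le> a\<^sup>2 + b\<^sup>2" for a b :: real
    using zero_le_power2[of "a - b"] zero_le_power2[of a] zero_le_power2[of b]
    unfolding power2_diff by linarith
  show "AE x in lebesgue_on \<Omega>. norm (cmod (f x) * cmod (g x)) \<le> norm ((cmod (f x))\<^sup>2 + (cmod (g x))\<^sup>2)"
    by (intro AE_I2) (simp add: *)
qed

lemma L2_integrable_mult:
  assumes "f \<in> L2 \<Omega>" "g \<in> L2 \<Omega>"
  shows "integrable (lebesgue_on \<Omega>) (\<lambda>x. f x * g x)"
  using assms[THEN L2_meas]
  by (intro Bochner_Integration.integrable_bound[OF L2_integrable_norm_mult[OF assms]])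
     (auto simp: norm_mult)

lemma L2_norm_nonneg [simp]: "0 \<le> L2_norm \<Omega> f"
  by (simp add: L2_norm_def)

lemma L2_norm_power2: "(L2_norm \<Omega> f)\<^sup>2 = (LINT x|lebesgue_on \<Omega>. (cmod (f x))\<^sup>2)"
  by (simp add: L2_norm_def)

text \<open>The quadratic polynomial \<open>t \<mapsto> \<integral> (t \<bar>f\<bar> - \<bar>g\<bar>)\<^sup>2\<close> is nonnegative, so its discriminant is not
positive.\<close>

lemma L2_Cauchy_Schwarz:
  assumes f: "f \<in> L2 \<Omega>" and g: "g \<in> L2 \<Omega>"
  shows "(LINT x|lebesgue_on \<Omega>. cmod (f x) * cmod (g x)) \<le> L2_norm \<Omega> f * L2_norm \<Omega> g"
proof -
  define A B C where "A = (LINT x|lebesgue_on \<Omega>. (cmod (f x))\<^sup>2)"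
    and "B = (LINT x|lebesgue_on \<Omega>. cmod (f x) * cmod (g x))"
    and "C = (LINT x|lebesgue_on \<Omega>. (cmod (g x))\<^sup>2)"
  note int = L2_integrable_square[OF f] L2_integrable_square[OF g] L2_integrable_norm_mult[OF f g]
  have AC: "A \<ge> 0" "C \<ge> 0" "B \<ge> 0" by (auto simp: A_def B_def C_def)
  have quad: "0 \<le> t\<^sup>2 * A - 2 * t * B + C" for t
  proof -
    have "0 \<le> (LINT x|lebesgue_on \<Omega>. (t * cmod (f x) - cmod (g x))\<^sup>2)" by simp
    also have "(\<lambda>x. (t * cmod (f x) - cmod (g x))\<^sup>2) =
        (\<lambda>x. t\<^sup>2 * (cmod (f x))\<^sup>2 - 2 * t * (cmod (f x) * cmod (g x)) + (cmod (g x))\<^sup>2)"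
      by (auto simp: power2_eq_square algebra_simps)
    also have "(LINT x|lebesgue_on \<Omega>. t\<^sup>2 * (cmod (f x))\<^sup>2 - 2 * t * (cmod (f x) * cmod (g x)) + (cmod (g x))\<^sup>2)
        = t\<^sup>2 * A - 2 * t * B + C"
      using int by (simp add: A_def B_def C_def)
    finally show ?thesis .
  qed
  have "B\<^sup>2 \<le> A * C"
  proof (cases "A = 0")
    case True
    have "B = 0"
    proof (rule ccontr)
      assume "B \<noteq> 0"
      with AC have "B > 0" by simp
      with quad[of "(C + 1) / (2 * B)"] True show False by (simp add: field_simps)
    qed
    with True show ?thesis by simp
  next
    case False
    with AC have "A > 0" by simp
    with quad[of "B / A"] show ?thesis
      by (simp add: field_simps power2_eq_square)
  qed
  then have "B \<le> sqrt (A * C)" by (rule real_le_rsqrt)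
  then show ?thesis by (simp add: L2_norm_def A_def B_def C_def real_sqrt_mult)
qed

lemma L2_integral_mult_le:
  assumes f: "f \<in> L2 \<Omega>" and g: "g \<in> L2 \<Omega>"
  shows "cmod (LINT x|lebesgue_on \<Omega>. f x * g x) \<le> L2_norm \<Omega> f * L2_norm \<Omega> g"
  by (rule order_trans[OF integral_norm_bound])
     (use L2_Cauchy_Schwarz[OF assms] in \<open>simp add: norm_mult\<close>)

lemma L2_scale: "f \<in> L2 \<Omega> \<Longrightarrow> (\<lambda>x. c * f x) \<in> L2 \<Omega>"
  by (auto simp: L2_def norm_mult power_mult_distrib)

lemma L2_add:
  assumes "f \<in> L2 \<Omega>" "g \<in> L2 \<Omega>" shows "(\<lambda>x. f x + g x) \<in> L2 \<Omega>"
proof -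
  have m: "(\<lambda>x. f x + g x) \<in> borel_measurable (lebesgue_on \<Omega>)"
    using assms[THEN L2_meas] by measurable
  have "integrable (lebesgue_on \<Omega>) (\<lambda>x. (cmod (f x + g x))\<^sup>2)"
  proof (rule Bochner_Integration.integrable_bound)
    show "integrable (lebesgue_on \<Omega>) (\<lambda>x. (cmod (f x))\<^sup>2 + (cmod (g x))\<^sup>2 + 2 * (cmod (f x) * cmod (g x)))"
      using assms by (intro Bochner_Integration.integrable_add L2_integrable_square
        integrable_mult_right L2_integrable_norm_mult)
    show "(\<lambda>x. (cmod (f x + g x))\<^sup>2) \<in> borel_measurable (lebesgue_on \<Omega>)"
      using m by measurable
    have "(cmod (f x + g x))\<^sup>2 \<le> (cmod (f x) + cmod (g x))\<^sup>2" for x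
      by (intro power_mono norm_triangle_ineq) auto
    then show "AE x in lebesgue_on \<Omega>. norm ((cmod (f x + g x))\<^sup>2) \<le>
       norm ((cmod (f x))\<^sup>2 + (cmod (g x))\<^sup>2 + 2 * (cmod (f x) * cmod (g x)))"
      by (intro AE_I2) (simp add: power2_sum mult.assoc)
  qed
  with m show ?thesis by (simp add: L2_def)
qed

lemma L2_diff: "f \<in> L2 \<Omega> \<Longrightarrow> g \<in> L2 \<Omega> \<Longrightarrow> (\<lambda>x. f x - g x) \<in> L2 \<Omega>"
  using L2_add[of f \<Omega> "\<lambda>x. -1 * g x"] L2_scale[of g \<Omega> "-1"] by simp

lemma L2_cnj: "f \<in> L2 \<Omega> \<Longrightarrow> (\<lambda>x. cnj (f x)) \<in> L2 \<Omega>"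
  by (auto simp: L2_def intro: borel_measurable_continuous_on[OF continuous_on_cnj[OF continuous_on_id]])

lemma L2_norm_scale: "L2_norm \<Omega> (\<lambda>x. c * f x) = cmod c * L2_norm \<Omega> f"
  by (simp add: L2_norm_def norm_mult power_mult_distrib real_sqrt_mult)

lemma L2_norm_cnj: "L2_norm \<Omega> (\<lambda>x. cnj (f x)) = L2_norm \<Omega> f"
  by (simp add: L2_norm_def)

lemma L2_norm_minus_commute: "L2_norm \<Omega> (\<lambda>x. f x - g x) = L2_norm \<Omega> (\<lambda>x. g x - f x)"
  by (simp add: L2_norm_def norm_minus_commute)

lemma L2_norm_triangle:
  assumes f: "f \<in> L2 \<Omega>" and g: "g \<in> L2 \<Omega>"
  shows "L2_norm \<Omega> (\<lambda>x. f x + g x) \<le> L2_norm \<Omega> f + L2_norm \<Omega> g"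
proof (rule power2_le_imp_le)
  have "(L2_norm \<Omega> (\<lambda>x. f x + g x))\<^sup>2 = (LINT x|lebesgue_on \<Omega>. (cmod (f x + g x))\<^sup>2)"
    by (rule L2_norm_power2)
  also have "\<dots> \<le> (LINT x|lebesgue_on \<Omega>. (cmod (f x))\<^sup>2 + (cmod (g x))\<^sup>2 + 2 * (cmod (f x) * cmod (g x)))"
  proof (rule integral_mono)
    show "integrable (lebesgue_on \<Omega>) (\<lambda>x. (cmod (f x + g x))\<^sup>2)"
      by (rule L2_integrable_square[OF L2_add[OF assms]])
    show "integrable (lebesgue_on \<Omega>) (\<lambda>x. (cmod (f x))\<^sup>2 + (cmod (g x))\<^sup>2 + 2 * (cmod (f x) * cmod (g x)))"
      using assms by (intro Bochner_Integration.integrable_add L2_integrable_square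
        integrable_mult_right L2_integrable_norm_mult)
    fix x
    have "(cmod (f x + g x))\<^sup>2 \<le> (cmod (f x) + cmod (g x))\<^sup>2"
      by (intro power_mono norm_triangle_ineq) auto
    then show "(cmod (f x + g x))\<^sup>2 \<le> (cmod (f x))\<^sup>2 + (cmod (g x))\<^sup>2 + 2 * (cmod (f x) * cmod (g x))"
      by (simp add: power2_sum mult.assoc)
  qed
  also have "\<dots> = (L2_norm \<Omega> f)\<^sup>2 + (L2_norm \<Omega> g)\<^sup>2 + 2 * (LINT x|lebesgue_on \<Omega>. cmod (f x) * cmod (g x))"
    using L2_integrable_square[OF f] L2_integrable_square[OF g] L2_integrable_norm_mult[OF f g]
    by (simp add: L2_norm_power2)
  also have "\<dots> \<le> (L2_norm \<Omega> f + L2_norm \<Omega> g)\<^sup>2"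
    using L2_Cauchy_Schwarz[OF assms] by (simp add: power2_sum)
  finally show "(L2_norm \<Omega> (\<lambda>x. f x + g x))\<^sup>2 \<le> (L2_norm \<Omega> f + L2_norm \<Omega> g)\<^sup>2" .
qed simp

lemma L2_norm_triangle_diff:
  assumes "f \<in> L2 \<Omega>" "g \<in> L2 \<Omega>"
  shows "L2_norm \<Omega> (\<lambda>x. f x - g x) \<le> L2_norm \<Omega> f + L2_norm \<Omega> g"
  using L2_norm_triangle[OF assms(1) L2_scale[OF assms(2), of "-1"]]
  by (simp add: L2_norm_def)

lemma L2_norm_cong_AE:
  assumes "f \<in> borel_measurable (lebesgue_on \<Omega>)" "g \<in> borel_measurable (lebesgue_on \<Omega>)"
    and "AE x in lebesgue_on \<Omega>. f x = g x"
  shows "L2_norm \<Omega> f = L2_norm \<Omega> g"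
  unfolding L2_norm_def using assms
  by (intro arg_cong[of _ _ sqrt] integral_cong_AE) (measurable, auto)

text \<open>The absolute value around \<open>K\<close> covers the case \<open>K < 0\<close>, which can occur when \<open>\<Omega>\<close> is a null
set.\<close>

lemma L2_mult_bounded:
  assumes f: "f \<in> L2 \<Omega>" and a: "a \<in> borel_measurable (lebesgue_on \<Omega>)"
    and b: "AE x in lebesgue_on \<Omega>. cmod (a x) \<le> K"
  shows "(\<lambda>x. a x * f x) \<in> L2 \<Omega>" "L2_norm \<Omega> (\<lambda>x. a x * f x) \<le> \<bar>K\<bar> * L2_norm \<Omega> f"
proof -
  have m: "(\<lambda>x. a x * f x) \<in> borel_measurable (lebesgue_on \<Omega>)"
    using a L2_meas[OF f] by measurable
  have i: "integrable (lebesgue_on \<Omega>) (\<lambda>x. K\<^sup>2 * (cmod (f x))\<^sup>2)"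
    using L2_integrable_square[OF f] by simp
  have le: "AE x in lebesgue_on \<Omega>. (cmod (a x * f x))\<^sup>2 \<le> K\<^sup>2 * (cmod (f x))\<^sup>2"
    using b by eventually_elim (auto simp: norm_mult power_mult_distrib intro!: mult_right_mono power_mono)
  have "integrable (lebesgue_on \<Omega>) (\<lambda>x. (cmod (a x * f x))\<^sup>2)"
    by (rule Bochner_Integration.integrable_bound[OF i]) (use m le in auto)
  then show L: "(\<lambda>x. a x * f x) \<in> L2 \<Omega>" using m by (simp add: L2_def)
  have "(L2_norm \<Omega> (\<lambda>x. a x * f x))\<^sup>2 \<le> (\<bar>K\<bar> * L2_norm \<Omega> f)\<^sup>2"
    using integral_mono_AE[OF L2_integrable_square[OF L] i le]
    by (simp add: L2_norm_power2 power_mult_distrib)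
  then show "L2_norm \<Omega> (\<lambda>x. a x * f x) \<le> \<bar>K\<bar> * L2_norm \<Omega> f"
    by (rule power2_le_imp_le) simp
qed

lemma L2_norm_eq_0_imp_AE:
  assumes f: "f \<in> L2 \<Omega>" and "L2_norm \<Omega> f = 0"
  shows "AE x in lebesgue_on \<Omega>. f x = 0"
proof -
  have "(LINT x|lebesgue_on \<Omega>. (cmod (f x))\<^sup>2) = 0"
    using assms(2) by (simp flip: L2_norm_power2)
  then have "AE x in lebesgue_on \<Omega>. (cmod (f x))\<^sup>2 = 0"
    using integral_nonneg_eq_0_iff_AE[OF L2_integrable_square[OF f]] by simp
  then show ?thesis by simp
qed

definition L2_tendsto :: "real set \<Rightarrow> (nat \<Rightarrow> real \<Rightarrow> complex) \<Rightarrow> (real \<Rightarrow> complex) \<Rightarrow> bool"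
  where "L2_tendsto \<Omega> fs f \<longleftrightarrow> (\<forall>n. fs n \<in> L2 \<Omega>) \<and> f \<in> L2 \<Omega> \<and>
    (\<lambda>n. L2_norm \<Omega> (\<lambda>x. fs n x - f x)) \<longlonglongrightarrow> 0"

lemma L2_tendstoD:
  assumes "L2_tendsto \<Omega> fs f"
  shows "fs n \<in> L2 \<Omega>" "f \<in> L2 \<Omega>" "(\<lambda>n. L2_norm \<Omega> (\<lambda>x. fs n x - f x)) \<longlonglongrightarrow> 0"
  using assms by (auto simp: L2_tendsto_def)

lemma L2_tendsto_const: "f \<in> L2 \<Omega> \<Longrightarrow> L2_tendsto \<Omega> (\<lambda>_. f) f"
  by (simp add: L2_tendsto_def L2_norm_def)

lemma L2_tendsto_scale: "L2_tendsto \<Omega> fs f \<Longrightarrow> L2_tendsto \<Omega> (\<lambda>n x. c * fs n x) (\<lambda>x. c * f x)"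
  using tendsto_mult_right_zero[of "\<lambda>n. L2_norm \<Omega> (\<lambda>x. fs n x - f x)" sequentially "cmod c"]
  by (auto simp: L2_tendsto_def L2_scale L2_norm_scale simp flip: right_diff_distrib)

lemma L2_tendsto_cnj: "L2_tendsto \<Omega> fs f \<Longrightarrow> L2_tendsto \<Omega> (\<lambda>n x. cnj (fs n x)) (\<lambda>x. cnj (f x))"
  by (auto simp: L2_tendsto_def L2_cnj L2_norm_cnj simp flip: complex_cnj_diff)

lemma L2_tendsto_add:
  assumes "L2_tendsto \<Omega> fs f" "L2_tendsto \<Omega> gs g"
  shows "L2_tendsto \<Omega> (\<lambda>n x. fs n x + gs n x) (\<lambda>x. f x + g x)"
proof -
  note a = L2_tendstoD[OF assms(1)] and b = L2_tendstoD[OF assms(2)]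
  have "(\<lambda>n. L2_norm \<Omega> (\<lambda>x. fs n x + gs n x - (f x + g x))) \<longlonglongrightarrow> 0"
  proof (rule Lim_null_comparison)
    show "\<forall>\<^sub>F n in sequentially. norm (L2_norm \<Omega> (\<lambda>x. fs n x + gs n x - (f x + g x))) \<le>
      L2_norm \<Omega> (\<lambda>x. fs n x - f x) + L2_norm \<Omega> (\<lambda>x. gs n x - g x)"
      using L2_norm_triangle[OF L2_diff[OF a(1,2)] L2_diff[OF b(1,2)]]
      by (intro always_eventually allI) (simp add: algebra_simps)
    show "(\<lambda>n. L2_norm \<Omega> (\<lambda>x. fs n x - f x) + L2_norm \<Omega> (\<lambda>x. gs n x - g x)) \<longlonglongrightarrow> 0"
      using tendsto_add[OF a(3) b(3)] by simp
  qed
  with a b show ?thesis by (auto simp: L2_tendsto_def intro: L2_add)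
qed

lemma L2_tendsto_integral_mult:
  assumes "L2_tendsto \<Omega> fs f" "L2_tendsto \<Omega> gs g"
  shows "(\<lambda>n. LINT x|lebesgue_on \<Omega>. fs n x * gs n x) \<longlonglongrightarrow> (LINT x|lebesgue_on \<Omega>. f x * g x)"
proof -
  note a = L2_tendstoD[OF assms(1)] and b = L2_tendstoD[OF assms(2)]
  have "norm ((LINT x|lebesgue_on \<Omega>. fs n x * gs n x) - (LINT x|lebesgue_on \<Omega>. f x * g x))
    \<le> L2_norm \<Omega> (\<lambda>x. fs n x - f x) * (L2_norm \<Omega> (\<lambda>x. gs n x - g x) + L2_norm \<Omega> g)
      + L2_norm \<Omega> f * L2_norm \<Omega> (\<lambda>x. gs n x - g x)" for n
  proof -
    have "(LINT x|lebesgue_on \<Omega>. fs n x * gs n x) - (LINT x|lebesgue_on \<Omega>. f x * g x)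
      = (LINT x|lebesgue_on \<Omega>. fs n x * gs n x - f x * g x)"
      by (intro Bochner_Integration.integral_diff[symmetric] L2_integrable_mult a b)
    also have "\<dots> = (LINT x|lebesgue_on \<Omega>. (fs n x - f x) * gs n x + f x * (gs n x - g x))"
      by (simp add: algebra_simps)
    also have "\<dots> = (LINT x|lebesgue_on \<Omega>. (fs n x - f x) * gs n x) + (LINT x|lebesgue_on \<Omega>. f x * (gs n x - g x))"
      by (intro Bochner_Integration.integral_add L2_integrable_mult L2_diff a b)
    finally have "norm ((LINT x|lebesgue_on \<Omega>. fs n x * gs n x) - (LINT x|lebesgue_on \<Omega>. f x * g x))
      \<le> L2_norm \<Omega> (\<lambda>x. fs n x - f x) * L2_norm \<Omega> (gs n) + L2_norm \<Omega> f * L2_norm \<Omega> (\<lambda>x. gs n x - g x)"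
      using norm_triangle_mono[OF L2_integral_mult_le[OF L2_diff[OF a(1,2)] b(1)]
          L2_integral_mult_le[OF a(2) L2_diff[OF b(1,2)]], of n n n] by simp
    moreover have "L2_norm \<Omega> (gs n) \<le> L2_norm \<Omega> (\<lambda>x. gs n x - g x) + L2_norm \<Omega> g"
      using L2_norm_triangle[OF L2_diff[OF b(1,2)] b(2), of n] by simp
    ultimately show ?thesis
      by (smt (verit) L2_norm_nonneg mult_left_mono)
  qed
  moreover have "(\<lambda>n. L2_norm \<Omega> (\<lambda>x. fs n x - f x) * (L2_norm \<Omega> (\<lambda>x. gs n x - g x) + L2_norm \<Omega> g)
      + L2_norm \<Omega> f * L2_norm \<Omega> (\<lambda>x. gs n x - g x)) \<longlonglongrightarrow> 0"
    using tendsto_add[OF tendsto_mult[OF a(3) tendsto_add[OF b(3) tendsto_const]]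
        tendsto_mult[OF tendsto_const b(3)], of "L2_norm \<Omega> g" "L2_norm \<Omega> f"] by simp
  ultimately have "(\<lambda>n. (LINT x|lebesgue_on \<Omega>. fs n x * gs n x) - (LINT x|lebesgue_on \<Omega>. f x * g x)) \<longlonglongrightarrow> 0"
    by (rule Lim_null_comparison[OF always_eventually[OF allI]])
  then show ?thesis by (simp add: LIM_zero_iff)
qed

text \<open>Uniform convergence of the multipliers is what sequences of test functions provide, since
convergence in \<open>H\<^sup>1\<close> on the line implies uniform convergence.\<close>

lemma L2_tendsto_mult_bounded:
  assumes "L2_tendsto \<Omega> fs f"
    and m: "\<And>n. as n \<in> borel_measurable (lebesgue_on \<Omega>)" "a \<in> borel_measurable (lebesgue_on \<Omega>)"
    and K: "AE x in lebesgue_on \<Omega>. cmod (a x) \<le> K"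
    and e: "\<And>n. AE x in lebesgue_on \<Omega>. cmod (as n x - a x) \<le> e n" "e \<longlonglongrightarrow> 0"
  shows "L2_tendsto \<Omega> (\<lambda>n x. as n x * fs n x) (\<lambda>x. a x * f x)"
proof -
  note f = L2_tendstoD[OF assms(1)]
  have b: "AE x in lebesgue_on \<Omega>. cmod (as n x) \<le> K + e n" for n
    using K e(1)[of n] by eventually_elim (smt (verit) norm_triangle_sub)
  have "(\<lambda>n. L2_norm \<Omega> (\<lambda>x. as n x * fs n x - a x * f x)) \<longlonglongrightarrow> 0"
  proof (rule Lim_null_comparison)
    show "\<forall>\<^sub>F n in sequentially. norm (L2_norm \<Omega> (\<lambda>x. as n x * fs n x - a x * f x)) \<le>
      \<bar>K + e n\<bar> * L2_norm \<Omega> (\<lambda>x. fs n x - f x) + \<bar>e n\<bar> * L2_norm \<Omega> f"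
    proof (intro always_eventually allI)
      fix n
      have "(\<lambda>x. as n x * fs n x - a x * f x) = (\<lambda>x. as n x * (fs n x - f x) + (as n x - a x) * f x)"
        by (simp add: algebra_simps)
      moreover have "L2_norm \<Omega> (\<lambda>x. as n x * (fs n x - f x) + (as n x - a x) * f x) \<le>
         L2_norm \<Omega> (\<lambda>x. as n x * (fs n x - f x)) + L2_norm \<Omega> (\<lambda>x. (as n x - a x) * f x)"
        using m b[of n] e(1)[of n] by (intro L2_norm_triangle L2_mult_bounded(1)[of _ _ _ "K + e n"] L2_mult_bounded(1)[of _ _ _ "e n"] L2_diff f)
          (auto intro: borel_measurable_diff)
      moreover have "L2_norm \<Omega> (\<lambda>x. as n x * (fs n x - f x)) \<le> \<bar>K + e n\<bar> * L2_norm \<Omega> (\<lambda>x. fs n x - f x)"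
        using m b[of n] by (intro L2_mult_bounded L2_diff f)
      moreover have "L2_norm \<Omega> (\<lambda>x. (as n x - a x) * f x) \<le> \<bar>e n\<bar> * L2_norm \<Omega> f"
        using m e(1)[of n] by (intro L2_mult_bounded f) (auto intro: borel_measurable_diff)
      ultimately show "norm (L2_norm \<Omega> (\<lambda>x. as n x * fs n x - a x * f x)) \<le>
         \<bar>K + e n\<bar> * L2_norm \<Omega> (\<lambda>x. fs n x - f x) + \<bar>e n\<bar> * L2_norm \<Omega> f"
        by simp
    qed
    have "(\<lambda>n. \<bar>K + e n\<bar> * L2_norm \<Omega> (\<lambda>x. fs n x - f x) + \<bar>e n\<bar> * L2_norm \<Omega> f) \<longlonglongrightarrow> \<bar>K + 0\<bar> * 0 + \<bar>0\<bar> * L2_norm \<Omega> f"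
      by (intro tendsto_intros f e)
    then show "(\<lambda>n. \<bar>K + e n\<bar> * L2_norm \<Omega> (\<lambda>x. fs n x - f x) + \<bar>e n\<bar> * L2_norm \<Omega> f) \<longlonglongrightarrow> 0" by simp
  qed
  moreover have "(\<lambda>x. as n x * fs n x) \<in> L2 \<Omega>" for n
    using m b[of n] by (intro L2_mult_bounded(1)[OF f(1)])
  moreover have "(\<lambda>x. a x * f x) \<in> L2 \<Omega>"
    using m K by (intro L2_mult_bounded(1)[OF f(2)])
  ultimately show ?thesis by (simp add: L2_tendsto_def)
qed

lemma L2_tendsto_norm:
  assumes "L2_tendsto \<Omega> h k" shows "(\<lambda>n. L2_norm \<Omega> (h n)) \<longlonglongrightarrow> L2_norm \<Omega> k"
proof -
  note hk = L2_tendstoD[OF assms]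
  have "\<bar>L2_norm \<Omega> (h n) - L2_norm \<Omega> k\<bar> \<le> L2_norm \<Omega> (\<lambda>x. h n x - k x)" for n
    using L2_norm_triangle[OF L2_diff[OF hk(1,2)] hk(2), of n]
      L2_norm_triangle_diff[OF hk(1) L2_diff[OF hk(1,2)], of n n] by simp
  then have "(\<lambda>n. L2_norm \<Omega> (h n) - L2_norm \<Omega> k) \<longlonglongrightarrow> 0"
    by (intro Lim_null_comparison[OF always_eventually hk(3)]) simp
  then show ?thesis by (simp add: LIM_zero_iff)
qed

lemma L2_cmod:
  assumes "f \<in> L2 \<Omega>" shows "(\<lambda>x. complex_of_real (cmod (f x))) \<in> L2 \<Omega>"
proof -
  have "(\<lambda>x. complex_of_real (cmod (f x))) \<in> borel_measurable (lebesgue_on \<Omega>)"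
    using L2_meas[OF assms] by measurable
  with L2_integrable_square[OF assms] show ?thesis by (simp add: L2_def)
qed

lemma L2_tendsto_cmod:
  assumes "L2_tendsto \<Omega> fs f"
  shows "L2_tendsto \<Omega> (\<lambda>n x. complex_of_real (cmod (fs n x))) (\<lambda>x. complex_of_real (cmod (f x)))"
proof -
  note f = L2_tendstoD[OF assms]
  have "L2_norm \<Omega> (\<lambda>x. complex_of_real (cmod (fs n x)) - complex_of_real (cmod (f x))) \<le> L2_norm \<Omega> (\<lambda>x. fs n x - f x)" for n
    unfolding L2_norm_def
  proof (intro real_sqrt_le_mono integral_mono L2_integrable_square L2_diff L2_cmod f)
    fix x
    have "\<bar>cmod (fs n x) - cmod (f x)\<bar> \<le> cmod (fs n x - f x)" by (rule norm_triangle_ineq3)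
    then show "(cmod (complex_of_real (cmod (fs n x)) - complex_of_real (cmod (f x))))\<^sup>2 \<le> (cmod (fs n x - f x))\<^sup>2"
      by (intro power_mono) (simp_all flip: of_real_diff)
  qed
  then have "(\<lambda>n. L2_norm \<Omega> (\<lambda>x. complex_of_real (cmod (fs n x)) - complex_of_real (cmod (f x)))) \<longlonglongrightarrow> 0"
    by (intro Lim_null_comparison[OF always_eventually f(3)]) simp
  with f L2_cmod show ?thesis by (simp add: L2_tendsto_def)
qed

section \<open>Calculus of smooth functions\<close>

lemma dir_deriv_eq: "(f has_derivative f') (at z) \<Longrightarrow> dir_deriv e f z = f' e"
  by (simp add: dir_deriv_def frechet_derivative_at[symmetric])

lemma has_derivative_dir_deriv: "f differentiable at z \<Longrightarrow> (f has_derivative (\<lambda>e. dir_deriv e f z)) (at z)"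
  by (simp add: dir_deriv_def frechet_derivative_works[symmetric])

lemma C_k_pred: "C_k (Suc k) f \<Longrightarrow> C_k k f"
proof (induction k arbitrary: f)
  case 0
  then show ?case
    by (auto intro!: continuous_at_imp_continuous_on differentiable_imp_continuous_within)
next
  case (Suc k)
  then show ?case using C_k.simps(2)[of "Suc k" f] C_k.simps(2)[of k f] by blast
qed

lemma C_k_add: "C_k k f \<Longrightarrow> C_k k g \<Longrightarrow> C_k k (\<lambda>z. f z + g z)"
proof (induction k arbitrary: f g)
  case (Suc k)
  have "dir_deriv e (\<lambda>z. f z + g z) = (\<lambda>z. dir_deriv e f z + dir_deriv e g z)" for e
    using Suc.prems
    by (intro ext dir_deriv_eq[OF has_derivative_add[OF has_derivative_dir_deriv has_derivative_dir_deriv]]) auto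
  with Suc show ?case by (auto intro!: differentiable_add)
qed (auto intro: continuous_on_add)

lemma C_k_mult:
  fixes f g :: "'a::real_normed_vector \<Rightarrow> 'b::real_normed_algebra"
  shows "C_k k f \<Longrightarrow> C_k k g \<Longrightarrow> C_k k (\<lambda>z. f z * g z)"
proof (induction k arbitrary: f g)
  case (Suc k)
  have "dir_deriv e (\<lambda>z. f z * g z) = (\<lambda>z. f z * dir_deriv e g z + dir_deriv e f z * g z)" for e
    using Suc.prems
    by (intro ext dir_deriv_eq[OF has_derivative_mult[OF has_derivative_dir_deriv has_derivative_dir_deriv]]) auto
  moreover have "C_k k f" "C_k k g" using Suc.prems by (blast intro: C_k_pred)+
  ultimately show ?case using Suc by (auto intro!: differentiable_mult C_k_add)
qed (auto intro: continuous_on_mult)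

lemma C_k_compose_affine:
  assumes "bounded_linear L"
  shows "C_k k f \<Longrightarrow> C_k k (\<lambda>z. f (c + L z))"
proof (induction k arbitrary: f)
  case 0
  have "continuous_on UNIV (\<lambda>z. c + L z)"
    using assms by (intro continuous_on_add continuous_on_const linear_continuous_on)
  then show ?case using 0 continuous_on_compose2[of UNIV f UNIV "\<lambda>z. c + L z"] by simp
next
  case (Suc k)
  have d: "((\<lambda>z. f (c + L z)) has_derivative (\<lambda>e. dir_deriv (L e) f (c + L z))) (at z)" for z
  proof -
    have 1: "((\<lambda>z. c + L z) has_derivative L) (at z)"
      by (auto intro!: derivative_eq_intros bounded_linear.has_derivative[OF assms])
    have "f differentiable at (c + L z)" using Suc.prems by simp
    from diff_chain_at[OF 1 has_derivative_dir_deriv[OF this]] show ?thesis by (simp add: o_def)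
  qed
  have "dir_deriv e (\<lambda>z. f (c + L z)) = (\<lambda>z. dir_deriv (L e) f (c + L z))" for e
    by (rule ext) (rule dir_deriv_eq[OF d])
  moreover have "(\<lambda>z. f (c + L z)) differentiable at z" for z
    using d[of z] by (rule differentiableI)
  moreover have "C_k k (dir_deriv e f)" for e using Suc.prems by simp
  ultimately show ?case using Suc.IH by simp
qed

lemma C_k_bounded_linear:
  assumes "bounded_linear L"
  shows "C_k k f \<Longrightarrow> C_k k (\<lambda>z. L (f z))"
proof (induction k arbitrary: f)
  case 0
  then show ?case using assms
    by (simp add: bounded_linear.continuous_on)
next
  case (Suc k)
  have d: "((\<lambda>z. L (f z)) has_derivative (\<lambda>e. L (dir_deriv e f z))) (at z)" for z
    using Suc.prems by (intro bounded_linear.has_derivative[OF assms] has_derivative_dir_deriv) auto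
  have "dir_deriv e (\<lambda>z. L (f z)) = (\<lambda>z. L (dir_deriv e f z))" for e
    by (rule ext) (rule dir_deriv_eq[OF d])
  moreover have "(\<lambda>z. L (f z)) differentiable at z" for z
    using d[of z] by (rule differentiableI)
  moreover have "C_k k (dir_deriv e f)" for e using Suc.prems by simp
  ultimately show ?case using Suc.IH by simp
qed

lemma dir_deriv_1_eq: "(f has_vector_derivative f') (at x) \<Longrightarrow> dir_deriv 1 f x = f'"
  unfolding has_vector_derivative_def by (drule dir_deriv_eq[where e = 1]) simp

text \<open>On the line a directional derivative is a multiple of the ordinary derivative, so that smoothness
can be checked with \<open>f'\<close> alone.\<close>

lemma C_k_SucI:
  fixes f :: "real \<Rightarrow> 'b::real_normed_vector"
  assumes d: "\<And>x. (f has_vector_derivative f' x) (at x)" and "C_k k f'"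
  shows "C_k (Suc k) f"
proof -
  have "dir_deriv e f = (\<lambda>x. e *\<^sub>R f' x)" for e
    by (rule ext) (rule dir_deriv_eq[OF d[unfolded has_vector_derivative_def]])
  moreover have "f differentiable at x" for x
    using d[of x] unfolding has_vector_derivative_def by (rule differentiableI)
  moreover have "C_k k (\<lambda>x. e *\<^sub>R f' x)" for e
    by (rule C_k_bounded_linear[OF bounded_linear_scaleR_right assms(2)])
  ultimately show ?thesis by simp
qed

lemma smooth_has_vector_derivative:
  fixes f :: "real \<Rightarrow> 'b::real_normed_vector"
  assumes "C_k (Suc k) f"
  shows "(f has_vector_derivative dir_deriv 1 f x) (at x)"
proof -
  from assms have "f differentiable at x" by simp
  then obtain f' where f': "(f has_derivative f') (at x)" by (auto simp: differentiable_def)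
  have "(\<lambda>y. y *\<^sub>R f' 1) = f'"
  proof
    show "y *\<^sub>R f' 1 = f' y" for y
      using linear_scale[OF has_derivative_linear[OF f'], of y 1] by simp
  qed
  moreover have "dir_deriv 1 f x = f' 1" by (rule dir_deriv_eq[OF f'])
  ultimately show ?thesis using f' by (simp only: has_vector_derivative_def)
qed

section \<open>Cut-off functions and test functions\<close>

text \<open>Among the functions \<open>P(1/x) exp(-1/x)\<close>, continued by \<open>0\<close> to \<open>x \<le> 0\<close>, differentiation only
changes the polynomial \<open>P\<close>. The whole family is therefore smooth, and \<open>P = 1\<close> gives the classical flat
function.\<close>

definition flat_poly :: "real poly \<Rightarrow> real \<Rightarrow> real"
  where "flat_poly p x = (if x > 0 then poly p (1 / x) * exp (- (1 / x)) else 0)"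

abbreviation flat :: "real \<Rightarrow> real" where "flat \<equiv> flat_poly 1"

text \<open>The factor \<open>y ^ k\<close> makes the induction on the polynomial go through.\<close>

lemma tendsto_poly_exp_at_top: "((\<lambda>y. y ^ k * poly p y * exp (- y)) \<longlongrightarrow> (0::real)) at_top"
proof (induction p arbitrary: k)
  case (pCons a p)
  have "((\<lambda>y. a * (y ^ k / exp y) + y ^ Suc k * poly p y * exp (- y)) \<longlongrightarrow> a * 0 + (0::real)) at_top"
    by (intro tendsto_intros pCons tendsto_power_div_exp_0)
  then show ?case by (simp add: exp_minus field_simps)
qed simp

lemma flat_poly_has_derivative:
  "(flat_poly p has_real_derivative flat_poly ([:0, 0, 1:] * (p - pderiv p)) x) (at x)"
proof -
  consider "x > 0" | "x < 0" | "x = 0" by linarith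
  then show ?thesis
  proof cases
    case 1
    have "((\<lambda>x. poly p (1 / x) * exp (- (1 / x))) has_real_derivative
        flat_poly ([:0, 0, 1:] * (p - pderiv p)) x) (at x)"
      using 1 by (auto intro!: derivative_eq_intros DERIV_chain2[OF poly_DERIV]
          simp: flat_poly_def field_simps power2_eq_square)
    then show ?thesis
      by (rule has_field_derivative_transform_within_open[of _ _ _ "{0<..}"])
         (use 1 in \<open>auto simp: flat_poly_def\<close>)
  next
    case 2
    have "((\<lambda>x. 0) has_real_derivative 0) (at x)" by simp
    then have "(flat_poly p has_real_derivative 0) (at x)"
      by (rule has_field_derivative_transform_within_open[of _ _ _ "{..<0}"])
         (use 2 in \<open>auto simp: flat_poly_def\<close>)
    then show ?thesis using 2 by (simp add: flat_poly_def)
  next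
    case 3
    \<comment> \<open>From the right the difference quotient is \<open>y P(y) exp(-y)\<close> with \<open>y = 1/h\<close>.\<close>
    have "((\<lambda>h. (flat_poly p h - flat_poly p 0) / (h - 0)) \<longlongrightarrow> 0) (at 0)"
    proof (rule filterlim_split_at_real)
      have "((\<lambda>h. flat_poly p h / h) \<longlongrightarrow> 0) (at_left 0)"
        by (rule tendsto_eventually) (auto simp: eventually_at_left_field flat_poly_def intro!: exI[of _ "-1"])
      then show "((\<lambda>h. (flat_poly p h - flat_poly p 0) / (h - 0)) \<longlongrightarrow> 0) (at_left 0)"
        by (simp add: flat_poly_def)
      have "((\<lambda>h. (inverse h) ^ 1 * poly p (inverse h) * exp (- inverse h)) \<longlongrightarrow> (0::real)) (at_right 0)"
        by (rule filterlim_compose[OF tendsto_poly_exp_at_top filterlim_inverse_at_top_right])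
      then show "((\<lambda>h. (flat_poly p h - flat_poly p 0) / (h - 0)) \<longlongrightarrow> 0) (at_right 0)"
        by (rule Lim_transform_eventually)
           (auto simp: eventually_at_right_field flat_poly_def field_simps intro!: exI[of _ 1])
    qed
    then show ?thesis unfolding 3 has_field_derivative_iff by (simp add: flat_poly_def)
  qed
qed

lemma C_k_flat_poly: "C_k k (flat_poly p)"
proof (induction k arbitrary: p)
  case 0
  then show ?case
    by (auto intro!: DERIV_continuous_on[OF flat_poly_has_derivative[THEN has_field_derivative_at_within]])
next
  case (Suc k)
  then show ?case
    by (intro C_k_SucI[OF flat_poly_has_derivative[unfolded has_real_derivative_iff_has_vector_derivative]])
qed

lemma flat_range: "0 \<le> flat x" "flat x \<le> 1" and flat_pos_iff: "flat x > 0 \<longleftrightarrow> x > 0"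
  by (auto simp: flat_poly_def)

text \<open>A bump on \<open>(0, 1)\<close>; its normalised primitive is a smooth step.\<close>

definition mollifier :: "real \<Rightarrow> real"
  where "mollifier x = flat x * flat (1 - x)"

lemma C_k_mollifier: "C_k k mollifier"
proof -
  have "C_k k (\<lambda>x. flat (1 + - x))"
    by (intro C_k_compose_affine[of uminus] C_k_flat_poly) (simp add: bounded_linear_minus bounded_linear_ident)
  from C_k_mult[OF C_k_flat_poly this, of 1] show ?thesis
    unfolding mollifier_def[abs_def] by simp
qed

lemma continuous_mollifier: "continuous_on S mollifier"
  using C_k_mollifier[of 0] by (auto intro: continuous_on_subset)

lemma mollifier_nonneg: "0 \<le> mollifier x"
  by (simp add: mollifier_def flat_range)

lemma mollifier_eq_0: "x \<le> 0 \<or> 1 \<le> x \<Longrightarrow> mollifier x = 0"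
  by (auto simp: mollifier_def flat_poly_def)

lemma smooth_step_exists:
  obtains \<rho> \<Theta> :: "real \<Rightarrow> real" where
    "\<And>k. C_k k \<Theta>" "\<And>x. (\<Theta> has_real_derivative \<rho> x) (at x)"
    "\<And>x. x \<le> 0 \<Longrightarrow> \<Theta> x = 0" "\<And>x. 1 \<le> x \<Longrightarrow> \<Theta> x = 1" "mono \<Theta>"
    "continuous_on UNIV \<rho>" "\<And>x. \<rho> x \<ge> 0" "\<And>x. x \<le> 0 \<or> 1 \<le> x \<Longrightarrow> \<rho> x = 0"
proof -
  define H where "H x = integral {-1..x} mollifier" for x
  have H0: "H x = 0" if "x \<le> 0" for x
  proof -
    have "H x = integral {-1..x} (\<lambda>_. 0)"
      unfolding H_def using that by (intro integral_cong) (auto simp: mollifier_eq_0)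
    then show ?thesis by simp
  qed
  have HD: "(H has_real_derivative mollifier x) (at x)" for x
  proof (cases "x < 0")
    case True
    have "((\<lambda>x. 0) has_real_derivative 0) (at x)" by simp
    then have "(H has_real_derivative 0) (at x)"
      by (rule has_field_derivative_transform_within_open[of _ _ _ "{..<0}"])
         (use True H0 in auto)
    then show ?thesis using True by (simp add: mollifier_eq_0)
  next
    case False
    have "(H has_vector_derivative mollifier x) (at x within {-1..x+1})"
      unfolding H_def using False by (intro integral_has_vector_derivative continuous_mollifier) auto
    moreover have "at x within {-1..x+1} = at x"
      using False by (intro at_within_interior) auto
    ultimately show ?thesis by (simp add: has_real_derivative_iff_has_vector_derivative)
  qed
  have mono: "H x \<le> H y" if "x \<le> y" for x y
    by (rule DERIV_nonneg_imp_nondecreasing[OF that]) (use HD mollifier_nonneg in blast)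
  have H1: "H x = H 1" if x: "1 \<le> x" for x
  proof (cases "x = 1")
    case False
    obtain \<xi> where "\<xi> > 1" "H x - H 1 = (x - 1) * mollifier \<xi>"
      using MVT2[of 1 x H mollifier] HD x False by auto
    then show ?thesis by (simp add: mollifier_eq_0)
  qed simp
  have pos: "H 1 > 0"
  proof -
    obtain \<xi> where "0 < \<xi>" "\<xi> < 1" "H 1 - H 0 = (1 - 0) * mollifier \<xi>"
      using MVT2[of 0 1 H mollifier] HD by auto
    moreover then have "mollifier \<xi> > 0"
      by (auto simp: mollifier_def flat_pos_iff)
    ultimately show ?thesis by (simp add: H0)
  qed
  have CH: "C_k k H" for k
    by (rule C_k_pred, rule C_k_SucI[OF HD[unfolded has_real_derivative_iff_has_vector_derivative] C_k_mollifier])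
  show ?thesis
  proof (rule that[of "\<lambda>x. H x / H 1" "\<lambda>x. mollifier x / H 1"])
    show "C_k k (\<lambda>x. H x / H 1)" for k
      using C_k_bounded_linear[OF bounded_linear_divide CH] .
    show "((\<lambda>x. H x / H 1) has_real_derivative mollifier x / H 1) (at x)" for x
      by (intro DERIV_cdivide HD)
    show "mono (\<lambda>x. H x / H 1)" using mono pos by (auto intro!: monoI divide_right_mono)
    show "continuous_on UNIV (\<lambda>x. mollifier x / H 1)"
      using pos by (intro continuous_intros continuous_mollifier) auto
    show "H x / H 1 = 1" if "1 \<le> x" for x using H1[OF that] pos by simp
  qed (use H0 pos mollifier_nonneg mollifier_eq_0 in auto)
qed

lemma test_functionsI:
  assumes "\<And>k. C_k k \<psi>" "{z. \<psi> z \<noteq> 0} \<subseteq> K" "compact K" "K \<subseteq> S"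
  shows "\<psi> \<in> test_functions S"
proof -
  have "closure {z. \<psi> z \<noteq> 0} \<subseteq> K"
    using assms by (simp add: closure_minimal compact_imp_closed)
  with assms show ?thesis
    by (auto simp: test_functions_def compact_closure intro: bounded_subset compact_imp_bounded)
qed

lemma test_functionsE:
  assumes "\<psi> \<in> test_functions S"
  obtains K where "\<And>k. C_k k \<psi>" "compact K" "K \<subseteq> S" "\<And>z. z \<notin> K \<Longrightarrow> \<psi> z = 0"
proof (rule that[of "closure {z. \<psi> z \<noteq> 0}"])
  show "\<psi> z = 0" if "z \<notin> closure {z. \<psi> z \<noteq> 0}" for z
    using that closure_subset[of "{z. \<psi> z \<noteq> 0}"] by blast
qed (use assms in \<open>simp_all add: test_functions_def\<close>)

lemma test_functions_add:
  assumes "f \<in> test_functions S" "g \<in> test_functions S"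
  shows "(\<lambda>x. f x + g x) \<in> test_functions S"
proof -
  from assms(1) obtain K where K: "\<And>k. C_k k f" "compact K" "K \<subseteq> S" "\<And>z. z \<notin> K \<Longrightarrow> f z = 0"
    by (rule test_functionsE) blast
  from assms(2) obtain L where L: "\<And>k. C_k k g" "compact L" "L \<subseteq> S" "\<And>z. z \<notin> L \<Longrightarrow> g z = 0"
    by (rule test_functionsE) blast
  show ?thesis
    by (rule test_functionsI[of _ "K \<union> L"]) (use K L in \<open>force intro: C_k_add\<close>)+
qed

lemma test_functions_linear:
  assumes "bounded_linear L" "f \<in> test_functions S"
  shows "(\<lambda>x. L (f x)) \<in> test_functions S"
proof -
  from assms(2) obtain K where K: "\<And>k. C_k k f" "compact K" "K \<subseteq> S" "\<And>z. z \<notin> K \<Longrightarrow> f z = 0"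
    by (rule test_functionsE) blast
  have "L 0 = 0" by (rule linear_0[OF bounded_linear.linear[OF assms(1)]])
  then have "{z. L (f z) \<noteq> 0} \<subseteq> K" using K(4) by force
  with K show ?thesis by (intro test_functionsI[OF C_k_bounded_linear[OF assms(1)]]) auto
qed

lemma test_functions_scale: "f \<in> test_functions S \<Longrightarrow> (\<lambda>x. c * f x) \<in> test_functions S"
  by (rule test_functions_linear[OF bounded_linear_mult_right])

lemma test_functions_cnj: "f \<in> test_functions S \<Longrightarrow> (\<lambda>x. cnj (f x)) \<in> test_functions S"
  by (rule test_functions_linear[OF bounded_linear_cnj])

lemma test_functions_deriv:
  assumes "f \<in> test_functions S" shows "dir_deriv e f \<in> test_functions S"
proof -
  from assms obtain K where K: "\<And>k. C_k k f" "compact K" "K \<subseteq> S" "\<And>z. z \<notin> K \<Longrightarrow> f z = 0"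
    by (rule test_functionsE) blast
  have "dir_deriv e f z = 0" if "z \<notin> K" for z
  proof -
    have "((\<lambda>_. 0) has_derivative (\<lambda>_. 0)) (at z)" by simp
    then have "(f has_derivative (\<lambda>_. 0)) (at z)"
      by (rule has_derivative_transform_within_open[of _ _ _ _ "- K"])
         (use K that in \<open>auto simp: compact_imp_closed open_Compl\<close>)
    then show ?thesis by (simp add: dir_deriv_eq)
  qed
  moreover have "C_k k (dir_deriv e f)" for k using K(1)[of "Suc k"] by simp
  ultimately show ?thesis by (intro test_functionsI[of _ K]) (use K in auto)
qed

lemma test_functions_has_derivative:
  "f \<in> test_functions (S::real set) \<Longrightarrow> (f has_vector_derivative dir_deriv 1 f x) (at x)"
  by (auto simp: test_functions_def intro: smooth_has_vector_derivative[of 0])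

lemma dir_deriv_test_functions_linear:
  assumes "bounded_linear L" "f \<in> test_functions (S::real set)"
  shows "dir_deriv 1 (\<lambda>x. L (f x)) = (\<lambda>x. L (dir_deriv 1 f x))"
  by (intro ext dir_deriv_1_eq bounded_linear.has_vector_derivative[OF assms(1)]
      test_functions_has_derivative[OF assms(2)])

lemma dir_deriv_test_functions_add:
  assumes "f \<in> test_functions (S::real set)" "g \<in> test_functions S"
  shows "dir_deriv 1 (\<lambda>x. f x + g x) = (\<lambda>x. dir_deriv 1 f x + dir_deriv 1 g x)"
  by (intro ext dir_deriv_1_eq has_vector_derivative_add test_functions_has_derivative[OF assms(1)]
      test_functions_has_derivative[OF assms(2)])

lemma test_functions_continuous: "f \<in> test_functions S \<Longrightarrow> continuous_on A f"
  by (metis C_k.simps(1) continuous_on_subset subset_UNIV test_functionsE)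

lemma test_functions_bounded:
  assumes "f \<in> test_functions S" obtains B where "B > 0" "\<And>x. cmod (f x) \<le> B"
proof -
  from assms obtain K where K: "\<And>k. C_k k f" "compact K" "K \<subseteq> S" "\<And>z. z \<notin> K \<Longrightarrow> f z = 0"
    by (rule test_functionsE) blast
  have "bounded (f ` K)"
    by (intro compact_imp_bounded compact_continuous_image test_functions_continuous[OF assms] K)
  then obtain B where "B > 0" "\<And>x. x \<in> K \<Longrightarrow> cmod (f x) \<le> B"
    by (auto simp: bounded_pos)
  with K(4) show ?thesis by (intro that[of B]) (metis less_imp_le norm_zero)+
qed

text \<open>Products of a function of time and a function of space are the only test functions on space-time
that the uniqueness proof uses.\<close>

lemma tensor_test_function:
  fixes \<eta> :: "'a::euclidean_space \<Rightarrow> complex" and \<xi> :: "'b::euclidean_space \<Rightarrow> complex"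
  assumes "\<eta> \<in> test_functions I" "\<xi> \<in> test_functions S"
  shows "(\<lambda>z. \<eta> (fst z) * \<xi> (snd z)) \<in> test_functions (I \<times> S)"
proof -
  from assms(1) obtain K where K: "\<And>k. C_k k \<eta>" "compact K" "K \<subseteq> I" "\<And>z. z \<notin> K \<Longrightarrow> \<eta> z = 0"
    by (rule test_functionsE) blast
  from assms(2) obtain L where L: "\<And>k. C_k k \<xi>" "compact L" "L \<subseteq> S" "\<And>z. z \<notin> L \<Longrightarrow> \<xi> z = 0"
    by (rule test_functionsE) blast
  have "C_k k (\<lambda>z. \<eta> (fst z) * \<xi> (snd z))" for k
    using C_k_mult[OF C_k_compose_affine[OF bounded_linear_fst K(1)[of k], of 0] C_k_compose_affine[OF bounded_linear_snd L(1)[of k], of 0]]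
    by simp
  then show ?thesis
    by (rule test_functionsI[of _ "K \<times> L"]) (use K L in \<open>force intro: compact_Times\<close>)+
qed

lemma dir_deriv_tensor:
  fixes \<eta> \<xi> :: "real \<Rightarrow> complex"
  assumes "\<eta> \<in> test_functions I" "\<xi> \<in> test_functions S"
  shows "dir_deriv (1, 0) (\<lambda>z. \<eta> (fst z) * \<xi> (snd z)) = (\<lambda>z. dir_deriv 1 \<eta> (fst z) * \<xi> (snd z))"
    and "dir_deriv (0, 1) (\<lambda>z. \<eta> (fst z) * \<xi> (snd z)) = (\<lambda>z. \<eta> (fst z) * dir_deriv 1 \<xi> (snd z))"
proof -
  have 1: "((\<lambda>z. \<eta> (fst z)) has_derivative (\<lambda>h. fst h *\<^sub>R dir_deriv 1 \<eta> (fst z))) (at z)" for z :: "real \<times> real"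
    using has_derivative_compose[OF has_derivative_fst[OF has_derivative_ident]
      test_functions_has_derivative[OF assms(1), unfolded has_vector_derivative_def], of z UNIV] by simp
  have 2: "((\<lambda>z. \<xi> (snd z)) has_derivative (\<lambda>h. snd h *\<^sub>R dir_deriv 1 \<xi> (snd z))) (at z)" for z :: "real \<times> real"
    using has_derivative_compose[OF has_derivative_snd[OF has_derivative_ident]
      test_functions_has_derivative[OF assms(2), unfolded has_vector_derivative_def], of z UNIV] by simp
  note d = has_derivative_mult[OF 1 2]
  show "dir_deriv (1, 0) (\<lambda>z. \<eta> (fst z) * \<xi> (snd z)) = (\<lambda>z. dir_deriv 1 \<eta> (fst z) * \<xi> (snd z))"
    using dir_deriv_eq[OF d] by auto
  show "dir_deriv (0, 1) (\<lambda>z. \<eta> (fst z) * \<xi> (snd z)) = (\<lambda>z. \<eta> (fst z) * dir_deriv 1 \<xi> (snd z))"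
    using dir_deriv_eq[OF d] by auto
qed

text \<open>The \<open>n\<close>-th root of \<open>exp(-1/x)\<close> is \<open>exp(-1/(n x))\<close>, the same flat function at another scale. Products
of two such functions, one for each end point, are test functions supported in the interval, and they
converge to its indicator because \<open>n\<close>-th roots of positive numbers tend to \<open>1\<close>.\<close>

lemma interval_test_functions:
  fixes a b :: real
  assumes "{a..b} \<subseteq> S"
  obtains \<psi> where "\<And>n. \<psi> n \<in> test_functions S" "\<And>n x. cmod (\<psi> n x) \<le> 1"
    "\<And>n x. x \<notin> {a<..<b} \<Longrightarrow> \<psi> n x = 0" "\<And>x. (\<lambda>n. \<psi> n x) \<longlonglongrightarrow> indicator {a<..<b} x"
proof -
  define \<psi> where "\<psi> n x = complex_of_real (flat (real (Suc n) * (x - a)) * flat (real (Suc n) * (b - x)))" for n x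
  have C_k_\<psi>: "C_k k (\<psi> n)" for k n
  proof -
    have "C_k k (\<lambda>x. flat (- (real (Suc n) * a) + real (Suc n) * x))"
      by (intro C_k_compose_affine[of "\<lambda>x. real (Suc n) * x"] C_k_flat_poly bounded_linear_mult_right)
    moreover have "C_k k (\<lambda>x. flat (real (Suc n) * b + (- real (Suc n)) * x))"
      by (intro C_k_compose_affine[of "\<lambda>x. - real (Suc n) * x"] C_k_flat_poly bounded_linear_mult_right)
    ultimately show ?thesis unfolding \<psi>_def
      by (intro C_k_bounded_linear[OF bounded_linear_of_real] C_k_mult) (simp_all add: algebra_simps)
  qed
  have 0: "\<psi> n x = 0" if "x \<notin> {a<..<b}" for n x
    using that by (auto simp: \<psi>_def flat_poly_def zero_less_mult_iff)
  have "\<psi> n \<in> test_functions S" for n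
  proof (rule test_functionsI[OF C_k_\<psi> _ compact_Icc assms])
    show "{z. \<psi> n z \<noteq> 0} \<subseteq> {a..b}" 
    proof
      fix z assume "z \<in> {z. \<psi> n z \<noteq> 0}"
      then have "z \<in> {a<..<b}" using 0[of z n] by blast
      then show "z \<in> {a..b}" by simp
    qed
  qed
  moreover have "cmod (\<psi> n x) \<le> 1" for n x
    using mult_mono[OF flat_range(2) flat_range(2), of "real (Suc n) * (x - a)" "real (Suc n) * (b - x)"] flat_range(1)
    by (simp add: \<psi>_def norm_mult mult.commute)
  moreover have "(\<lambda>n. \<psi> n x) \<longlonglongrightarrow> indicator {a<..<b} x" for x
  proof (cases "x \<in> {a<..<b}")
    case True
    have lim: "(\<lambda>n. flat (real (Suc n) * c)) \<longlonglongrightarrow> 1" if "c > 0" for c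
    proof -
      have "(\<lambda>n. exp (- (inverse (real (Suc n)) * inverse c))) \<longlonglongrightarrow> exp (- (0 * inverse c))"
        by (intro tendsto_intros LIMSEQ_inverse_real_of_nat)
      moreover have "flat (real (Suc n) * c) = exp (- (inverse (real (Suc n)) * inverse c))" for n
        using that unfolding flat_poly_def by (simp add: field_simps zero_less_mult_iff del: of_nat_Suc)
      ultimately show ?thesis by simp
    qed
    have "(\<lambda>n. complex_of_real (flat (real (Suc n) * (x - a)) * flat (real (Suc n) * (b - x)))) \<longlonglongrightarrow> complex_of_real (1 * 1)"
      using True by (intro tendsto_of_real tendsto_mult lim) auto
    then show ?thesis using True by (simp add: \<psi>_def)
  qed (simp add: 0)
  ultimately show ?thesis using 0 that[of \<psi>] by blast
qed

section \<open>Integration on the line and uniqueness of weak derivatives\<close>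

lemma integral_lebesgue_on_eq_lborel:
  fixes f :: "real \<Rightarrow> 'b::{banach, second_countable_topology}"
  assumes "f \<in> borel_measurable borel" "S \<in> sets borel"
  shows "(LINT x|lebesgue_on S. f x) = (LINT x|lborel. indicator S x *\<^sub>R f x)"
proof -
  have "(LINT x|lebesgue_on S. f x) = (LINT x|lebesgue. indicator S x *\<^sub>R f x)"
    using assms by (intro integral_restrict_space) auto
  also have "\<dots> = (LINT x|lborel. indicator S x *\<^sub>R f x)"
    using assms by (intro integral_completion) (measurable, auto)
  finally show ?thesis .
qed

lemma integrable_lebesgue_on_iff_lborel:
  fixes f :: "real \<Rightarrow> 'b::{banach, second_countable_topology}"
  assumes "f \<in> borel_measurable borel" "S \<in> sets borel"
  shows "integrable (lebesgue_on S) f \<longleftrightarrow> integrable lborel (\<lambda>x. indicator S x *\<^sub>R f x)"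
proof -
  have "integrable (lebesgue_on S) f \<longleftrightarrow> integrable lebesgue (\<lambda>x. indicator S x *\<^sub>R f x)"
    using assms by (intro integrable_restrict_space) auto
  also have "\<dots> \<longleftrightarrow> integrable lborel (\<lambda>x. indicator S x *\<^sub>R f x)"
    using assms by (intro integrable_completion) (measurable, auto)
  finally show ?thesis .
qed

lemma borel_measurable_lebesgue_on_continuous:
  "continuous_on UNIV f \<Longrightarrow> (f :: real \<Rightarrow> 'b::{second_countable_topology, banach}) \<in> borel_measurable (lebesgue_on S)"
  by (intro measurable_restrict_space1 measurable_completion borel_measurable_continuous_onI)
     (simp add: borel_measurable_continuous_onI)

lemma continuous_compact_support_integrable:
  fixes f :: "real \<Rightarrow> 'b::{banach, second_countable_topology}"
  assumes f: "continuous_on UNIV f" and K: "compact K" "\<And>x. x \<notin> K \<Longrightarrow> f x = 0"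
  shows "integrable lborel f" "S \<in> sets borel \<Longrightarrow> integrable (lebesgue_on S) f"
proof -
  have "(\<lambda>x. indicator K x *\<^sub>R f x) = f" using K(2) by (auto simp: indicator_def)
  then show i: "integrable lborel f"
    using borel_integrable_compact[OF K(1), of f] f by (auto intro: continuous_on_subset)
  show "integrable (lebesgue_on S) f" if "S \<in> sets borel"
    using integrable_mult_indicator[OF _ i, of S] that f
    by (simp add: integrable_lebesgue_on_iff_lborel borel_measurable_continuous_onI)
qed

lemma has_vector_derivative_0_outside:
  fixes f :: "real \<Rightarrow> 'b::real_normed_vector"
  assumes "closed K" "\<And>y. y \<notin> K \<Longrightarrow> f y = 0" "x \<notin> K"
  shows "(f has_vector_derivative 0) (at x)"
proof -
  have "((\<lambda>_. 0) has_vector_derivative 0) (at x)" by simp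
  then show ?thesis
    by (rule has_vector_derivative_transform_within_open[of _ _ _ "- K"])
       (use assms in \<open>auto simp: open_Compl\<close>)
qed

text \<open>This is the fundamental theorem of calculus on an interval that contains the support in its
interior. It is stated for continuously differentiable functions rather than test functions because it
is also applied to a product with a power of \<open>\<bar>\<phi>\<bar>\<^sup>2 + \<delta>\<close>.\<close>

lemma integral_deriv_compact_support:
  fixes f :: "real \<Rightarrow> 'b::euclidean_space"
  assumes d: "\<And>x. (f has_vector_derivative f' x) (at x)" and f': "continuous_on UNIV f'"
    and K: "compact K" "\<And>x. x \<notin> K \<Longrightarrow> f x = 0" "K \<subseteq> S" and S: "S \<in> sets borel"
  shows "(LINT x|lebesgue_on S. f' x) = 0"
proof -
  obtain a b where ab: "K \<subseteq> {a<..<b}" "a \<le> b"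
  proof -
    obtain B where "\<And>x. x \<in> K \<Longrightarrow> \<bar>x\<bar> \<le> B" using compact_imp_bounded[OF K(1)] by (auto simp: bounded_real)
    then have "K \<subseteq> {- \<bar>B\<bar> - 1<..<\<bar>B\<bar> + 1}" by force
    then show thesis by (intro that[of "- \<bar>B\<bar> - 1" "\<bar>B\<bar> + 1"]) auto
  qed
  have f'0: "f' x = 0" if "x \<notin> K" for x
    by (rule vector_derivative_unique_at[OF d has_vector_derivative_0_outside[OF compact_imp_closed[OF K(1)] K(2) that]])
  have "(LINT x|lebesgue_on S. f' x) = (LINT x|lborel. indicator S x *\<^sub>R f' x)"
    using f' S by (intro integral_lebesgue_on_eq_lborel borel_measurable_continuous_onI) auto
  also have "(\<lambda>x. indicator S x *\<^sub>R f' x) = (\<lambda>x. indicator {a..b} x *\<^sub>R f' x)"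
  proof
    fix x show "indicator S x *\<^sub>R f' x = indicator {a..b} x *\<^sub>R f' x"
      using f'0[of x] K(3) ab(1) by (cases "x \<in> K") (auto simp: indicator_def)
  qed
  also have "(LINT x|lborel. indicator {a..b} x *\<^sub>R f' x) = f b - f a"
    by (rule integral_FTC_atLeastAtMost)
       (use ab d f' in \<open>auto intro: has_vector_derivative_at_within continuous_on_subset\<close>)
  also have "\<dots> = 0"
    using K(2)[of a] K(2)[of b] ab by force
  finally show ?thesis .
qed

lemma test_functions_L2:
  assumes "\<psi> \<in> test_functions \<Omega>" "open \<Omega>" shows "\<psi> \<in> L2 \<Omega>"
proof -
  from assms(1) obtain K where K: "\<And>k. C_k k \<psi>" "compact K" "K \<subseteq> \<Omega>" "\<And>z. z \<notin> K \<Longrightarrow> \<psi> z = 0"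
    by (rule test_functionsE) blast
  note c = test_functions_continuous[OF assms(1)]
  have "integrable (lebesgue_on \<Omega>) (\<lambda>x. (cmod (\<psi> x))\<^sup>2)"
    using K assms(2) by (intro continuous_compact_support_integrable(2)[of _ K] continuous_intros c) auto
  then show ?thesis using c by (simp add: L2_def borel_measurable_lebesgue_on_continuous)
qed

lemma test_functions_integration_by_parts:
  fixes \<Omega> :: "real set"
  assumes "f \<in> test_functions \<Omega>" "g \<in> test_functions \<Omega>" "open \<Omega>"
  shows "(LINT x|lebesgue_on \<Omega>. f x * dir_deriv 1 g x) = - (LINT x|lebesgue_on \<Omega>. dir_deriv 1 f x * g x)"
proof -
  note d = test_functions_deriv[OF assms(1), of 1] test_functions_deriv[OF assms(2), of 1]
  from assms(1) obtain K where K: "\<And>k. C_k k f" "compact K" "K \<subseteq> \<Omega>" "\<And>z. z \<notin> K \<Longrightarrow> f z = 0"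
    by (rule test_functionsE) blast
  have "(LINT x|lebesgue_on \<Omega>. f x * dir_deriv 1 g x + dir_deriv 1 f x * g x) = 0"
    using K assms(3)
    by (intro integral_deriv_compact_support[of "\<lambda>x. f x * g x" _ K] continuous_intros
         test_functions_continuous[OF assms(1)] test_functions_continuous[OF assms(2)]
         test_functions_continuous[OF d(1)] test_functions_continuous[OF d(2)]
         has_vector_derivative_mult test_functions_has_derivative[OF assms(1)] test_functions_has_derivative[OF assms(2)]) auto
  also have "(LINT x|lebesgue_on \<Omega>. f x * dir_deriv 1 g x + dir_deriv 1 f x * g x)
     = (LINT x|lebesgue_on \<Omega>. f x * dir_deriv 1 g x) + (LINT x|lebesgue_on \<Omega>. dir_deriv 1 f x * g x)"
    by (intro Bochner_Integration.integral_add L2_integrable_mult test_functions_L2[OF _ assms(3)] assms d)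
  finally show ?thesis by (simp add: eq_neg_iff_add_eq_0)
qed

lemma sigma_finite_lebesgue: "sigma_finite_measure (lebesgue :: real measure)"
proof
  show "\<exists>A. countable A \<and> A \<subseteq> sets (lebesgue :: real measure) \<and> \<Union>A = space lebesgue \<and>
      (\<forall>a\<in>A. emeasure lebesgue a \<noteq> \<infinity>)"
  proof (intro exI conjI ballI)
    show "countable (range (\<lambda>n. {- real n..real n}))" by simp
    show "range (\<lambda>n. {- real n..real n}) \<subseteq> sets lebesgue" by auto
    show "\<Union>(range (\<lambda>n. {- real n..real n})) = space lebesgue"
    proof -
      have "\<exists>n. x \<in> {- real n..real n}" for x
        using real_arch_simple[of "\<bar>x\<bar>"] by (auto simp: abs_le_iff minus_le_iff)
      then show ?thesis by auto
    qed
    show "emeasure lebesgue a \<noteq> \<infinity>" if "a \<in> range (\<lambda>n. {- real n..real n})" for a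
      using that by (auto simp: emeasure_lborel_Icc_eq)
  qed
qed

text \<open>The Borel sets over which the integral of \<open>f\<close> vanishes form a Dynkin system that contains the
intervals, hence all Borel sets; and a Lebesgue set differs from a Borel set by a null set.\<close>

lemma AE_zero_of_intervals:
  fixes f :: "real \<Rightarrow> complex"
  assumes f: "integrable lebesgue f"
    and 0: "\<And>a b. (LINT x|lebesgue. indicator {a<..<b} x *\<^sub>R f x) = 0"
  shows "AE x in lebesgue. f x = 0"
proof (rule sigma_finite_measure.density_zero[OF sigma_finite_lebesgue f])
  have int: "set_integrable lebesgue A f" if "A \<in> sets lebesgue" for A
    using integrable_mult_indicator[OF that f] by (simp add: set_integrable_def)
  have borel: "set_lebesgue_integral lebesgue A f = 0" if "A \<in> sets borel" for A
  proof -
    have total: "(LINT x|lebesgue. f x) = 0"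
    proof -
      have "(\<lambda>n. LINT x|lebesgue. indicator {- real n<..<real n} x *\<^sub>R f x) \<longlonglongrightarrow> (LINT x|lebesgue. f x)"
      proof (rule integral_dominated_convergence[where w = "\<lambda>x. norm (f x)"])
        show "AE x in lebesgue. (\<lambda>n. indicator {- real n<..<real n} x *\<^sub>R f x) \<longlonglongrightarrow> f x"
        proof (intro AE_I2 tendsto_eventually)
          fix x :: real
          obtain N where "\<bar>x\<bar> < real N" using reals_Archimedean2 by blast
          then show "\<forall>\<^sub>F n in sequentially. indicator {- real n<..<real n} x *\<^sub>R f x = f x"
            by (intro eventually_sequentiallyI[of N]) (auto simp: indicator_def)
        qed
        show "(\<lambda>x. indicator {- real n<..<real n} x *\<^sub>R f x) \<in> borel_measurable lebesgue" for n
          by (rule borel_measurable_integrable[OF integrable_mult_indicator[OF _ f]]) auto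
      qed (use f in \<open>auto simp: indicator_def\<close>)
      then show ?thesis by (simp add: 0 LIMSEQ_const_iff)
    qed
    have "Int_stable (range (\<lambda>(a, b). box a b :: real set))"
      by (auto simp: Int_stable_def box_Int_box)
    moreover have "range (\<lambda>(a, b). box a b :: real set) \<subseteq> Pow UNIV" by simp
    moreover have "A \<in> sigma_sets UNIV (range (\<lambda>(a, b). box a b :: real set))"
      using that by (simp add: borel_eq_box)
    ultimately show ?thesis
    proof (induct rule: sigma_sets_induct_disjoint)
      case (basic A)
      then show ?case using 0 by (auto simp: set_lebesgue_integral_def box_real)
    next
      case (compl A)
      then have A: "A \<in> sets borel" by (simp add: borel_eq_box)
      have "set_lebesgue_integral lebesgue (A \<union> (UNIV - A)) f =
        set_lebesgue_integral lebesgue A f + set_lebesgue_integral lebesgue (UNIV - A) f"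
        using A by (intro set_integral_Un int) auto
      moreover have "A \<union> (UNIV - A) = UNIV" by auto
      ultimately show ?case using compl total by (simp add: set_lebesgue_integral_def)
    next
      case (union A)
      have "A i \<in> sets borel" for i
        using subsetD[OF union(2), of "A i"] by (simp add: borel_eq_box)
      then have A: "A i \<in> sets lebesgue" for i by simp
      have "set_lebesgue_integral lebesgue (\<Union>i. A i) f = (\<Sum>i. set_lebesgue_integral lebesgue (A i) f)"
        using A union by (intro lebesgue_integral_countable_add int) (auto simp: disjoint_family_on_def)
      then show ?case using union by simp
    qed (simp add: set_lebesgue_integral_def)
  qed
  fix A :: "real set" assume A: "A \<in> sets lebesgue"
  have "AE x in lebesgue. x \<in> A \<longleftrightarrow> x \<in> main_part lborel A"
    using AE_notin_null_part[OF A, THEN AE_completion]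
  proof eventually_elim
    case (elim x)
    then show ?case using main_part_null_part_Un[OF A] by blast
  qed
  then have "set_lebesgue_integral lebesgue A f = set_lebesgue_integral lebesgue (main_part lborel A) f"
    using borel_measurable_integrable[OF int[unfolded set_integrable_def, OF A]]
      borel_measurable_integrable[OF int[unfolded set_integrable_def, of "main_part lborel A"]] main_part_sets[OF A]
    by (intro set_integral_cong_set) (auto simp: set_borel_measurable_def)
  then show "set_lebesgue_integral lebesgue A f = 0" using borel[of "main_part lborel A"] main_part_sets[OF A] by simp
qed

lemma L2_indicator:
  fixes a b :: real
  assumes "open \<Omega>" shows "indicator {a..b} \<in> L2 \<Omega>" "indicator {a<..<b} \<in> L2 \<Omega>"
proof -
  have "indicator J \<in> L2 \<Omega>" if J: "J \<in> sets borel" "emeasure lborel J < \<infinity>" for J :: "real set"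
  proof -
    have [measurable]: "J \<in> sets lebesgue" using J by auto
    have "(indicator J :: real \<Rightarrow> complex) \<in> borel_measurable (lebesgue_on \<Omega>)"
      by (intro measurable_restrict_space1) measurable
    moreover have "(\<lambda>x. (cmod (indicator J x))\<^sup>2) = (indicator J :: real \<Rightarrow> real)"
      by (auto simp: indicator_def)
    moreover have "integrable (lebesgue_on \<Omega>) (indicator J :: real \<Rightarrow> real)"
    proof -
      have "integrable lborel (indicator J :: real \<Rightarrow> real)"
        by (rule integrable_real_indicator) (use J in simp_all)
      moreover have "\<Omega> \<in> sets lborel" using assms by simp
      ultimately have "integrable lborel (\<lambda>x. indicator \<Omega> x *\<^sub>R indicator J x :: real)"
        by (rule integrable_mult_indicator[rotated])
      then show ?thesis using J assms by (subst integrable_lebesgue_on_iff_lborel) simp_all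
    qed
    ultimately show ?thesis by (simp add: L2_def)
  qed
  moreover have "emeasure lborel {a..b} < \<infinity>" "emeasure lborel {a<..<b} < \<infinity>"
    by (rule emeasure_bounded_finite, simp)+
  ultimately show "indicator {a..b} \<in> L2 \<Omega>" "indicator {a<..<b} \<in> L2 \<Omega>" by auto
qed

text \<open>Approximating indicators of intervals by test functions shows that \<open>g\<close> has vanishing integral over
every compact interval in \<open>\<Omega>\<close>. Countably many such intervals cover \<open>\<Omega>\<close>.\<close>

lemma fundamental_lemma_calculus_of_variations:
  assumes g: "g \<in> L2 \<Omega>" and \<Omega>: "open \<Omega>"
    and 0: "\<And>\<psi>. \<psi> \<in> test_functions \<Omega> \<Longrightarrow> (LINT x|lebesgue_on \<Omega>. g x * \<psi> x) = 0"
  shows "AE x in lebesgue_on \<Omega>. g x = 0"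
proof -
  have int0: "(LINT x|lebesgue_on \<Omega>. g x * indicator {a<..<b} x) = 0" if ab: "{a..b} \<subseteq> \<Omega>" for a b
  proof -
    obtain \<psi> where \<psi>: "\<And>n. \<psi> n \<in> test_functions \<Omega>" "\<And>n x. cmod (\<psi> n x) \<le> 1"
      "\<And>n x. x \<notin> {a<..<b} \<Longrightarrow> \<psi> n x = 0" "\<And>x. (\<lambda>n. \<psi> n x) \<longlonglongrightarrow> indicator {a<..<b} x"
      by (rule interval_test_functions[OF ab]) blast
    have "(\<lambda>n. LINT x|lebesgue_on \<Omega>. g x * \<psi> n x) \<longlonglongrightarrow> (LINT x|lebesgue_on \<Omega>. g x * indicator {a<..<b} x)"
    proof (rule integral_dominated_convergence[where w = "\<lambda>x. cmod (g x) * cmod (indicator {a<..<b} x)"])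
      show "AE x in lebesgue_on \<Omega>. (\<lambda>n. g x * \<psi> n x) \<longlonglongrightarrow> g x * indicator {a<..<b} x"
        by (intro AE_I2 tendsto_intros \<psi>)
      show "AE x in lebesgue_on \<Omega>. norm (g x * \<psi> n x) \<le> cmod (g x) * cmod (indicator {a<..<b} x)" for n
      proof (rule AE_I2)
        fix x show "norm (g x * \<psi> n x) \<le> cmod (g x) * cmod (indicator {a<..<b} x)"
          using \<psi>(2)[of n x] \<psi>(3)[of x n] by (auto simp: norm_mult indicator_def mult_left_le)
      qed
      show "integrable (lebesgue_on \<Omega>) (\<lambda>x. cmod (g x) * cmod (indicator {a<..<b} x))"
        by (intro L2_integrable_norm_mult g L2_indicator \<Omega>)
      show "(\<lambda>x. g x * indicator {a<..<b} x) \<in> borel_measurable (lebesgue_on \<Omega>)"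
        using L2_integrable_mult[OF g L2_indicator(2)[OF \<Omega>, of a b]] by (rule borel_measurable_integrable)
      show "(\<lambda>x. g x * \<psi> n x) \<in> borel_measurable (lebesgue_on \<Omega>)" for n
        using L2_integrable_mult[OF g test_functions_L2[OF \<psi>(1) \<Omega>]] by (rule borel_measurable_integrable)
    qed
    then show ?thesis using 0[OF \<psi>(1)] by (simp add: LIMSEQ_const_iff)
  qed
  have loc: "AE x in lebesgue. x \<in> {a..b} \<longrightarrow> g x = 0" if ab: "{a..b} \<subseteq> \<Omega>" for a b
  proof -
    define f where "f x = indicator \<Omega> x *\<^sub>R (g x * indicator {a<..<b} x)" for x
    have f: "integrable lebesgue f"
      using L2_integrable_mult[OF g L2_indicator(2)[OF \<Omega>, of a b]] \<Omega>
      by (simp add: integrable_restrict_space f_def[abs_def])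
    have "AE x in lebesgue. f x = 0"
    proof (rule AE_zero_of_intervals[OF f])
      fix c d :: real
      have "indicator {c<..<d} x *\<^sub>R f x = indicator \<Omega> x *\<^sub>R (g x * indicator {max a c<..<min b d} x)" for x
        by (auto simp: f_def indicator_def)
      then have "(LINT x|lebesgue. indicator {c<..<d} x *\<^sub>R f x)
         = (LINT x|lebesgue_on \<Omega>. g x * indicator {max a c<..<min b d} x)"
        using \<Omega> by (simp add: integral_restrict_space)
      also have "\<dots> = 0" using ab by (intro int0) auto
      finally show "(LINT x|lebesgue. indicator {c<..<d} x *\<^sub>R f x) = 0" .
    qed
    moreover have "AE x in lebesgue. x \<noteq> a" "AE x in lebesgue. x \<noteq> b"
      by (auto intro!: AE_completion AE_lborel_singleton)
    ultimately show ?thesis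
    proof eventually_elim
      case (elim x)
      then show ?case using ab by (cases "x \<in> \<Omega>") (auto simp: f_def indicator_def split: if_splits)
    qed
  qed
  obtain \<D> where D: "countable \<D>" "\<D> \<subseteq> Pow \<Omega>" "\<And>X. X \<in> \<D> \<Longrightarrow> \<exists>a b. X = cbox a b" "\<Union>\<D> = \<Omega>"
    using open_countable_Union_open_cbox[OF \<Omega>] by metis
  have "AE x in lebesgue. \<forall>X\<in>\<D>. x \<in> X \<longrightarrow> g x = 0"
  proof (rule AE_ball_countable[THEN iffD2, OF D(1)], rule ballI)
    fix X assume X: "X \<in> \<D>"
    with D(3) obtain a b where "X = {a..b}" by fastforce
    with X D(2) loc[of a b] show "AE x in lebesgue. x \<in> X \<longrightarrow> g x = 0" by auto
  qed
  then show ?thesis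
    using \<Omega> D(4) by (auto simp: AE_restrict_space_iff elim!: eventually_mono)
qed

lemma weak_deriv_unique:
  assumes "has_L2_weak_deriv \<Omega> f g" "has_L2_weak_deriv \<Omega> f h" "open \<Omega>"
  shows "AE x in lebesgue_on \<Omega>. g x = h x"
proof -
  have gh: "g \<in> L2 \<Omega>" "h \<in> L2 \<Omega>" using assms by (auto simp: has_L2_weak_deriv_def)
  have "AE x in lebesgue_on \<Omega>. g x - h x = 0"
  proof (rule fundamental_lemma_calculus_of_variations[OF L2_diff[OF gh] assms(3)])
    fix \<psi> assume \<psi>: "\<psi> \<in> test_functions \<Omega>"
    note L = test_functions_L2[OF \<psi> assms(3)]
    have "(LINT x|lebesgue_on \<Omega>. (g x - h x) * \<psi> x) = (LINT x|lebesgue_on \<Omega>. g x * \<psi> x) - (LINT x|lebesgue_on \<Omega>. h x * \<psi> x)"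
      using L2_integrable_mult[OF gh(1) L] L2_integrable_mult[OF gh(2) L] by (simp add: left_diff_distrib)
    also have "\<dots> = 0"
      using assms(1,2) \<psi> by (auto simp: has_L2_weak_deriv_def)
    finally show "(LINT x|lebesgue_on \<Omega>. (g x - h x) * \<psi> x) = 0" .
  qed
  then show ?thesis by simp
qed

lemma has_weak_deriv_weak_deriv: "f \<in> H1 \<Omega> \<Longrightarrow> has_L2_weak_deriv \<Omega> f (weak_deriv \<Omega> f)"
  using someI_ex[of "has_L2_weak_deriv \<Omega> f"] by (simp add: weak_deriv_def H1_def)

section \<open>\<open>H\<^sup>1\<^sub>0\<close> as a space of limits of test functions\<close>

text \<open>The derivative \<open>g\<close> is carried along, so that statements about \<open>(f, g)\<close> pass to the limit from
test functions without reference to the chosen representative of the weak derivative.\<close>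

definition H1_0_grad :: "real set \<Rightarrow> (real \<Rightarrow> complex) \<Rightarrow> (real \<Rightarrow> complex) \<Rightarrow> bool"
  where "H1_0_grad \<Omega> f g \<longleftrightarrow> (\<exists>\<psi>. (\<forall>n. \<psi> n \<in> test_functions \<Omega>) \<and>
    L2_tendsto \<Omega> \<psi> f \<and> L2_tendsto \<Omega> (\<lambda>n. dir_deriv 1 (\<psi> n)) g)"

lemma H1_0_gradE:
  assumes "H1_0_grad \<Omega> f g"
  obtains \<psi> where "\<And>n. \<psi> n \<in> test_functions \<Omega>" "L2_tendsto \<Omega> \<psi> f" "L2_tendsto \<Omega> (\<lambda>n. dir_deriv 1 (\<psi> n)) g"
  using assms unfolding H1_0_grad_def by blast

lemma H1_0_grad_L2: "H1_0_grad \<Omega> f g \<Longrightarrow> f \<in> L2 \<Omega>" "H1_0_grad \<Omega> f g \<Longrightarrow> g \<in> L2 \<Omega>"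
  unfolding H1_0_grad_def using L2_tendstoD(2) by blast+

lemma H1_0_grad_test:
  assumes "\<psi> \<in> test_functions \<Omega>" "open \<Omega>" shows "H1_0_grad \<Omega> \<psi> (dir_deriv 1 \<psi>)"
  unfolding H1_0_grad_def
proof (intro exI[of _ "\<lambda>_. \<psi>"] conjI allI)
  show "L2_tendsto \<Omega> (\<lambda>_. \<psi>) \<psi>"
    by (rule L2_tendsto_const[OF test_functions_L2[OF assms]])
  show "L2_tendsto \<Omega> (\<lambda>_. dir_deriv 1 \<psi>) (dir_deriv 1 \<psi>)"
    by (rule L2_tendsto_const[OF test_functions_L2[OF test_functions_deriv[OF assms(1)] assms(2)]])
qed (rule assms)

lemma H1_0_grad_scale:
  assumes "H1_0_grad \<Omega> f g" shows "H1_0_grad \<Omega> (\<lambda>x. c * f x) (\<lambda>x. c * g x)"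
proof -
  obtain \<psi> where \<psi>: "\<And>n. \<psi> n \<in> test_functions \<Omega>" "L2_tendsto \<Omega> \<psi> f" "L2_tendsto \<Omega> (\<lambda>n. dir_deriv 1 (\<psi> n)) g"
    by (rule H1_0_gradE[OF assms]) blast
  have "L2_tendsto \<Omega> (\<lambda>n. dir_deriv 1 (\<lambda>x. c * \<psi> n x)) (\<lambda>x. c * g x)"
    unfolding dir_deriv_test_functions_linear[OF bounded_linear_mult_right \<psi>(1)]
    by (rule L2_tendsto_scale[OF \<psi>(3)])
  then show ?thesis
    unfolding H1_0_grad_def using L2_tendsto_scale[OF \<psi>(2), of c] test_functions_scale[OF \<psi>(1), of c]
    by (intro exI[of _ "\<lambda>n x. c * \<psi> n x"]) simp
qed

lemma H1_0_grad_cnj: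
  assumes "H1_0_grad \<Omega> f g" shows "H1_0_grad \<Omega> (\<lambda>x. cnj (f x)) (\<lambda>x. cnj (g x))"
proof -
  obtain \<psi> where \<psi>: "\<And>n. \<psi> n \<in> test_functions \<Omega>" "L2_tendsto \<Omega> \<psi> f" "L2_tendsto \<Omega> (\<lambda>n. dir_deriv 1 (\<psi> n)) g"
    by (rule H1_0_gradE[OF assms]) blast
  have "L2_tendsto \<Omega> (\<lambda>n. dir_deriv 1 (\<lambda>x. cnj (\<psi> n x))) (\<lambda>x. cnj (g x))"
    unfolding dir_deriv_test_functions_linear[OF bounded_linear_cnj \<psi>(1)]
    by (rule L2_tendsto_cnj[OF \<psi>(3)])
  then show ?thesis
    unfolding H1_0_grad_def using L2_tendsto_cnj[OF \<psi>(2)] test_functions_cnj[OF \<psi>(1)]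
    by (intro exI[of _ "\<lambda>n x. cnj (\<psi> n x)"]) simp
qed

lemma H1_0_grad_add:
  assumes "H1_0_grad \<Omega> f g" "H1_0_grad \<Omega> f2 g2"
  shows "H1_0_grad \<Omega> (\<lambda>x. f x + f2 x) (\<lambda>x. g x + g2 x)"
proof -
  obtain \<psi> where \<psi>: "\<And>n. \<psi> n \<in> test_functions \<Omega>" "L2_tendsto \<Omega> \<psi> f" "L2_tendsto \<Omega> (\<lambda>n. dir_deriv 1 (\<psi> n)) g"
    by (rule H1_0_gradE[OF assms(1)]) blast
  obtain \<theta> where \<theta>: "\<And>n. \<theta> n \<in> test_functions \<Omega>" "L2_tendsto \<Omega> \<theta> f2" "L2_tendsto \<Omega> (\<lambda>n. dir_deriv 1 (\<theta> n)) g2"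
    by (rule H1_0_gradE[OF assms(2)]) blast
  have "L2_tendsto \<Omega> (\<lambda>n. dir_deriv 1 (\<lambda>x. \<psi> n x + \<theta> n x)) (\<lambda>x. g x + g2 x)"
    unfolding dir_deriv_test_functions_add[OF \<psi>(1) \<theta>(1)]
    by (rule L2_tendsto_add[OF \<psi>(3) \<theta>(3)])
  then show ?thesis
    unfolding H1_0_grad_def using L2_tendsto_add[OF \<psi>(2) \<theta>(2)] test_functions_add[OF \<psi>(1) \<theta>(1)]
    by (intro exI[of _ "\<lambda>n x. \<psi> n x + \<theta> n x"]) simp
qed

lemma H1_0_grad_diff:
  assumes "H1_0_grad \<Omega> f g" "H1_0_grad \<Omega> f2 g2"
  shows "H1_0_grad \<Omega> (\<lambda>x. f x - f2 x) (\<lambda>x. g x - g2 x)"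
  using H1_0_grad_add[OF assms(1) H1_0_grad_scale[OF assms(2), of "-1"]] by simp

text \<open>Integration by parts against a fixed test function is continuous in \<open>L\<^sup>2\<close>.\<close>

lemma H1_0_grad_has_weak_deriv:
  assumes "H1_0_grad \<Omega> f g" "open \<Omega>" shows "has_L2_weak_deriv \<Omega> f g"
  unfolding has_L2_weak_deriv_def
proof (intro conjI ballI)
  show "g \<in> L2 \<Omega>" by (rule H1_0_grad_L2[OF assms(1)])
  fix \<theta> assume \<theta>: "\<theta> \<in> test_functions \<Omega>"
  obtain \<psi> where \<psi>: "\<And>n. \<psi> n \<in> test_functions \<Omega>" "L2_tendsto \<Omega> \<psi> f" "L2_tendsto \<Omega> (\<lambda>n. dir_deriv 1 (\<psi> n)) g"
    by (rule H1_0_gradE[OF assms(1)]) blast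
  have "(\<lambda>n. LINT x|lebesgue_on \<Omega>. \<psi> n x * dir_deriv 1 \<theta> x) \<longlonglongrightarrow> (LINT x|lebesgue_on \<Omega>. f x * dir_deriv 1 \<theta> x)"
    by (rule L2_tendsto_integral_mult[OF \<psi>(2) L2_tendsto_const[OF test_functions_L2[OF test_functions_deriv[OF \<theta>] assms(2)]]])
  moreover have "(\<lambda>n. - (LINT x|lebesgue_on \<Omega>. dir_deriv 1 (\<psi> n) x * \<theta> x)) \<longlonglongrightarrow> - (LINT x|lebesgue_on \<Omega>. g x * \<theta> x)"
    by (rule tendsto_minus[OF L2_tendsto_integral_mult[OF \<psi>(3) L2_tendsto_const[OF test_functions_L2[OF \<theta> assms(2)]]]])
  moreover have "(LINT x|lebesgue_on \<Omega>. \<psi> n x * dir_deriv 1 \<theta> x) = - (LINT x|lebesgue_on \<Omega>. dir_deriv 1 (\<psi> n) x * \<theta> x)" for n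
    by (rule test_functions_integration_by_parts[OF \<psi>(1) \<theta> assms(2)])
  ultimately show "(LINT x|lebesgue_on \<Omega>. f x * dir_deriv 1 \<theta> x) = - (LINT x|lebesgue_on \<Omega>. g x * \<theta> x)"
    using LIMSEQ_unique by auto
qed

lemma weak_deriv_eq_AE:
  assumes "has_L2_weak_deriv \<Omega> f g" "f \<in> L2 \<Omega>" "open \<Omega>"
  shows "AE x in lebesgue_on \<Omega>. weak_deriv \<Omega> f x = g x" "weak_deriv \<Omega> f \<in> L2 \<Omega>"
    "H1_norm \<Omega> f = sqrt ((L2_norm \<Omega> f)\<^sup>2 + (L2_norm \<Omega> g)\<^sup>2)"
proof -
  have "f \<in> H1 \<Omega>" using assms by (auto simp: H1_def)
  note w = has_weak_deriv_weak_deriv[OF this]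
  show ae: "AE x in lebesgue_on \<Omega>. weak_deriv \<Omega> f x = g x"
    by (rule weak_deriv_unique[OF w assms(1,3)])
  show L: "weak_deriv \<Omega> f \<in> L2 \<Omega>" using w by (simp add: has_L2_weak_deriv_def)
  have "L2_norm \<Omega> (weak_deriv \<Omega> f) = L2_norm \<Omega> g"
    using assms(1) by (intro L2_norm_cong_AE L2_meas[OF L] ae L2_meas[of g]) (simp add: has_L2_weak_deriv_def)
  then show "H1_norm \<Omega> f = sqrt ((L2_norm \<Omega> f)\<^sup>2 + (L2_norm \<Omega> g)\<^sup>2)" by (simp add: H1_norm_def)
qed

lemma H1_0_grad_weak_deriv:
  assumes "H1_0_grad \<Omega> f g" "open \<Omega>"
  shows "AE x in lebesgue_on \<Omega>. weak_deriv \<Omega> f x = g x" "weak_deriv \<Omega> f \<in> L2 \<Omega>"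
    "H1_norm \<Omega> f = sqrt ((L2_norm \<Omega> f)\<^sup>2 + (L2_norm \<Omega> g)\<^sup>2)"
  using weak_deriv_eq_AE[OF H1_0_grad_has_weak_deriv[OF assms] H1_0_grad_L2(1)[OF assms(1)] assms(2)] by auto

lemma has_L2_weak_deriv_diff:
  assumes "has_L2_weak_deriv \<Omega> f g" "has_L2_weak_deriv \<Omega> f2 g2" "f \<in> L2 \<Omega>" "f2 \<in> L2 \<Omega>" "open \<Omega>"
  shows "has_L2_weak_deriv \<Omega> (\<lambda>x. f x - f2 x) (\<lambda>x. g x - g2 x)"
  unfolding has_L2_weak_deriv_def
proof (intro conjI ballI)
  have g: "g \<in> L2 \<Omega>" "g2 \<in> L2 \<Omega>" using assms by (auto simp: has_L2_weak_deriv_def)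
  then show "(\<lambda>x. g x - g2 x) \<in> L2 \<Omega>" by (rule L2_diff)
  fix \<theta> assume \<theta>: "\<theta> \<in> test_functions \<Omega>"
  note L = test_functions_L2[OF \<theta> assms(5)] test_functions_L2[OF test_functions_deriv[OF \<theta>, of 1] assms(5)]
  show "(LINT x|lebesgue_on \<Omega>. (f x - f2 x) * dir_deriv 1 \<theta> x) = - (LINT x|lebesgue_on \<Omega>. (g x - g2 x) * \<theta> x)"
    using assms(1,2) \<theta> L2_integrable_mult[OF assms(3) L(2)] L2_integrable_mult[OF assms(4) L(2)]
      L2_integrable_mult[OF g(1) L(1)] L2_integrable_mult[OF g(2) L(1)]
    by (simp add: has_L2_weak_deriv_def left_diff_distrib)
qed

lemma le_sqrt_sum_squares: "a \<le> sqrt (a\<^sup>2 + b\<^sup>2)" "b \<le> sqrt (a\<^sup>2 + b\<^sup>2)" for a b :: real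
  by (auto intro: real_le_rsqrt)

text \<open>The norm \<open>H1_norm (f - \<psi>)\<close> involves some representative of the weak derivative of the difference;
by uniqueness it is the difference of the derivatives almost everywhere.\<close>

lemma H1_0_imp_grad:
  assumes f: "f \<in> H1_0 \<Omega>" and \<Omega>: "open \<Omega>"
  shows "H1_0_grad \<Omega> f (weak_deriv \<Omega> f)"
proof -
  from f have f1: "f \<in> L2 \<Omega>" "f \<in> H1 \<Omega>" by (auto simp: H1_0_def H1_def)
  note w = has_weak_deriv_weak_deriv[OF f1(2)]
  have "\<exists>\<psi>\<in>test_functions \<Omega>. H1_norm \<Omega> (\<lambda>x. f x - \<psi> x) < 1 / real (Suc n)" for n
    using f by (simp add: H1_0_def)
  then obtain \<psi> where \<psi>: "\<And>n. \<psi> n \<in> test_functions \<Omega>" "\<And>n. H1_norm \<Omega> (\<lambda>x. f x - \<psi> n x) < 1 / real (Suc n)"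
    by metis
  note L = test_functions_L2[OF \<psi>(1) \<Omega>] test_functions_L2[OF test_functions_deriv[OF \<psi>(1), of 1] \<Omega>]
  have W: "weak_deriv \<Omega> f \<in> L2 \<Omega>" using w by (simp add: has_L2_weak_deriv_def)
  have H: "H1_norm \<Omega> (\<lambda>x. f x - \<psi> n x) = sqrt ((L2_norm \<Omega> (\<lambda>x. f x - \<psi> n x))\<^sup>2
      + (L2_norm \<Omega> (\<lambda>x. weak_deriv \<Omega> f x - dir_deriv 1 (\<psi> n) x))\<^sup>2)" for n
    by (rule weak_deriv_eq_AE(3)[OF has_L2_weak_deriv_diff[OF w H1_0_grad_has_weak_deriv[OF H1_0_grad_test[OF \<psi>(1) \<Omega>] \<Omega>]
         f1(1) L(1) \<Omega>] L2_diff[OF f1(1) L(1)] \<Omega>])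
  have lim: "(\<lambda>n. 1 / real (Suc n)) \<longlonglongrightarrow> 0"
    using LIMSEQ_inverse_real_of_nat by (simp add: inverse_eq_divide)
  have b1: "norm (L2_norm \<Omega> (\<lambda>x. \<psi> n x - f x)) \<le> 1 / real (Suc n)" for n
    using order_trans[OF le_sqrt_sum_squares(1) less_imp_le[OF \<psi>(2)[of n, unfolded H]]]
    by (simp add: L2_norm_minus_commute[of \<Omega> f])
  have b2: "norm (L2_norm \<Omega> (\<lambda>x. dir_deriv 1 (\<psi> n) x - weak_deriv \<Omega> f x)) \<le> 1 / real (Suc n)" for n
    using order_trans[OF le_sqrt_sum_squares(2) less_imp_le[OF \<psi>(2)[of n, unfolded H]]]
    by (simp add: L2_norm_minus_commute[of \<Omega> "weak_deriv \<Omega> f"])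
  have "L2_tendsto \<Omega> \<psi> f" "L2_tendsto \<Omega> (\<lambda>n. dir_deriv 1 (\<psi> n)) (weak_deriv \<Omega> f)"
    unfolding L2_tendsto_def
    using L f1(1) W Lim_null_comparison[OF always_eventually[OF allI[OF b1]] lim]
      Lim_null_comparison[OF always_eventually[OF allI[OF b2]] lim] by auto
  with \<psi>(1) show ?thesis unfolding H1_0_grad_def by blast
qed

lemma H1_0_gradI:
  assumes fg: "H1_0_grad \<Omega> f g" and \<Omega>: "open \<Omega>" shows "f \<in> H1_0 \<Omega>"
proof -
  obtain \<psi> where \<psi>: "\<And>n. \<psi> n \<in> test_functions \<Omega>" "L2_tendsto \<Omega> \<psi> f" "L2_tendsto \<Omega> (\<lambda>n. dir_deriv 1 (\<psi> n)) g"
    by (rule H1_0_gradE[OF fg]) blast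
  have H: "H1_norm \<Omega> (\<lambda>x. f x - \<psi> n x) = sqrt ((L2_norm \<Omega> (\<lambda>x. \<psi> n x - f x))\<^sup>2
      + (L2_norm \<Omega> (\<lambda>x. dir_deriv 1 (\<psi> n) x - g x))\<^sup>2)" for n
    using H1_0_grad_weak_deriv(3)[OF H1_0_grad_diff[OF fg H1_0_grad_test[OF \<psi>(1) \<Omega>]] \<Omega>, of n]
    by (simp add: L2_norm_minus_commute[of _ f] L2_norm_minus_commute[of _ g])
  have "(\<lambda>n. H1_norm \<Omega> (\<lambda>x. f x - \<psi> n x)) \<longlonglongrightarrow> sqrt (0\<^sup>2 + 0\<^sup>2)"
    unfolding H by (intro tendsto_intros L2_tendstoD(3)[OF \<psi>(2)] L2_tendstoD(3)[OF \<psi>(3)])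
  then have lim: "(\<lambda>n. H1_norm \<Omega> (\<lambda>x. f x - \<psi> n x)) \<longlonglongrightarrow> 0" by simp
  have "\<exists>\<psi>\<in>test_functions \<Omega>. H1_norm \<Omega> (\<lambda>x. f x - \<psi> x) < \<epsilon>" if "\<epsilon> > 0" for \<epsilon>
  proof -
    have "eventually (\<lambda>n. H1_norm \<Omega> (\<lambda>x. f x - \<psi> n x) < \<epsilon>) sequentially"
      using order_tendstoD(2)[OF lim that] .
    then obtain n where "H1_norm \<Omega> (\<lambda>x. f x - \<psi> n x) < \<epsilon>" by (auto simp: eventually_sequentially)
    then show ?thesis using \<psi>(1) by blast
  qed
  moreover have "f \<in> H1 \<Omega>"
    using H1_0_grad_has_weak_deriv[OF fg \<Omega>] H1_0_grad_L2[OF fg] by (auto simp: H1_def)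
  ultimately show ?thesis by (simp add: H1_0_def)
qed

lemma H1_norm_le: "H1_0_grad \<Omega> f g \<Longrightarrow> open \<Omega> \<Longrightarrow> H1_norm \<Omega> f \<le> L2_norm \<Omega> f + L2_norm \<Omega> g"
  using H1_0_grad_weak_deriv(3)[of \<Omega> f g] sqrt_sum_squares_le_sum[of "L2_norm \<Omega> f" "L2_norm \<Omega> g"] by simp

lemma L2_norm_le_H1_norm:
  "H1_0_grad \<Omega> f g \<Longrightarrow> open \<Omega> \<Longrightarrow> L2_norm \<Omega> f \<le> H1_norm \<Omega> f"
  "H1_0_grad \<Omega> f g \<Longrightarrow> open \<Omega> \<Longrightarrow> L2_norm \<Omega> g \<le> H1_norm \<Omega> f"
  using H1_0_grad_weak_deriv(3)[of \<Omega> f g] le_sqrt_sum_squares by auto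

text \<open>Integrate \<open>(\<bar>\<psi>\<bar>\<^sup>2)' = 2 \<psi> \<bullet> \<psi>' \<le> \<bar>\<psi>\<bar>\<^sup>2 + \<bar>\<psi>'\<bar>\<^sup>2\<close> from a point to the left of the support.\<close>

lemma test_function_sup_bound:
  assumes \<psi>: "\<psi> \<in> test_functions \<Omega>" and \<Omega>: "open \<Omega>"
  shows "cmod (\<psi> x) \<le> sqrt ((L2_norm \<Omega> \<psi>)\<^sup>2 + (L2_norm \<Omega> (dir_deriv 1 \<psi>))\<^sup>2)"
proof (rule real_le_rsqrt)
  let ?d = "dir_deriv 1 \<psi>"
  obtain K where K: "\<And>k. C_k k \<psi>" "compact K" "K \<subseteq> \<Omega>" "\<And>z. z \<notin> K \<Longrightarrow> \<psi> z = 0"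
    using \<psi> by (rule test_functionsE) blast
  obtain B where B: "\<And>y. y \<in> K \<Longrightarrow> \<bar>y\<bar> \<le> B" using compact_imp_bounded[OF K(2)] by (auto simp: bounded_real)
  \<comment> \<open>A point to the left of both \<open>x\<close> and the support.\<close>
  define a where "a = min x (- \<bar>B\<bar> - 1)"
  have a: "a \<le> x" "\<psi> a = 0" using B[of a] K(4)[of a] by (force simp: a_def)+
  have c\<psi>: "continuous_on A \<psi>" for A by (rule test_functions_continuous[OF \<psi>])
  have cd: "continuous_on A ?d" for A by (rule test_functions_continuous[OF test_functions_deriv[OF \<psi>]])
  have dK: "?d y = 0" if "y \<notin> K" for y
    by (rule vector_derivative_unique_at[OF test_functions_has_derivative[OF \<psi>]
          has_vector_derivative_0_outside[OF compact_imp_closed[OF K(2)] K(4) that]])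
  define q where "q y = (cmod (\<psi> y))\<^sup>2 + (cmod (?d y))\<^sup>2" for y
  have cq: "continuous_on A q" for A unfolding q_def by (intro continuous_intros c\<psi> cd)
  have q0: "q y = 0" if "y \<notin> K" for y using that K(4) dK by (simp add: q_def)
  have iq: "integrable lborel q" "integrable (lebesgue_on \<Omega>) q"
    using continuous_compact_support_integrable[OF cq K(2) q0] \<Omega> by auto
  have d: "((\<lambda>y. \<psi> y \<bullet> \<psi> y) has_vector_derivative (\<psi> y \<bullet> ?d y + ?d y \<bullet> \<psi> y)) (at y within S)" for y S
    by (rule has_vector_derivative_at_within)
       (rule bounded_bilinear.has_vector_derivative[OF bounded_bilinear_inner test_functions_has_derivative[OF \<psi>] test_functions_has_derivative[OF \<psi>]])
  have cg: "continuous_on A (\<lambda>y. \<psi> y \<bullet> ?d y + ?d y \<bullet> \<psi> y)" for A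
    by (intro continuous_intros c\<psi> cd)
  have "(LINT y|lborel. indicator {a..x} y *\<^sub>R (\<psi> y \<bullet> ?d y + ?d y \<bullet> \<psi> y)) = \<psi> x \<bullet> \<psi> x - \<psi> a \<bullet> \<psi> a"
    by (rule integral_FTC_atLeastAtMost[OF a(1) d cg])
  then have "(cmod (\<psi> x))\<^sup>2 = (LINT y|lborel. indicator {a..x} y *\<^sub>R (\<psi> y \<bullet> ?d y + ?d y \<bullet> \<psi> y))"
    using a by (simp add: power2_norm_eq_inner)
  also have "\<dots> \<le> (LINT y|lborel. q y)"
  proof (rule integral_mono)
    show "integrable lborel (\<lambda>y. indicator {a..x} y *\<^sub>R (\<psi> y \<bullet> ?d y + ?d y \<bullet> \<psi> y))"
      by (rule borel_integrable_compact[OF compact_Icc cg])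
    fix y
    have "\<psi> y \<bullet> ?d y + ?d y \<bullet> \<psi> y \<le> 2 * (cmod (\<psi> y) * cmod (?d y))"
      using Cauchy_Schwarz_ineq2[of "\<psi> y" "?d y"] by (simp add: inner_commute)
    also have "\<dots> \<le> q y"
      using sum_squares_bound[of "cmod (\<psi> y)" "cmod (?d y)"] by (simp add: q_def)
    finally show "indicator {a..x} y *\<^sub>R (\<psi> y \<bullet> ?d y + ?d y \<bullet> \<psi> y) \<le> q y"
      by (cases "y \<in> {a..x}") (auto simp: q_def)
  qed (rule iq)
  also have "(LINT y|lborel. q y) = (LINT y|lborel. indicator \<Omega> y *\<^sub>R q y)"
    by (rule Bochner_Integration.integral_cong) (use q0 K(3) in \<open>auto simp: indicator_def\<close>)
  also have "\<dots> = (LINT y|lebesgue_on \<Omega>. q y)"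
    using \<Omega> by (intro integral_lebesgue_on_eq_lborel[symmetric] borel_measurable_continuous_onI cq) auto
  also have "\<dots> = (L2_norm \<Omega> \<psi>)\<^sup>2 + (L2_norm \<Omega> ?d)\<^sup>2"
    using L2_integrable_square[OF test_functions_L2[OF \<psi> \<Omega>]]
      L2_integrable_square[OF test_functions_L2[OF test_functions_deriv[OF \<psi>] \<Omega>], of 1]
    by (simp add: q_def L2_norm_power2)
  finally show "(cmod (\<psi> x))\<^sup>2 \<le> (L2_norm \<Omega> \<psi>)\<^sup>2 + (L2_norm \<Omega> ?d)\<^sup>2" .
qed

text \<open>Fatou's lemma, applied to \<open>\<bar>\<psi> n - f\<bar>\<^sup>2\<close>.\<close>

lemma L2_tendsto_AE_unique:
  assumes f: "L2_tendsto \<Omega> \<psi> f" and F: "F \<in> borel_measurable (lebesgue_on \<Omega>)" "\<And>x. (\<lambda>n. \<psi> n x) \<longlonglongrightarrow> F x"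
  shows "AE x in lebesgue_on \<Omega>. f x = F x"
proof -
  note m = L2_meas[OF L2_tendstoD(1)[OF f]] L2_meas[OF L2_tendstoD(2)[OF f]]
  have meas: "(\<lambda>x. ennreal ((cmod (\<psi> n x - f x))\<^sup>2)) \<in> borel_measurable (lebesgue_on \<Omega>)" for n
    using m(1)[of n] m(2) by measurable
  have "(\<integral>\<^sup>+x. ennreal ((cmod (F x - f x))\<^sup>2) \<partial>lebesgue_on \<Omega>)
      = (\<integral>\<^sup>+x. liminf (\<lambda>n. ennreal ((cmod (\<psi> n x - f x))\<^sup>2)) \<partial>lebesgue_on \<Omega>)"
  proof (rule nn_integral_cong)
    fix x
    have "(\<lambda>n. ennreal ((cmod (\<psi> n x - f x))\<^sup>2)) \<longlonglongrightarrow> ennreal ((cmod (F x - f x))\<^sup>2)"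
      by (intro tendsto_ennrealI tendsto_intros F(2))
    then show "ennreal ((cmod (F x - f x))\<^sup>2) = liminf (\<lambda>n. ennreal ((cmod (\<psi> n x - f x))\<^sup>2))"
      using lim_imp_Liminf[OF sequentially_bot] by metis
  qed
  also have "\<dots> \<le> liminf (\<lambda>n. \<integral>\<^sup>+x. ennreal ((cmod (\<psi> n x - f x))\<^sup>2) \<partial>lebesgue_on \<Omega>)"
    by (rule nn_integral_liminf[OF meas])
  also have "(\<lambda>n. \<integral>\<^sup>+x. ennreal ((cmod (\<psi> n x - f x))\<^sup>2) \<partial>lebesgue_on \<Omega>) = (\<lambda>n. ennreal ((L2_norm \<Omega> (\<lambda>x. \<psi> n x - f x))\<^sup>2))"
    unfolding L2_norm_power2
    by (intro ext nn_integral_eq_integral L2_integrable_square L2_diff L2_tendstoD(1)[OF f] L2_tendstoD(2)[OF f]) simp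
  also have "liminf \<dots> = 0"
  proof -
    have "(\<lambda>n. ennreal ((L2_norm \<Omega> (\<lambda>x. \<psi> n x - f x))\<^sup>2)) \<longlonglongrightarrow> ennreal (0\<^sup>2)"
      by (intro tendsto_ennrealI tendsto_intros L2_tendstoD(3)[OF f])
    then show ?thesis using lim_imp_Liminf[OF sequentially_bot] by fastforce
  qed
  finally have "(\<integral>\<^sup>+x. ennreal ((cmod (F x - f x))\<^sup>2) \<partial>lebesgue_on \<Omega>) = 0" by simp
  moreover have "(\<lambda>x. ennreal ((cmod (F x - f x))\<^sup>2)) \<in> borel_measurable (lebesgue_on \<Omega>)"
    using F(1) m(2) by measurable
  ultimately have "AE x in lebesgue_on \<Omega>. ennreal ((cmod (F x - f x))\<^sup>2) = 0"
    by (simp add: nn_integral_0_iff_AE)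
  then show ?thesis by eventually_elim (simp add: ennreal_eq_0_iff)
qed

text \<open>By the bound of the supremum, test functions that converge in \<open>H\<^sup>1\<close> converge uniformly on the whole
line. Their limit is continuous, vanishes outside \<open>\<Omega>\<close>, and inherits the fundamental theorem of
calculus.\<close>

lemma H1_0_continuous_representative:
  assumes fg: "H1_0_grad \<Omega> f g" and \<Omega>: "open \<Omega>"
  obtains F where "continuous_on UNIV F" "\<And>x. cmod (F x) \<le> H1_norm \<Omega> f"
    "AE x in lebesgue_on \<Omega>. f x = F x" "\<And>x. x \<notin> \<Omega> \<Longrightarrow> F x = 0"
    "\<And>a b. a \<le> b \<Longrightarrow> {a..b} \<subseteq> \<Omega> \<Longrightarrow> F b - F a = (LINT x|lebesgue_on \<Omega>. indicator {a..b} x * g x)"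
proof -
  obtain \<psi> where \<psi>: "\<And>n. \<psi> n \<in> test_functions \<Omega>" "L2_tendsto \<Omega> \<psi> f" "L2_tendsto \<Omega> (\<lambda>n. dir_deriv 1 (\<psi> n)) g"
    by (rule H1_0_gradE[OF fg]) blast
  note t = L2_tendstoD[OF \<psi>(2)] L2_tendstoD[OF \<psi>(3)]
  define e where "e n = L2_norm \<Omega> (\<lambda>x. \<psi> n x - f x) + L2_norm \<Omega> (\<lambda>x. dir_deriv 1 (\<psi> n) x - g x)" for n
  have e: "e \<longlonglongrightarrow> 0" unfolding e_def using tendsto_add[OF t(3) t(6)] by simp
  have diff: "cmod (\<psi> n x - \<psi> m x) \<le> e n + e m" for n m x
  proof -
    have test: "(\<lambda>x. \<psi> n x + (-1) * \<psi> m x) \<in> test_functions \<Omega>"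
      by (intro test_functions_add test_functions_scale \<psi>)
    have dd: "dir_deriv 1 (\<lambda>x. \<psi> n x + (-1) * \<psi> m x) = (\<lambda>x. dir_deriv 1 (\<psi> n) x + (-1) * dir_deriv 1 (\<psi> m) x)"
      unfolding dir_deriv_test_functions_add[OF \<psi>(1) test_functions_scale[OF \<psi>(1)]]
        dir_deriv_test_functions_linear[OF bounded_linear_mult_right \<psi>(1)] by (rule refl)
    have "cmod (\<psi> n x + (-1) * \<psi> m x) \<le> L2_norm \<Omega> (\<lambda>x. \<psi> n x + (-1) * \<psi> m x)
       + L2_norm \<Omega> (\<lambda>x. dir_deriv 1 (\<psi> n) x + (-1) * dir_deriv 1 (\<psi> m) x)"
      using test_function_sup_bound[OF test \<Omega>, of x, unfolded dd]
      by (rule order_trans) (rule sqrt_sum_squares_le_sum, simp_all)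
    also have "\<dots> \<le> e n + e m"
      using L2_norm_triangle_diff[OF L2_diff[OF t(1,2)] L2_diff[OF t(1,2)], of n m]
        L2_norm_triangle_diff[OF L2_diff[OF t(4,5)] L2_diff[OF t(4,5)], of n m]
      by (simp add: e_def)
    finally show ?thesis by simp
  qed
  have "uniformly_Cauchy_on UNIV \<psi>"
  proof (rule uniformly_Cauchy_onI)
    fix \<epsilon> :: real assume "\<epsilon> > 0"
    then obtain N where N: "\<And>n. n \<ge> N \<Longrightarrow> \<bar>e n\<bar> < \<epsilon> / 2"
      using LIMSEQ_D[OF e, of "\<epsilon> / 2"] by auto
    have "dist (\<psi> m x) (\<psi> n x) < \<epsilon>" if "m \<ge> N" "n \<ge> N" for m n x
      using diff[of m x n] N[OF that(1)] N[OF that(2)] by (simp add: dist_norm)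
    then show "\<exists>M. \<forall>x\<in>UNIV. \<forall>m\<ge>M. \<forall>n\<ge>M. dist (\<psi> m x) (\<psi> n x) < \<epsilon>" by blast
  qed
  then have "uniformly_convergent_on UNIV \<psi>" by (rule Cauchy_uniformly_convergent)
  then obtain F where F: "uniform_limit UNIV \<psi> F sequentially" by (auto simp: uniformly_convergent_on_def)
  have pt: "(\<lambda>n. \<psi> n x) \<longlonglongrightarrow> F x" for x by (rule tendsto_uniform_limitI[OF F]) simp
  show ?thesis
  proof (rule that)
    show cF: "continuous_on UNIV F"
      by (rule uniform_limit_theorem[OF _ F]) (simp_all add: test_functions_continuous[OF \<psi>(1)])
    show "AE x in lebesgue_on \<Omega>. f x = F x"
      by (rule L2_tendsto_AE_unique[OF \<psi>(2) borel_measurable_lebesgue_on_continuous[OF cF] pt])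
    show "cmod (F x) \<le> H1_norm \<Omega> f" for x
    proof (rule LIMSEQ_le[OF tendsto_norm[OF pt]])
      show "(\<lambda>n. sqrt ((L2_norm \<Omega> (\<psi> n))\<^sup>2 + (L2_norm \<Omega> (dir_deriv 1 (\<psi> n)))\<^sup>2)) \<longlonglongrightarrow> H1_norm \<Omega> f"
        unfolding H1_0_grad_weak_deriv(3)[OF fg \<Omega>]
        by (intro tendsto_intros L2_tendsto_norm \<psi>)
      show "\<exists>N. \<forall>n\<ge>N. cmod (\<psi> n x) \<le> sqrt ((L2_norm \<Omega> (\<psi> n))\<^sup>2 + (L2_norm \<Omega> (dir_deriv 1 (\<psi> n)))\<^sup>2)"
        using test_function_sup_bound[OF \<psi>(1) \<Omega>] by blast
    qed
    show "F x = 0" if "x \<notin> \<Omega>" for x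
    proof -
      have "\<psi> n x = 0" for n
        using \<psi>(1)[of n] that by (metis subsetD test_functionsE)
      with pt[of x] show ?thesis by (simp add: LIMSEQ_const_iff)
    qed
    fix a b :: real assume ab: "a \<le> b" "{a..b} \<subseteq> \<Omega>"
    have "(\<lambda>n. LINT x|lebesgue_on \<Omega>. indicator {a..b} x * dir_deriv 1 (\<psi> n) x) \<longlonglongrightarrow> (LINT x|lebesgue_on \<Omega>. indicator {a..b} x * g x)"
      by (rule L2_tendsto_integral_mult[OF L2_tendsto_const[OF L2_indicator(1)[OF \<Omega>]] \<psi>(3)])
    moreover have "(LINT x|lebesgue_on \<Omega>. indicator {a..b} x * dir_deriv 1 (\<psi> n) x) = \<psi> n b - \<psi> n a" for n
    proof -
      have "(LINT x|lebesgue_on \<Omega>. indicator {a..b} x * dir_deriv 1 (\<psi> n) x)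
        = (LINT x|lebesgue. indicator \<Omega> x *\<^sub>R (indicator {a..b} x * dir_deriv 1 (\<psi> n) x))"
        using \<Omega> by (intro integral_restrict_space) auto
      also have "\<dots> = (LINT x|lebesgue. indicator {a..b} x *\<^sub>R dir_deriv 1 (\<psi> n) x)"
        by (rule Bochner_Integration.integral_cong) (use ab in \<open>auto simp: indicator_def\<close>)
      also have "\<dots> = (LINT x|lborel. indicator {a..b} x *\<^sub>R dir_deriv 1 (\<psi> n) x)"
        by (rule integral_completion)
          (use borel_measurable_continuous_onI[OF test_functions_continuous[OF test_functions_deriv[OF \<psi>(1)]]] in measurable)
      also have "\<dots> = \<psi> n b - \<psi> n a"
        by (rule integral_FTC_atLeastAtMost[OF ab(1) has_vector_derivative_at_within[OF test_functions_has_derivative[OF \<psi>(1)]]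
              test_functions_continuous[OF test_functions_deriv[OF \<psi>(1)]]])
      finally show ?thesis .
    qed
    ultimately show "F b - F a = (LINT x|lebesgue_on \<Omega>. indicator {a..b} x * g x)"
      using LIMSEQ_unique[OF _ tendsto_diff[OF pt pt]] by simp
  qed
qed

lemma H1_0_AE_bound:
  assumes "H1_0_grad \<Omega> f g" "open \<Omega>"
  shows "AE x in lebesgue_on \<Omega>. cmod (f x) \<le> H1_norm \<Omega> f"
proof -
  obtain F where F: "\<And>x. cmod (F x) \<le> H1_norm \<Omega> f" "AE x in lebesgue_on \<Omega>. f x = F x"
    by (rule H1_0_continuous_representative[OF assms]) blast
  from F(2) show ?thesis by eventually_elim (simp add: F(1))
qed

section \<open>Means of functions with finite Gagliardo seminorm\<close>

text \<open>The inner integral of the Gagliardo seminorm. Its value at a single point \<open>x\<close> controls the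
oscillation of \<open>g\<close> around \<open>x\<close>, which makes pointwise estimates possible.\<close>

definition gagliardo_density :: "real set \<Rightarrow> (real \<Rightarrow> complex) \<Rightarrow> real \<Rightarrow> ennreal"
  where "gagliardo_density \<Omega> g x = (\<integral>\<^sup>+y. ennreal ((cmod (g x - g y))\<^sup>2 / \<bar>x - y\<bar>\<^sup>2) \<partial>lebesgue_on \<Omega>)"

lemma gagliardo_eq: "gagliardo \<Omega> g = (\<integral>\<^sup>+x. gagliardo_density \<Omega> g x \<partial>lebesgue_on \<Omega>)"
  by (simp add: gagliardo_def gagliardo_density_def)

lemma borel_measurable_gagliardo_density:
  assumes g: "g \<in> borel_measurable (lebesgue_on \<Omega>)" and \<Omega>: "open \<Omega>"
  shows "gagliardo_density \<Omega> g \<in> borel_measurable (lebesgue_on \<Omega>)"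
proof -
  have [measurable]: "g \<in> borel_measurable (lebesgue_on \<Omega>)" by (rule g)
  have [measurable]: "(\<lambda>x. x) \<in> borel_measurable (lebesgue_on \<Omega>)"
    by (rule borel_measurable_lebesgue_on_continuous) (rule continuous_on_id)
  have sf: "sigma_finite_measure (lebesgue_on \<Omega>)"
    using \<Omega> by (intro sigma_finite_measure_restrict_space sigma_finite_lebesgue) auto
  have "case_prod (\<lambda>x y. ennreal ((cmod (g x - g y))\<^sup>2 / \<bar>x - y\<bar>\<^sup>2)) \<in> borel_measurable (lebesgue_on \<Omega> \<Otimes>\<^sub>M lebesgue_on \<Omega>)"
    by measurable
  from sigma_finite_measure.borel_measurable_nn_integral[OF sf this]
  show ?thesis by (simp add: gagliardo_density_def[abs_def])
qed

lemma integral_indicator_Icc: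
  assumes "{a..b} \<subseteq> \<Omega>" "a \<le> b" "open \<Omega>"
  shows "(LINT x|lebesgue_on \<Omega>. indicator {a..b} x * c) = complex_of_real (b - a) * c"
    and "(L2_norm \<Omega> (indicator {a..b}))\<^sup>2 = b - a"
proof -
  have r: "(LINT x|lebesgue_on \<Omega>. indicator {a..b} x) = b - a"
  proof -
    have "(LINT x|lebesgue_on \<Omega>. indicator {a..b} x) = (LINT x|lborel. indicator \<Omega> x *\<^sub>R (indicator {a..b} x :: real))"
      using assms by (intro integral_lebesgue_on_eq_lborel) auto
    also have "(\<lambda>x. indicator \<Omega> x *\<^sub>R (indicator {a..b} x :: real)) = indicator {a..b}"
      using assms by (auto simp: indicator_def fun_eq_iff)
    also have "(LINT x|lborel. indicator {a..b} x) = b - a" using assms by simp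
    finally show ?thesis .
  qed
  have "(LINT x|lebesgue_on \<Omega>. indicator {a..b} x * c) = (LINT x|lebesgue_on \<Omega>. indicator {a..b} x *\<^sub>R c)"
    by (rule Bochner_Integration.integral_cong) (auto simp: indicator_def)
  also have "\<dots> = (LINT x|lebesgue_on \<Omega>. indicator {a..b} x) *\<^sub>R c"
  proof (rule integral_scaleR_left)
    have "integrable (lebesgue_on \<Omega>) (\<lambda>x. (cmod (indicator {a..b} x))\<^sup>2)"
      by (rule L2_integrable_square[OF L2_indicator(1)[OF assms(3)]])
    also have "(\<lambda>x. (cmod (indicator {a..b} x))\<^sup>2) = indicator {a..b}" by (auto simp: indicator_def)
    finally show "integrable (lebesgue_on \<Omega>) (\<lambda>x. indicator {a..b} x :: real)" .
  qed
  finally show "(LINT x|lebesgue_on \<Omega>. indicator {a..b} x * c) = complex_of_real (b - a) * c"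
    unfolding r by (simp add: scaleR_conv_of_real)
  have "(\<lambda>x. (cmod (indicator {a..b} x))\<^sup>2) = indicator {a..b}" by (auto simp: indicator_def)
  then show "(L2_norm \<Omega> (indicator {a..b}))\<^sup>2 = b - a"
    unfolding L2_norm_power2 using r by simp
qed

definition interval_mean :: "real set \<Rightarrow> (real \<Rightarrow> complex) \<Rightarrow> real \<Rightarrow> real \<Rightarrow> complex"
  where "interval_mean \<Omega> g a b = (LINT x|lebesgue_on \<Omega>. indicator {a..b} x * g x) / complex_of_real (b - a)"

lemma mean_diff:
  assumes "g1 \<in> L2 \<Omega>" "g2 \<in> L2 \<Omega>" "open \<Omega>"
  shows "interval_mean \<Omega> (\<lambda>x. g1 x - g2 x) a b = interval_mean \<Omega> g1 a b - interval_mean \<Omega> g2 a b"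
  using L2_integrable_mult[OF L2_indicator(1)[OF assms(3)] assms(1), of a b]
    L2_integrable_mult[OF L2_indicator(1)[OF assms(3)] assms(2), of a b]
  by (simp add: interval_mean_def right_diff_distrib diff_divide_distrib)

lemma mean_bound:
  assumes g: "g \<in> L2 \<Omega>" and J: "{a..b} \<subseteq> \<Omega>" "a < b" "open \<Omega>"
  shows "(cmod (interval_mean \<Omega> g a b))\<^sup>2 \<le> (L2_norm \<Omega> g)\<^sup>2 / (b - a)"
proof -
  have "(cmod (LINT x|lebesgue_on \<Omega>. indicator {a..b} x * g x))\<^sup>2 \<le> (L2_norm \<Omega> (indicator {a..b}) * L2_norm \<Omega> g)\<^sup>2"
    by (intro power_mono L2_integral_mult_le L2_indicator J g) simp
  also have "\<dots> = (b - a) * (L2_norm \<Omega> g)\<^sup>2"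
    using J by (simp add: power_mult_distrib integral_indicator_Icc(2))
  finally show ?thesis
    using J by (simp add: interval_mean_def norm_divide power_divide divide_simps power2_eq_square mult.commute del: of_real_diff)
qed

text \<open>The mean minimises the quadratic deviation; here only the Cauchy-Schwarz inequality for
\<open>1 \<cdot> (g - c)\<close> on the interval is needed. The right-hand side may be compared with Gagliardo
integrals, hence the extended nonnegative reals.\<close>

lemma mean_variance:
  assumes g: "g \<in> L2 \<Omega>" and J: "{a..b} \<subseteq> \<Omega>" "a < b" "open \<Omega>"
  shows "ennreal ((cmod (interval_mean \<Omega> g a b - c))\<^sup>2) \<le>
    ennreal (1 / (b - a)) * (\<integral>\<^sup>+x. indicator {a..b} x * ennreal ((cmod (g x - c))\<^sup>2) \<partial>lebesgue_on \<Omega>)"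
proof -
  \<comment> \<open>The deviation \<open>g - c\<close> cut off to the interval; \<open>c\<close> itself need not be square integrable on \<open>\<Omega>\<close>.\<close>
  define k where "k x = indicator {a..b} x * g x - c * indicator {a..b} x" for x
  have i: "(\<lambda>x. indicator {a..b} x * g x) \<in> L2 \<Omega>"
    by (rule L2_mult_bounded(1)[OF g L2_meas[OF L2_indicator(1)[OF J(3)]], where K = 1]) (auto simp: indicator_def)
  have k: "k \<in> L2 \<Omega>"
    unfolding k_def by (intro L2_diff i L2_scale L2_indicator J)
  have "interval_mean \<Omega> k a b = interval_mean \<Omega> g a b - c"
  proof -
    have "(LINT x|lebesgue_on \<Omega>. indicator {a..b} x * k x) = (LINT x|lebesgue_on \<Omega>. indicator {a..b} x * g x - indicator {a..b} x * c)"
      by (rule Bochner_Integration.integral_cong) (auto simp: k_def indicator_def)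
    also have "\<dots> = (LINT x|lebesgue_on \<Omega>. indicator {a..b} x * g x) - (LINT x|lebesgue_on \<Omega>. indicator {a..b} x * c)"
    proof (rule Bochner_Integration.integral_diff[OF L2_integrable_mult[OF L2_indicator(1)[OF J(3)] g]])
      have "(\<lambda>x. indicator {a..b} x * c) = (\<lambda>x. indicator {a..b} x * (c * indicator {a..b} x))"
        by (auto simp: indicator_def)
      then show "integrable (lebesgue_on \<Omega>) (\<lambda>x. indicator {a..b} x * c)"
        using L2_integrable_mult[OF L2_indicator(1)[OF J(3)] L2_scale[OF L2_indicator(1)[OF J(3)]]] by metis
    qed
    finally have eq: "(LINT x|lebesgue_on \<Omega>. indicator {a..b} x * k x) =
        (LINT x|lebesgue_on \<Omega>. indicator {a..b} x * g x) - complex_of_real (b - a) * c"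
      unfolding integral_indicator_Icc(1)[OF J(1) less_imp_le[OF J(2)] J(3)] .
    show ?thesis
      unfolding interval_mean_def eq using J by (simp add: diff_divide_distrib del: of_real_diff)
  qed
  then have "(cmod (interval_mean \<Omega> g a b - c))\<^sup>2 \<le> (L2_norm \<Omega> k)\<^sup>2 / (b - a)"
    using mean_bound[OF k J] by simp
  then have "ennreal ((cmod (interval_mean \<Omega> g a b - c))\<^sup>2) \<le> ennreal (1 / (b - a) * (L2_norm \<Omega> k)\<^sup>2)"
    by (intro ennreal_leI) simp
  also have "\<dots> = ennreal (1 / (b - a)) * ennreal ((L2_norm \<Omega> k)\<^sup>2)"
    using J by (intro ennreal_mult) auto
  also have "ennreal ((L2_norm \<Omega> k)\<^sup>2) = (\<integral>\<^sup>+x. ennreal ((cmod (k x))\<^sup>2) \<partial>lebesgue_on \<Omega>)"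
    unfolding L2_norm_power2 by (rule nn_integral_eq_integral[OF L2_integrable_square[OF k], symmetric]) simp
  also have "\<dots> = (\<integral>\<^sup>+x. indicator {a..b} x * ennreal ((cmod (g x - c))\<^sup>2) \<partial>lebesgue_on \<Omega>)"
    by (rule nn_integral_cong) (auto simp: k_def indicator_def)
  finally show ?thesis .
qed

text \<open>On the interval the weight \<open>1 / \<bar>x - y\<bar>\<^sup>2\<close> is at least \<open>1 / r\<^sup>2\<close>.\<close>

lemma mean_near_point:
  assumes g: "g \<in> L2 \<Omega>" and J: "{a..b} \<subseteq> \<Omega>" "a < b" "open \<Omega>"
    and r: "\<And>y. y \<in> {a..b} \<Longrightarrow> \<bar>x - y\<bar> \<le> r"
  shows "ennreal ((cmod (interval_mean \<Omega> g a b - g x))\<^sup>2) \<le> ennreal (r\<^sup>2 / (b - a)) * gagliardo_density \<Omega> g x"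
proof -
  have [measurable]: "g \<in> borel_measurable (lebesgue_on \<Omega>)" by (rule L2_meas[OF g])
  have [measurable]: "(\<lambda>x. x) \<in> borel_measurable (lebesgue_on \<Omega>)"
    by (rule borel_measurable_lebesgue_on_continuous) (rule continuous_on_id)
  have "ennreal ((cmod (interval_mean \<Omega> g a b - g x))\<^sup>2) \<le>
    ennreal (1 / (b - a)) * (\<integral>\<^sup>+y. indicator {a..b} y * ennreal ((cmod (g y - g x))\<^sup>2) \<partial>lebesgue_on \<Omega>)"
    by (rule mean_variance[OF g J])
  also have "\<dots> \<le> ennreal (1 / (b - a)) * (\<integral>\<^sup>+y. ennreal (r\<^sup>2) * ennreal ((cmod (g x - g y))\<^sup>2 / \<bar>x - y\<bar>\<^sup>2) \<partial>lebesgue_on \<Omega>)"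
  proof (intro mult_left_mono nn_integral_mono)
    fix y
    have "(cmod (g y - g x))\<^sup>2 \<le> r\<^sup>2 * ((cmod (g x - g y))\<^sup>2 / \<bar>x - y\<bar>\<^sup>2)" if y: "y \<in> {a..b}"
    proof (cases "x = y")
      case False
      have "\<bar>x - y\<bar>\<^sup>2 \<le> r\<^sup>2" by (rule power_mono[OF r[OF y]]) simp
      then have "(cmod (g x - g y))\<^sup>2 * \<bar>x - y\<bar>\<^sup>2 \<le> (cmod (g x - g y))\<^sup>2 * r\<^sup>2" by (intro mult_left_mono) auto
      with False show ?thesis by (simp add: divide_simps norm_minus_commute mult.commute)
    qed simp
    then show "indicator {a..b} y * ennreal ((cmod (g y - g x))\<^sup>2) \<le> ennreal (r\<^sup>2) * ennreal ((cmod (g x - g y))\<^sup>2 / \<bar>x - y\<bar>\<^sup>2)"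
      by (cases "y \<in> {a..b}") (auto simp flip: ennreal_mult intro!: ennreal_leI)
  qed simp
  also have "\<dots> = ennreal (1 / (b - a)) * (ennreal (r\<^sup>2) * gagliardo_density \<Omega> g x)"
    unfolding gagliardo_density_def by (subst nn_integral_cmult) measurable
  also have "\<dots> = ennreal (r\<^sup>2 / (b - a)) * gagliardo_density \<Omega> g x"
    using J by (simp add: mult.assoc[symmetric] ennreal_mult[symmetric])
  finally show ?thesis .
qed

text \<open>Two applications of the variance bound: the first with the constant \<open>c\<close> equal to the other mean,
the second at each point \<open>x\<close> of the first interval.\<close>

lemma mean_near_mean:
  assumes g: "g \<in> L2 \<Omega>" and \<Omega>: "open \<Omega>" and J: "{a..b} \<subseteq> \<Omega>" "a < b" and J': "{c..d} \<subseteq> \<Omega>" "c < d"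
    and r: "\<And>x y. x \<in> {a..b} \<Longrightarrow> y \<in> {c..d} \<Longrightarrow> \<bar>x - y\<bar> \<le> r"
  shows "ennreal ((cmod (interval_mean \<Omega> g a b - interval_mean \<Omega> g c d))\<^sup>2) \<le> ennreal (r\<^sup>2 / ((b - a) * (d - c))) *
    (\<integral>\<^sup>+x. indicator {a..b} x * gagliardo_density \<Omega> g x \<partial>lebesgue_on \<Omega>)"
proof -
  have [measurable]: "gagliardo_density \<Omega> g \<in> borel_measurable (lebesgue_on \<Omega>)"
    by (rule borel_measurable_gagliardo_density[OF L2_meas[OF g] \<Omega>])
  have [measurable]: "(indicator {a..b} :: real \<Rightarrow> ennreal) \<in> borel_measurable (lebesgue_on \<Omega>)"
    by (intro measurable_restrict_space1 measurable_completion) measurable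
  have "ennreal ((cmod (interval_mean \<Omega> g a b - interval_mean \<Omega> g c d))\<^sup>2) \<le>
    ennreal (1 / (b - a)) * (\<integral>\<^sup>+x. indicator {a..b} x * ennreal ((cmod (g x - interval_mean \<Omega> g c d))\<^sup>2) \<partial>lebesgue_on \<Omega>)"
    by (rule mean_variance[OF g J \<Omega>])
  also have "\<dots> \<le> ennreal (1 / (b - a)) * (\<integral>\<^sup>+x. ennreal (r\<^sup>2 / (d - c)) * (indicator {a..b} x * gagliardo_density \<Omega> g x) \<partial>lebesgue_on \<Omega>)"
  proof (intro mult_left_mono nn_integral_mono)
    fix x
    show "indicator {a..b} x * ennreal ((cmod (g x - interval_mean \<Omega> g c d))\<^sup>2) \<le> ennreal (r\<^sup>2 / (d - c)) * (indicator {a..b} x * gagliardo_density \<Omega> g x)"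
      using mean_near_point[OF g J' \<Omega>, of x r] r[of x]
      by (cases "x \<in> {a..b}") (auto simp: norm_minus_commute)
  qed simp
  also have "\<dots> = ennreal (1 / (b - a)) * (ennreal (r\<^sup>2 / (d - c)) * (\<integral>\<^sup>+x. indicator {a..b} x * gagliardo_density \<Omega> g x \<partial>lebesgue_on \<Omega>))"
    by (subst nn_integral_cmult) measurable
  also have "\<dots> = ennreal (r\<^sup>2 / ((b - a) * (d - c))) * (\<integral>\<^sup>+x. indicator {a..b} x * gagliardo_density \<Omega> g x \<partial>lebesgue_on \<Omega>)"
    using J J' by (simp add: mult.assoc[symmetric] ennreal_mult[symmetric] mult.commute)
  finally show ?thesis .
qed

text \<open>The square of the \<open>k\<close>-th difference of successive means is at most \<open>c\<close> times the mass of the Gagliardo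
density on the \<open>k\<close>-th interval. As these intervals are disjoint, the squares add up to at most \<open>c G\<close>, and
Cauchy-Schwarz for the sum of \<open>n\<close> differences gives the factor \<open>sqrt n\<close> in place of \<open>n\<close>.\<close>

lemma mean_telescope:
  assumes g: "g \<in> L2 \<Omega>" and \<Omega>: "open \<Omega>" and G: "gagliardo \<Omega> g \<le> ennreal G" "G \<ge> 0"
    and J: "\<And>k. {a k..b k} \<subseteq> \<Omega>" "\<And>k. a k < b k"
    and disj: "\<And>j k. j \<noteq> k \<Longrightarrow> {a j..b j} \<inter> {a k..b k} = {}"
    and r: "\<And>k x y. x \<in> {a k..b k} \<Longrightarrow> y \<in> {a (Suc k)..b (Suc k)} \<Longrightarrow> \<bar>x - y\<bar> \<le> r k"
    and c: "\<And>k. (r k)\<^sup>2 / ((b k - a k) * (b (Suc k) - a (Suc k))) \<le> c" "c \<ge> 0"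
  shows "cmod (interval_mean \<Omega> g (a n) (b n) - interval_mean \<Omega> g (a 0) (b 0)) \<le> sqrt (real n * c * G)"
proof -
  define m where "m k = interval_mean \<Omega> g (a k) (b k)" for k
  have [measurable]: "gagliardo_density \<Omega> g \<in> borel_measurable (lebesgue_on \<Omega>)"
    by (rule borel_measurable_gagliardo_density[OF L2_meas[OF g] \<Omega>])
  have [measurable]: "(indicator {a k..b k} :: real \<Rightarrow> ennreal) \<in> borel_measurable (lebesgue_on \<Omega>)" for k
    by (intro measurable_restrict_space1 measurable_completion) measurable
  have "ennreal (\<Sum>k<n. (cmod (m (Suc k) - m k))\<^sup>2) = (\<Sum>k<n. ennreal ((cmod (m (Suc k) - m k))\<^sup>2))"
    by (simp add: sum_ennreal)
  also have "\<dots> \<le> (\<Sum>k<n. ennreal c * (\<integral>\<^sup>+x. indicator {a k..b k} x * gagliardo_density \<Omega> g x \<partial>lebesgue_on \<Omega>))"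
  proof (rule sum_mono)
    fix k
    have "ennreal ((cmod (m k - m (Suc k)))\<^sup>2) \<le> ennreal ((r k)\<^sup>2 / ((b k - a k) * (b (Suc k) - a (Suc k)))) *
       (\<integral>\<^sup>+x. indicator {a k..b k} x * gagliardo_density \<Omega> g x \<partial>lebesgue_on \<Omega>)"
      unfolding m_def by (rule mean_near_mean[OF g \<Omega> J J r])
    also have "\<dots> \<le> ennreal c * (\<integral>\<^sup>+x. indicator {a k..b k} x * gagliardo_density \<Omega> g x \<partial>lebesgue_on \<Omega>)"
      by (intro mult_right_mono ennreal_leI c) simp
    finally show "ennreal ((cmod (m (Suc k) - m k))\<^sup>2) \<le> ennreal c * (\<integral>\<^sup>+x. indicator {a k..b k} x * gagliardo_density \<Omega> g x \<partial>lebesgue_on \<Omega>)"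
      by (simp add: norm_minus_commute)
  qed
  also have "\<dots> = ennreal c * (\<integral>\<^sup>+x. (\<Sum>k<n. indicator {a k..b k} x * gagliardo_density \<Omega> g x) \<partial>lebesgue_on \<Omega>)"
    by (subst nn_integral_sum) (auto simp: sum_distrib_left)
  also have "\<dots> \<le> ennreal c * gagliardo \<Omega> g"
    unfolding gagliardo_eq
  proof (intro mult_left_mono nn_integral_mono)
    fix x
    show "(\<Sum>k<n. indicator {a k..b k} x * gagliardo_density \<Omega> g x) \<le> gagliardo_density \<Omega> g x"
    proof (cases "\<exists>k<n. x \<in> {a k..b k}")
      case True
      then obtain k where k: "k < n" "x \<in> {a k..b k}" by blast
      have "indicator {a j..b j} x * gagliardo_density \<Omega> g x = (if j = k then gagliardo_density \<Omega> g x else 0)" for j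
        using disj[of j k] k(2) by (auto simp: indicator_def)
      then have "(\<Sum>j<n. indicator {a j..b j} x * gagliardo_density \<Omega> g x) = (\<Sum>j<n. if j = k then gagliardo_density \<Omega> g x else 0)"
        by (intro sum.cong refl)
      also have "\<dots> = gagliardo_density \<Omega> g x" using k(1) by simp
      finally show ?thesis by (rule eq_refl)
    next
      case False
      then have "(\<Sum>j<n. indicator {a j..b j} x * gagliardo_density \<Omega> g x) = 0"
        by (intro sum.neutral ballI) (simp add: indicator_def)
      then show ?thesis by (simp only: zero_le)
    qed
  qed simp
  also have "\<dots> \<le> ennreal c * ennreal G" by (intro mult_left_mono G) simp
  also have "\<dots> = ennreal (c * G)" using c G by (simp add: ennreal_mult)
  finally have S: "(\<Sum>k<n. (cmod (m (Suc k) - m k))\<^sup>2) \<le> c * G"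
    using c(2) G(2) by (simp add: ennreal_le_iff)
  have "cmod (m n - m 0) = cmod (\<Sum>k<n. m (Suc k) - m k)"
    by (simp add: sum_lessThan_telescope)
  also have "\<dots> \<le> (\<Sum>k<n. cmod (m (Suc k) - m k))" by (rule norm_sum)
  finally have "(cmod (m n - m 0))\<^sup>2 \<le> (\<Sum>k<n. cmod (m (Suc k) - m k))\<^sup>2" by (intro power_mono) auto
  also have "\<dots> \<le> real n * (\<Sum>k<n. (cmod (m (Suc k) - m k))\<^sup>2)"
    using sum_squared_le_sum_of_squares[of "\<lambda>k. cmod (m (Suc k) - m k)" "{..<n}"] by (simp add: mult.commute)
  also have "\<dots> \<le> real n * (c * G)" by (intro mult_left_mono S) simp
  finally show ?thesis unfolding m_def by (intro real_le_rsqrt) (simp add: mult.assoc)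
qed

text \<open>The intervals \<open>[x + H k / 2, x + H k]\<close> with \<open>H k = h / 4\<^sup>k\<close>, or their mirror images, are disjoint and
approach \<open>x\<close>. Three errors add up: the mean over the largest interval, bounded by the \<open>L\<^sup>2\<close> norm; the
telescoping sum down to scale \<open>n\<close>; and the distance of \<open>g x\<close> from the mean at scale \<open>n\<close>. Either side of
\<open>x\<close> may be used, which is why an interval \<open>\<Omega>\<close> with end points causes no difficulty.\<close>

lemma pointwise_log_bound:
  assumes g: "g \<in> L2 \<Omega>" and \<Omega>: "open \<Omega>" and G: "gagliardo \<Omega> g \<le> ennreal G" "G \<ge> 0"
    and h: "h > 0" and x: "{x..x+h} \<subseteq> \<Omega> \<or> {x-h..x} \<subseteq> \<Omega>" and q: "gagliardo_density \<Omega> g x = ennreal q" "q \<ge> 0"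
  shows "cmod (g x) \<le> sqrt (2 / h) * L2_norm \<Omega> g + sqrt (16 * real n * G) + sqrt (2 * h / 4 ^ n * q)"
proof -
  \<comment> \<open>The sign \<open>s\<close> records on which side of \<open>x\<close> the intervals lie.\<close>
  obtain s :: real where s: "s = 1 \<and> {x..x+h} \<subseteq> \<Omega> \<or> s = -1 \<and> {x-h..x} \<subseteq> \<Omega>" using x by auto
  define H where "H k = h / 4 ^ k" for k :: nat
  define a where "a k = (if s = 1 then x + H k / 2 else x - H k)" for k
  define b where "b k = (if s = 1 then x + H k else x - H k / 2)" for k
  have Hpos: "H k > 0" for k using h by (simp add: H_def)
  have HS: "H (Suc k) = H k / 4" for k by (simp add: H_def)
  have Hle: "H j \<le> H k / 4" if "k < j" for j k
  proof -
    have "H (Suc k + d) \<le> H (Suc k)" for d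
    proof (induction d)
      case (Suc d)
      then show ?case using Hpos[of "k + d"] by (simp add: HS)
    qed simp
    from this[of "j - Suc k"] that show ?thesis by (simp add: HS)
  qed
  have Hh: "H k \<le> h" for k
    using Hle[of 0 k] Hpos[of k] h by (cases k) (auto simp: H_def)
  have ab: "a k < b k" "b k - a k = H k / 2" for k
    using s Hpos[of k] by (auto simp: a_def b_def)
  have J: "{a k..b k} \<subseteq> \<Omega>" for k
    using s Hpos[of k] Hh[of k] by (auto simp: a_def b_def subset_eq)
  have near: "\<bar>x - y\<bar> \<le> H k" if "y \<in> {a k..b k}" for y k
    using that s Hpos[of k] by (auto simp: a_def b_def split: if_splits)
  have disj': "{a j..b j} \<inter> {a k..b k} = {}" if "k < j" for j k
    using Hle[OF that] s Hpos[of k] Hpos[of j] by (auto simp: a_def b_def split: if_splits)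
  have "cmod (interval_mean \<Omega> g (a n) (b n) - interval_mean \<Omega> g (a 0) (b 0)) \<le> sqrt (real n * 16 * G)"
  proof (rule mean_telescope[OF g \<Omega> G J ab(1), where r = H])
    show "{a j..b j} \<inter> {a k..b k} = {}" if "j \<noteq> k" for j k
      using that disj'[of j k] disj'[of k j] by (metis Int_commute linorder_neqE_nat)
    show "\<bar>u - v\<bar> \<le> H k" if "u \<in> {a k..b k}" "v \<in> {a (Suc k)..b (Suc k)}" for k u v
      using that s Hpos[of k] by (auto simp: a_def b_def HS split: if_splits)
    show "(H k)\<^sup>2 / ((b k - a k) * (b (Suc k) - a (Suc k))) \<le> 16" for k
      using Hpos[of k] by (simp add: ab HS power2_eq_square)
  qed simp
  moreover have "cmod (interval_mean \<Omega> g (a 0) (b 0)) \<le> sqrt (2 / h) * L2_norm \<Omega> g"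
  proof -
    have "cmod (interval_mean \<Omega> g (a 0) (b 0)) \<le> sqrt ((L2_norm \<Omega> g)\<^sup>2 / (b 0 - a 0))"
      by (rule real_le_rsqrt[OF mean_bound[OF g J ab(1) \<Omega>]])
    then show ?thesis by (simp add: ab H_def real_sqrt_divide real_sqrt_mult mult.commute)
  qed
  moreover have "cmod (interval_mean \<Omega> g (a n) (b n) - g x) \<le> sqrt (2 * h / 4 ^ n * q)"
  proof (rule real_le_rsqrt)
    have "ennreal ((cmod (interval_mean \<Omega> g (a n) (b n) - g x))\<^sup>2) \<le> ennreal ((H n)\<^sup>2 / (b n - a n)) * ennreal q"
      using mean_near_point[OF g J ab(1) \<Omega> near, of n] unfolding q(1) .
    also have "\<dots> = ennreal ((H n)\<^sup>2 / (b n - a n) * q)"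
      using q(2) ab(1)[of n] by (intro ennreal_mult[symmetric]) auto
    also have "(H n)\<^sup>2 / (b n - a n) = 2 * h / 4 ^ n"
      using Hpos[of n] by (simp add: ab power2_eq_square) (simp add: H_def)
    finally show "(cmod (interval_mean \<Omega> g (a n) (b n) - g x))\<^sup>2 \<le> 2 * h / 4 ^ n * q"
      using q(2) h by (subst (asm) ennreal_le_iff) auto
  qed
  ultimately show ?thesis
    using norm_triangle_ineq4[of "interval_mean \<Omega> g (a n) (b n)" "interval_mean \<Omega> g (a n) (b n) - g x"]
      norm_triangle_ineq[of "interval_mean \<Omega> g (a n) (b n) - interval_mean \<Omega> g (a 0) (b 0)" "interval_mean \<Omega> g (a 0) (b 0)"]
    by (simp add: mult.commute)
qed

lemma gagliardo_density_finite:
  assumes g: "g \<in> L2 \<Omega>" and \<Omega>: "open \<Omega>" and G: "gagliardo \<Omega> g \<le> ennreal G" "G \<ge> 0"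
  obtains q where "\<And>x. q x \<ge> 0" "AE x in lebesgue_on \<Omega>. gagliardo_density \<Omega> g x = ennreal (q x)"
    "integrable (lebesgue_on \<Omega>) q" "(LINT x|lebesgue_on \<Omega>. q x) \<le> G"
proof -
  define q where "q x = enn2real (gagliardo_density \<Omega> g x)" for x
  have m [measurable]: "gagliardo_density \<Omega> g \<in> borel_measurable (lebesgue_on \<Omega>)"
    by (rule borel_measurable_gagliardo_density[OF L2_meas[OF g] \<Omega>])
  have fin: "gagliardo \<Omega> g \<noteq> \<infinity>" using G by (auto simp: top_unique)
  have ae: "AE x in lebesgue_on \<Omega>. gagliardo_density \<Omega> g x = ennreal (q x)"
    using nn_integral_PInf_AE[OF m] fin unfolding gagliardo_eq q_def
    by (auto elim!: eventually_mono simp: ennreal_enn2real_if)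
  have qm: "q \<in> borel_measurable (lebesgue_on \<Omega>)" unfolding q_def by measurable
  have I: "(\<integral>\<^sup>+x. ennreal (q x) \<partial>lebesgue_on \<Omega>) = gagliardo \<Omega> g"
    unfolding gagliardo_eq by (rule nn_integral_cong_AE) (use ae in \<open>auto elim: eventually_mono\<close>)
  have q0: "q x \<ge> 0" for x by (simp add: q_def)
  have int: "integrable (lebesgue_on \<Omega>) q"
    by (rule integrableI_nonneg[OF qm]) (use I fin q0 in \<open>auto simp: less_top\<close>)
  moreover have "ennreal (LINT x|lebesgue_on \<Omega>. q x) \<le> ennreal G"
    using nn_integral_eq_integral[OF int] q0 I G(1) by simp
  ultimately show ?thesis using that[of q] q0 ae G(2) by (simp add: ennreal_le_iff)
qed

text \<open>Integrating the pointwise bound against \<open>\<bar>z\<bar>\<^sup>2\<close> leaves the term \<open>sqrt q \<bar>z\<bar>\<^sup>2\<close>, which is at most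
\<open>q + \<bar>z\<bar>\<^sup>4 \<le> q + M\<^sup>2 \<bar>z\<bar>\<^sup>2\<close>. This is the replacement for boundedness of \<open>g\<close>.\<close>

lemma log_interpolation:
  assumes g: "g \<in> L2 \<Omega>" and \<Omega>: "open \<Omega>" and G: "gagliardo \<Omega> g \<le> ennreal G" "G \<ge> 0"
    and h: "h > 0" and x: "\<And>x. x \<in> \<Omega> \<Longrightarrow> {x..x+h} \<subseteq> \<Omega> \<or> {x-h..x} \<subseteq> \<Omega>"
    and z: "z \<in> L2 \<Omega>" "AE x in lebesgue_on \<Omega>. cmod (z x) \<le> M"
  shows "(LINT x|lebesgue_on \<Omega>. cmod (g x) * (cmod (z x))\<^sup>2) \<le>
      (sqrt (2 / h) * L2_norm \<Omega> g + sqrt (16 * real n * G) + sqrt (2 * h) * M\<^sup>2) * (L2_norm \<Omega> z)\<^sup>2 + sqrt (2 * h) / 2 ^ n * G"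
proof -
  obtain q where q: "\<And>x. q x \<ge> 0" "AE x in lebesgue_on \<Omega>. gagliardo_density \<Omega> g x = ennreal (q x)"
    "integrable (lebesgue_on \<Omega>) q" "(LINT x|lebesgue_on \<Omega>. q x) \<le> G"
    by (rule gagliardo_density_finite[OF g \<Omega> G]) blast
  define A where "A = sqrt (2 / h) * L2_norm \<Omega> g + sqrt (16 * real n * G)"
  define e where "e = sqrt (2 * h) / 2 ^ n"
  have A0: "A \<ge> 0" using G h by (auto simp: A_def)
  have e0: "e \<ge> 0" "e \<le> sqrt (2 * h)" using h by (auto simp: e_def divide_le_eq mult_le_cancel_left1 one_le_power)
  have se: "sqrt (2 * h / 4 ^ n * y) = e * sqrt y" for y
  proof -
    have "sqrt (4 ^ n) = (2::real) ^ n" by (simp add: real_sqrt_power)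
    then show ?thesis by (simp add: e_def real_sqrt_mult real_sqrt_divide)
  qed
  have "(LINT x|lebesgue_on \<Omega>. cmod (g x) * (cmod (z x))\<^sup>2) \<le> (LINT x|lebesgue_on \<Omega>. (A + sqrt (2 * h) * M\<^sup>2) * (cmod (z x))\<^sup>2 + e * q x)"
  proof (rule integral_mono_AE')
    show "integrable (lebesgue_on \<Omega>) (\<lambda>x. (A + sqrt (2 * h) * M\<^sup>2) * (cmod (z x))\<^sup>2 + e * q x)"
      by (intro Bochner_Integration.integrable_add integrable_mult_right q L2_integrable_square z)
    have "AE x in lebesgue_on \<Omega>. x \<in> \<Omega>" by (rule AE_I2) simp
    then show "AE x in lebesgue_on \<Omega>. cmod (g x) * (cmod (z x))\<^sup>2 \<le> (A + sqrt (2 * h) * M\<^sup>2) * (cmod (z x))\<^sup>2 + e * q x"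
      using q(2) z(2)
    proof eventually_elim
      case (elim y)
      have gy: "cmod (g y) \<le> A + e * sqrt (q y)"
        using pointwise_log_bound[OF g \<Omega> G h x[OF elim(1)] elim(2) q(1), of n] unfolding se A_def .
      have zM: "(cmod (z y))\<^sup>2 \<le> M\<^sup>2" using elim(3) by (intro power_mono) auto
      have "sqrt (q y) * (cmod (z y))\<^sup>2 \<le> q y + (cmod (z y))\<^sup>2 * (cmod (z y))\<^sup>2"
      proof -
        have "2 * (sqrt (q y) * (cmod (z y))\<^sup>2) \<le> q y + ((cmod (z y))\<^sup>2)\<^sup>2"
          using sum_squares_bound[of "sqrt (q y)" "(cmod (z y))\<^sup>2"] q(1)[of y] by simp
        moreover have "sqrt (q y) * (cmod (z y))\<^sup>2 \<ge> 0" using q(1) by simp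
        ultimately show ?thesis unfolding power2_eq_square[of "(cmod (z y))\<^sup>2"] by linarith
      qed
      also have "\<dots> \<le> q y + M\<^sup>2 * (cmod (z y))\<^sup>2" using zM by (intro add_left_mono mult_right_mono) auto
      finally have "e * (sqrt (q y) * (cmod (z y))\<^sup>2) \<le> e * (q y + M\<^sup>2 * (cmod (z y))\<^sup>2)"
        using e0 by (intro mult_left_mono)
      moreover have "e * (M\<^sup>2 * (cmod (z y))\<^sup>2) \<le> sqrt (2 * h) * (M\<^sup>2 * (cmod (z y))\<^sup>2)"
        using e0 by (intro mult_right_mono) auto
      moreover have "cmod (g y) * (cmod (z y))\<^sup>2 \<le> (A + e * sqrt (q y)) * (cmod (z y))\<^sup>2"
        using gy by (intro mult_right_mono) auto
      ultimately show ?case by (simp add: algebra_simps)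
    qed
    show "AE x in lebesgue_on \<Omega>. 0 \<le> (A + sqrt (2 * h) * M\<^sup>2) * (cmod (z x))\<^sup>2 + e * q x"
      using A0 e0 q(1) h by (intro AE_I2) auto
  qed
  also have "\<dots> = (A + sqrt (2 * h) * M\<^sup>2) * (L2_norm \<Omega> z)\<^sup>2 + e * (LINT x|lebesgue_on \<Omega>. q x)"
    using q(3) L2_integrable_square[OF z(1)] by (simp add: L2_norm_power2)
  also have "\<dots> \<le> (A + sqrt (2 * h) * M\<^sup>2) * (L2_norm \<Omega> z)\<^sup>2 + e * G"
    using q(4) e0 by (intro add_left_mono mult_left_mono) auto
  finally show ?thesis by (simp add: A_def e_def)
qed

text \<open>A function on \<open>\<Omega>\<close> continued by \<open>0\<close> may be translated across the boundary.\<close>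

lemma nn_integral_translate_le:
  fixes F :: "real \<Rightarrow> complex"
  assumes F: "continuous_on UNIV F" "\<And>x. x \<notin> \<Omega> \<Longrightarrow> F x = 0" and \<Omega>: "open \<Omega>"
  shows "(\<integral>\<^sup>+x. ennreal ((cmod (F (x + t)))\<^sup>2) \<partial>lebesgue_on \<Omega>) \<le> (\<integral>\<^sup>+x. ennreal ((cmod (F x))\<^sup>2) \<partial>lebesgue_on \<Omega>)"
proof -
  have [measurable]: "F \<in> borel_measurable borel" by (rule borel_measurable_continuous_onI[OF F(1)])
  have conv: "(\<integral>\<^sup>+x. k x \<partial>lebesgue_on \<Omega>) = (\<integral>\<^sup>+x. k x * indicator \<Omega> x \<partial>lborel)" for k :: "real \<Rightarrow> ennreal"
    using \<Omega> by (subst nn_integral_restrict_space) (auto simp: nn_integral_completion)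
  have "(\<integral>\<^sup>+x. ennreal ((cmod (F (x + t)))\<^sup>2) \<partial>lebesgue_on \<Omega>) \<le> (\<integral>\<^sup>+x. ennreal ((cmod (F (t + 1 * x)))\<^sup>2) \<partial>lborel)"
    unfolding conv by (rule nn_integral_mono) (auto simp: indicator_def add.commute)
  also have "\<dots> = (\<integral>\<^sup>+x. ennreal ((cmod (F x))\<^sup>2) \<partial>lborel)"
    using nn_integral_real_affine[of "\<lambda>x. ennreal ((cmod (F x))\<^sup>2)" 1 t] by simp
  also have "\<dots> = (\<integral>\<^sup>+x. ennreal ((cmod (F x))\<^sup>2) \<partial>lebesgue_on \<Omega>)"
    unfolding conv by (rule nn_integral_cong) (use F(2) in \<open>auto simp: indicator_def\<close>)
  finally show ?thesis .
qed

text \<open>The mean of \<open>g\<close> over an interval of length \<open>h\<close> is a difference quotient of the continuous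
representative of \<open>f\<close>, hence controlled by \<open>f / h\<close> in \<open>L\<^sup>2\<close>; the distance of \<open>g\<close> from that mean is
controlled by the Gagliardo seminorm with a factor \<open>sqrt h\<close>. The seminorms are those of the two
terms of a difference, as they are bounded separately.\<close>

lemma gradient_interpolation:
  assumes f: "H1_0_grad \<Omega> f g" and \<Omega>: "open \<Omega>"
    and g12: "AE x in lebesgue_on \<Omega>. g x = g1 x - g2 x" "g1 \<in> L2 \<Omega>" "g2 \<in> L2 \<Omega>"
    and G: "gagliardo \<Omega> g1 \<le> ennreal G" "gagliardo \<Omega> g2 \<le> ennreal G" "G \<ge> 0"
    and h: "h > 0" and x: "\<And>x. x \<in> \<Omega> \<Longrightarrow> {x..x+h} \<subseteq> \<Omega> \<or> {x-h..x} \<subseteq> \<Omega>"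
  shows "(L2_norm \<Omega> g)\<^sup>2 \<le> 6 * h * G + 18 / h\<^sup>2 * (L2_norm \<Omega> f)\<^sup>2"
proof -
  let ?M = "lebesgue_on \<Omega>"
  obtain F where F: "continuous_on UNIV F" "AE x in ?M. f x = F x" "\<And>x. x \<notin> \<Omega> \<Longrightarrow> F x = 0"
    "\<And>a b. a \<le> b \<Longrightarrow> {a..b} \<subseteq> \<Omega> \<Longrightarrow> F b - F a = (LINT x|?M. indicator {a..b} x * g x)"
    by (rule H1_0_continuous_representative[OF f \<Omega>]) blast
  have gL: "g \<in> L2 \<Omega>" and fL: "f \<in> L2 \<Omega>" using H1_0_grad_L2[OF f] by auto
  obtain q1 where q1: "\<And>x. q1 x \<ge> 0" "AE x in ?M. gagliardo_density \<Omega> g1 x = ennreal (q1 x)"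
    "integrable ?M q1" "(LINT x|?M. q1 x) \<le> G"
    by (rule gagliardo_density_finite[OF g12(2) \<Omega> G(1,3)]) blast
  obtain q2 where q2: "\<And>x. q2 x \<ge> 0" "AE x in ?M. gagliardo_density \<Omega> g2 x = ennreal (q2 x)"
    "integrable ?M q2" "(LINT x|?M. q2 x) \<le> G"
    by (rule gagliardo_density_finite[OF g12(3) \<Omega> G(2,3)]) blast
  have mean_eq: "interval_mean \<Omega> g1 a b - interval_mean \<Omega> g2 a b = (F b - F a) / complex_of_real (b - a)"
    if "a \<le> b" "{a..b} \<subseteq> \<Omega>" for a b
  proof -
    have "(LINT x|?M. indicator {a..b} x * g x) = (LINT x|?M. indicator {a..b} x * (g1 x - g2 x))"
    proof (rule integral_cong_AE)
      show "(\<lambda>x. indicator {a..b} x * g x) \<in> borel_measurable ?M"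
        by (rule borel_measurable_integrable[OF L2_integrable_mult[OF L2_indicator(1)[OF \<Omega>] gL]])
      show "(\<lambda>x. indicator {a..b} x * (g1 x - g2 x)) \<in> borel_measurable ?M"
        by (rule borel_measurable_integrable[OF L2_integrable_mult[OF L2_indicator(1)[OF \<Omega>] L2_diff[OF g12(2,3)]]])
      show "AE x in ?M. indicator {a..b} x * g x = indicator {a..b} x * (g1 x - g2 x)"
        using g12(1) by eventually_elim simp
    qed
    with F(4)[OF that] show ?thesis
      unfolding mean_diff[OF g12(2,3) \<Omega>, symmetric] unfolding interval_mean_def by simp
  qed
  \<comment> \<open>The shift by \<open>0\<close> gives all three summands the same form.\<close>
  define P where "P x = (cmod (F (x + h)))\<^sup>2 + (cmod (F (x + - h)))\<^sup>2 + (cmod (F (x + 0)))\<^sup>2" for x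
  have pw: "(cmod (g x))\<^sup>2 \<le> 3 * h * q1 x + 3 * h * q2 x + 6 / h\<^sup>2 * P x"
    if e: "x \<in> \<Omega>" "gagliardo_density \<Omega> g1 x = ennreal (q1 x)" "gagliardo_density \<Omega> g2 x = ennreal (q2 x)" "g x = g1 x - g2 x" for x
  proof -
    obtain a b where ab: "a < b" "b - a = h" "{a..b} \<subseteq> \<Omega>" "\<And>y. y \<in> {a..b} \<Longrightarrow> \<bar>x - y\<bar> \<le> h"
      and P: "2 * ((cmod (F b))\<^sup>2 + (cmod (F a))\<^sup>2) \<le> 2 * P x"
    proof (cases "{x..x+h} \<subseteq> \<Omega>")
      case True
      then show ?thesis by (intro that[of x "x + h"]) (use h in \<open>auto simp: P_def\<close>)
    next
      case False
      then have "{x-h..x} \<subseteq> \<Omega>" using x[OF e(1)] by blast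
      then show ?thesis by (intro that[of "x - h" x]) (use h in \<open>auto simp: P_def\<close>)
    qed
    have near: "(cmod (interval_mean \<Omega> k a b - k x))\<^sup>2 \<le> h * q" 
      if k: "k \<in> L2 \<Omega>" "gagliardo_density \<Omega> k x = ennreal q" "q \<ge> 0" for k q
    proof -
      have "ennreal ((cmod (interval_mean \<Omega> k a b - k x))\<^sup>2) \<le> ennreal (h\<^sup>2 / (b - a)) * ennreal q"
        using mean_near_point[OF k(1) ab(3,1) \<Omega> ab(4)] k(2) by simp
      also have "\<dots> = ennreal (h * q)"
        using k(3) h ab(2) by (simp add: power2_eq_square flip: ennreal_mult)
      finally show ?thesis using k(3) h by (subst (asm) ennreal_le_iff) auto
    qed
    have sq3: "(cmod (u - v + w))\<^sup>2 \<le> 3 * ((cmod u)\<^sup>2 + (cmod v)\<^sup>2 + (cmod w)\<^sup>2)" for u v w :: complex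
    proof -
      have "cmod (u - v + w) \<le> cmod u + cmod v + cmod w"
        by (metis add_mono norm_triangle_ineq norm_triangle_ineq4 order_refl order_trans)
      then have "(cmod (u - v + w))\<^sup>2 \<le> (cmod u + cmod v + cmod w)\<^sup>2" by (intro power_mono) auto
      also have "\<dots> \<le> 3 * ((cmod u)\<^sup>2 + (cmod v)\<^sup>2 + (cmod w)\<^sup>2)"
        using sum_squares_bound[of "cmod u" "cmod v"] sum_squares_bound[of "cmod u" "cmod w"] sum_squares_bound[of "cmod v" "cmod w"]
        by (simp add: power2_eq_square algebra_simps)
      finally show ?thesis .
    qed
    define D where "D = (F b - F a) / complex_of_real (b - a)"
    have "g x = (interval_mean \<Omega> g2 a b - g2 x) - (interval_mean \<Omega> g1 a b - g1 x) + D"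
      using mean_eq[OF less_imp_le[OF ab(1)] ab(3)] e(4) by (simp add: D_def algebra_simps)
    then have "(cmod (g x))\<^sup>2 \<le> 3 * ((cmod (interval_mean \<Omega> g2 a b - g2 x))\<^sup>2 + (cmod (interval_mean \<Omega> g1 a b - g1 x))\<^sup>2 + (cmod D)\<^sup>2)"
      using sq3[of "interval_mean \<Omega> g2 a b - g2 x" "interval_mean \<Omega> g1 a b - g1 x" D] by simp
    also have "\<dots> \<le> 3 * (h * q2 x + h * q1 x + 2 * P x / h\<^sup>2)"
    proof (intro mult_left_mono add_mono near g12 e q1 q2)
      have "(cmod (F b - F a))\<^sup>2 \<le> (cmod (F b) + cmod (F a))\<^sup>2" by (intro power_mono norm_triangle_ineq4) auto
      also have "\<dots> \<le> 2 * ((cmod (F b))\<^sup>2 + (cmod (F a))\<^sup>2)"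
        using sum_squares_bound[of "cmod (F b)" "cmod (F a)"] by (simp add: power2_eq_square algebra_simps)
      also note P
      finally show "(cmod D)\<^sup>2 \<le> 2 * P x / h\<^sup>2"
        using h by (simp add: D_def ab(2) norm_divide power_divide divide_right_mono del: of_real_diff)
    qed simp
    finally show ?thesis by (simp add: algebra_simps)
  qed
  have mF: "(\<lambda>x. F (x + t)) \<in> borel_measurable ?M" for t
    by (rule borel_measurable_lebesgue_on_continuous, rule continuous_on_compose2[OF F(1)]) (auto intro!: continuous_intros)
  have FL: "(\<integral>\<^sup>+x. ennreal ((cmod (F x))\<^sup>2) \<partial>?M) = ennreal ((L2_norm \<Omega> f)\<^sup>2)"
  proof -
    have "(\<integral>\<^sup>+x. ennreal ((cmod (F x))\<^sup>2) \<partial>?M) = (\<integral>\<^sup>+x. ennreal ((cmod (f x))\<^sup>2) \<partial>?M)"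
      by (rule nn_integral_cong_AE) (use F(2) in \<open>auto elim: eventually_mono\<close>)
    then show ?thesis
      unfolding L2_norm_power2 by (simp add: nn_integral_eq_integral[OF L2_integrable_square[OF fL]])
  qed
  have Ft: "(\<integral>\<^sup>+x. ennreal ((cmod (F (x + t)))\<^sup>2) \<partial>?M) \<le> ennreal ((L2_norm \<Omega> f)\<^sup>2)" for t
    using nn_integral_translate_le[OF F(1,3) \<Omega>, of t] by (simp add: FL)
  have Pint: "integrable ?M P" "(LINT x|?M. P x) \<le> 3 * (L2_norm \<Omega> f)\<^sup>2"
  proof -
    have i: "integrable ?M (\<lambda>x. (cmod (F (x + t)))\<^sup>2)" for t
      by (rule integrableI_nonneg) (use mF Ft[of t] in \<open>auto intro!: le_less_trans[OF Ft] borel_measurable_power borel_measurable_norm\<close>)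
    have l: "(LINT x|?M. (cmod (F (x + t)))\<^sup>2) \<le> (L2_norm \<Omega> f)\<^sup>2" for t
      using Ft[of t] nn_integral_eq_integral[OF i[of t]] by (simp add: ennreal_le_iff)
    show "integrable ?M P" unfolding P_def by (intro Bochner_Integration.integrable_add i)
    show "(LINT x|?M. P x) \<le> 3 * (L2_norm \<Omega> f)\<^sup>2"
      unfolding P_def using i[of h] i[of "-h"] i[of 0] l[of h] l[of "-h"] l[of 0]
      by (simp only: Bochner_Integration.integral_add Bochner_Integration.integrable_add)
  qed
  have "(L2_norm \<Omega> g)\<^sup>2 \<le> (LINT x|?M. 3 * h * q1 x + 3 * h * q2 x + 6 / h\<^sup>2 * P x)"
    unfolding L2_norm_power2
  proof (rule integral_mono_AE[OF L2_integrable_square[OF gL]])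
    show "integrable ?M (\<lambda>x. 3 * h * q1 x + 3 * h * q2 x + 6 / h\<^sup>2 * P x)"
      by (intro Bochner_Integration.integrable_add integrable_mult_right q1 q2 Pint)
    have "AE x in ?M. x \<in> \<Omega>" by (rule AE_I2) simp
    then show "AE x in ?M. (cmod (g x))\<^sup>2 \<le> 3 * h * q1 x + 3 * h * q2 x + 6 / h\<^sup>2 * P x"
      using q1(2) q2(2) g12(1) by eventually_elim (rule pw)
  qed
  also have "\<dots> = 3 * h * (LINT x|?M. q1 x) + 3 * h * (LINT x|?M. q2 x) + 6 / h\<^sup>2 * (LINT x|?M. P x)"
    using q1(3) q2(3) Pint(1) by simp
  also have "\<dots> \<le> 3 * h * G + 3 * h * G + 6 / h\<^sup>2 * (3 * (L2_norm \<Omega> f)\<^sup>2)"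
    using h by (intro add_mono mult_left_mono q1 q2 Pint) auto
  finally show ?thesis by (simp add: mult_ac)
qed

section \<open>The nonlinearity and the energy form\<close>

text \<open>A Lipschitz constant of \<open>r \<mapsto> r powr (2 \<sigma>)\<close> for \<open>r\<^sup>2 \<le> R\<close>. Using \<open>r\<^sup>2\<close> makes it also the constant for
\<open>(\<bar>\<phi>\<bar>\<^sup>2 + \<delta>) powr \<sigma>\<close>.\<close>

definition powr_lip_const :: "real \<Rightarrow> real \<Rightarrow> real" where "powr_lip_const \<sigma> R = 2 * \<sigma> * R powr (\<sigma> - 1 / 2)"

lemma powr_lip_const_nonneg: "1 / 2 \<le> \<sigma> \<Longrightarrow> 0 \<le> powr_lip_const \<sigma> R"
  by (simp add: powr_lip_const_def)

lemma powr_lipschitz: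
  assumes \<sigma>: "1 / 2 \<le> \<sigma>" and a: "0 \<le> a" "a\<^sup>2 \<le> R" and b: "0 \<le> b" "b\<^sup>2 \<le> R"
  shows "\<bar>a powr (2 * \<sigma>) - b powr (2 * \<sigma>)\<bar> \<le> powr_lip_const \<sigma> R * \<bar>a - b\<bar>"
proof -
  have *: "\<bar>b powr (2 * \<sigma>) - a powr (2 * \<sigma>)\<bar> \<le> powr_lip_const \<sigma> R * \<bar>b - a\<bar>"
    if ab: "0 \<le> a" "a < b" "b\<^sup>2 \<le> R" for a b :: real
  proof -
    have c: "continuous_on {a..b} (\<lambda>x. x powr (2 * \<sigma>))"
      using ab(1) \<sigma> by (intro continuous_on_powr' continuous_intros) auto
    have d: "((\<lambda>x. x powr (2 * \<sigma>)) has_real_derivative 2 * \<sigma> * x powr (2 * \<sigma> - 1)) (at x)" if "x > 0" for x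
      by (rule has_real_derivative_powr[OF that])
    have "\<exists>z. a < z \<and> z < b \<and> b powr (2 * \<sigma>) - a powr (2 * \<sigma>) = (b - a) * (2 * \<sigma> * z powr (2 * \<sigma> - 1))"
    proof -
      have "\<exists>l z. a < z \<and> z < b \<and> ((\<lambda>x. x powr (2 * \<sigma>)) has_real_derivative l) (at z) \<and> b powr (2 * \<sigma>) - a powr (2 * \<sigma>) = (b - a) * l"
      proof (rule MVT[OF ab(2) c])
        show "(\<lambda>x. x powr (2 * \<sigma>)) differentiable at x" if "a < x" "x < b" for x
        proof -
          have "x > 0" using that ab(1) by simp
          from d[OF this] show ?thesis unfolding real_differentiable_def by blast
        qed
      qed
      then obtain l z where z: "a < z" "z < b" "((\<lambda>x. x powr (2 * \<sigma>)) has_real_derivative l) (at z)"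
        "b powr (2 * \<sigma>) - a powr (2 * \<sigma>) = (b - a) * l" by blast
      then have "l = 2 * \<sigma> * z powr (2 * \<sigma> - 1)" using d[of z] ab(1) DERIV_unique by fastforce
      with z show ?thesis by blast
    qed
    then obtain z where z: "a < z" "z < b" "b powr (2 * \<sigma>) - a powr (2 * \<sigma>) = (b - a) * (2 * \<sigma> * z powr (2 * \<sigma> - 1))"
      by blast
    have "z powr (2 * \<sigma> - 1) = (z\<^sup>2) powr (\<sigma> - 1 / 2)"
    proof -
      have "z\<^sup>2 = z powr 2" using z ab(1) by (simp add: powr_numeral)
      then show ?thesis by (simp add: powr_powr algebra_simps)
    qed
    also have "\<dots> \<le> R powr (\<sigma> - 1 / 2)"
      using z ab \<sigma> by (intro powr_mono2 order_trans[OF power_mono[of z b 2] ab(3)]) auto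
    finally have "2 * \<sigma> * z powr (2 * \<sigma> - 1) \<le> powr_lip_const \<sigma> R" using \<sigma> by (simp add: powr_lip_const_def mult_left_mono)
    then have "(b - a) * (2 * \<sigma> * z powr (2 * \<sigma> - 1)) \<le> (b - a) * powr_lip_const \<sigma> R" using ab by (intro mult_left_mono) auto
    moreover have "0 \<le> (b - a) * (2 * \<sigma> * z powr (2 * \<sigma> - 1))" using ab \<sigma> by auto
    ultimately show ?thesis using z(3) ab(2) by (simp add: mult.commute)
  qed
  consider "a < b" | "b < a" | "a = b" by linarith
  then show ?thesis
    using *[of a b] *[of b a] a b by cases (auto simp: abs_minus_commute)
qed

lemma L2_tendsto_powr_mult:
  assumes \<sigma>: "1 / 2 \<le> \<sigma>" and g: "L2_tendsto \<Omega> gs g"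
    and m: "\<And>n. rs n \<in> borel_measurable (lebesgue_on \<Omega>)" "r \<in> borel_measurable (lebesgue_on \<Omega>)"
    and nonneg: "\<And>n x. 0 \<le> rs n x" "\<And>x. 0 \<le> r x"
    and b: "AE x in lebesgue_on \<Omega>. r x \<le> M"
    and e: "\<And>n. AE x in lebesgue_on \<Omega>. \<bar>rs n x - r x\<bar> \<le> e n" "e \<longlonglongrightarrow> 0"
  shows "L2_tendsto \<Omega> (\<lambda>n x. complex_of_real (rs n x powr (2 * \<sigma>)) * gs n x) (\<lambda>x. complex_of_real (r x powr (2 * \<sigma>)) * g x)"
proof -
  obtain E where E: "\<And>n. \<bar>e n\<bar> \<le> E"
    using convergent_imp_Bseq[of e] e(2) by (auto simp: Bseq_def convergent_def)
  define K where "K = powr_lip_const \<sigma> ((M + E)\<^sup>2)"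
  show ?thesis
  proof (rule L2_tendsto_mult_bounded[OF g, where K = "M powr (2 * \<sigma>)" and e = "\<lambda>n. K * e n"])
    show "AE x in lebesgue_on \<Omega>. cmod (complex_of_real (r x powr (2 * \<sigma>))) \<le> M powr (2 * \<sigma>)"
      using b by eventually_elim (use nonneg(2) \<sigma> in \<open>auto intro!: powr_mono2\<close>)
    show "AE x in lebesgue_on \<Omega>. cmod (complex_of_real (rs n x powr (2 * \<sigma>)) - complex_of_real (r x powr (2 * \<sigma>))) \<le> K * e n" for n
      using b e(1)[of n]
    proof eventually_elim
      case (elim x)
      have "rs n x \<le> M + E" "r x \<le> M + E" using elim E[of n] by linarith+
      then have "\<bar>rs n x powr (2 * \<sigma>) - r x powr (2 * \<sigma>)\<bar> \<le> K * \<bar>rs n x - r x\<bar>"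
        unfolding K_def using nonneg by (intro powr_lipschitz \<sigma> power_mono) auto
      also have "\<dots> \<le> K * e n" using elim powr_lip_const_nonneg[OF \<sigma>] by (intro mult_left_mono) (auto simp: K_def)
      finally show ?case by (simp flip: of_real_diff)
    qed
    show "(\<lambda>n. K * e n) \<longlonglongrightarrow> 0" using tendsto_mult_right_zero[OF e(2)] .
  qed (use m in measurable)
qed

text \<open>For \<open>\<sigma> = 1/2\<close> the function \<open>\<bar>\<phi>\<bar> powr (2 \<sigma>)\<close> is not differentiable at the zeros of \<open>\<phi>\<close>. With
\<open>\<delta> > 0\<close> the coefficient is continuously differentiable, and its derivative is at most a constant times
\<open>\<bar>\<phi>'\<bar>\<close>, where the constant depends on \<open>\<delta>\<close> only through \<open>R\<close>. The left-hand side is the integral of the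
coefficient against \<open>(\<bar>\<psi>\<bar>\<^sup>2)'\<close>, which can be integrated by parts.\<close>

lemma regularized_chain_rule_bound:
  fixes \<Omega> :: "real set"
  assumes \<sigma>: "1 / 2 \<le> \<sigma>" and \<Omega>: "open \<Omega>" and \<phi>: "\<phi> \<in> test_functions \<Omega>" and \<psi>: "\<psi> \<in> test_functions \<Omega>"
    and \<delta>: "0 < \<delta>" and R: "\<And>x. (cmod (\<phi> x))\<^sup>2 + \<delta> \<le> R"
  shows "2 * \<bar>Re (LINT x|lebesgue_on \<Omega>. complex_of_real (((cmod (\<phi> x))\<^sup>2 + \<delta>) powr \<sigma>) * dir_deriv 1 \<psi> x * cnj (\<psi> x))\<bar>
    \<le> powr_lip_const \<sigma> R * (LINT x|lebesgue_on \<Omega>. cmod (dir_deriv 1 \<phi> x) * (cmod (\<psi> x))\<^sup>2)"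
proof -
  let ?M = "lebesgue_on \<Omega>"
  define \<phi>' where "\<phi>' = dir_deriv 1 \<phi>"
  define \<psi>' where "\<psi>' = dir_deriv 1 \<psi>"
  define r where "r x = \<phi> x \<bullet> \<phi> x + \<delta>" for x
  define a where "a x = r x powr \<sigma>" for x
  define a' where "a' x = \<sigma> * r x powr (\<sigma> - 1) * (\<phi> x \<bullet> \<phi>' x + \<phi>' x \<bullet> \<phi> x)" for x
  define b where "b x = \<psi> x \<bullet> \<psi> x" for x
  define b' where "b' x = \<psi> x \<bullet> \<psi>' x + \<psi>' x \<bullet> \<psi> x" for x
  have r: "r x > 0" "r x \<le> R" "r x = (cmod (\<phi> x))\<^sup>2 + \<delta>" for x
    using \<delta> R[of x] by (auto simp: r_def power2_norm_eq_inner intro: add_nonneg_pos)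
  have c: "continuous_on S \<phi>" "continuous_on S \<phi>'" "continuous_on S \<psi>" "continuous_on S \<psi>'" for S
    unfolding \<phi>'_def \<psi>'_def by (rule test_functions_continuous[OF \<phi>] test_functions_continuous[OF \<psi>]
      test_functions_continuous[OF test_functions_deriv[OF \<phi>]] test_functions_continuous[OF test_functions_deriv[OF \<psi>]])+
  have cr: "continuous_on S r" for S unfolding r_def by (intro continuous_intros c)
  have cab: "continuous_on S a" "continuous_on S a'" "continuous_on S b" "continuous_on S b'" for S
  proof -
    have "\<forall>x\<in>S. r x \<noteq> 0" using r(1) by (metis less_irrefl)
    then show "continuous_on S a" "continuous_on S a'"
      unfolding a_def a'_def by (intro continuous_intros cr c | simp)+
    show "continuous_on S b" "continuous_on S b'" unfolding b_def b'_def by (intro continuous_intros c)+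
  qed
  have db: "(b has_vector_derivative b' x) (at x)" for x
    unfolding b_def b'_def \<psi>'_def
    by (rule bounded_bilinear.has_vector_derivative[OF bounded_bilinear_inner test_functions_has_derivative[OF \<psi>] test_functions_has_derivative[OF \<psi>]])
  have dr: "(r has_real_derivative (\<phi> x \<bullet> \<phi>' x + \<phi>' x \<bullet> \<phi> x)) (at x)" for x
  proof -
    have "((\<lambda>x. \<phi> x \<bullet> \<phi> x) has_vector_derivative (\<phi> x \<bullet> \<phi>' x + \<phi>' x \<bullet> \<phi> x)) (at x)"
      unfolding \<phi>'_def
      by (rule bounded_bilinear.has_vector_derivative[OF bounded_bilinear_inner test_functions_has_derivative[OF \<phi>] test_functions_has_derivative[OF \<phi>]])
    then show ?thesis unfolding r_def has_real_derivative_iff_has_vector_derivative[symmetric]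
      by (auto intro!: derivative_eq_intros)
  qed
  have da: "(a has_real_derivative a' x) (at x)" for x
    unfolding a_def a'_def using DERIV_chain2[OF has_real_derivative_powr[OF r(1)[of x]] dr[of x], of \<sigma>] by simp
  obtain K where K: "compact K" "K \<subseteq> \<Omega>" "\<And>z. z \<notin> K \<Longrightarrow> \<psi> z = 0"
    using \<psi> by (rule test_functionsE) blast
  have int: "integrable ?M f" if "continuous_on UNIV f" "\<And>x. \<psi> x = 0 \<Longrightarrow> f x = 0" for f :: "real \<Rightarrow> real"
    by (rule continuous_compact_support_integrable(2)[OF that(1) K(1)]) (use that(2) K(3) \<Omega> in auto)
  have "(LINT x|?M. a x * b' x + a' x * b x) = 0"
  proof (rule integral_deriv_compact_support[of "\<lambda>x. a x * b x" _ K])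
    show "((\<lambda>x. a x * b x) has_vector_derivative (a x * b' x + a' x * b x)) (at x)" for x
      using da[of x] db[of x] unfolding has_real_derivative_iff_has_vector_derivative[symmetric]
      by (auto intro!: derivative_eq_intros simp: algebra_simps)
    show "continuous_on UNIV (\<lambda>x. a x * b' x + a' x * b x)" by (intro continuous_intros cab)
    show "a x * b x = 0" if "x \<notin> K" for x using K(3)[OF that] by (simp add: b_def)
  qed (use K \<Omega> in auto)
  moreover have i1: "integrable ?M (\<lambda>x. a x * b' x)" by (rule int, intro continuous_intros cab, simp add: b'_def)
  moreover have i2: "integrable ?M (\<lambda>x. a' x * b x)" by (rule int, intro continuous_intros cab, simp add: b_def)
  ultimately have eq: "(LINT x|?M. a x * b' x) = - (LINT x|?M. a' x * b x)" by simp
  have a'_le: "\<bar>a' x\<bar> \<le> powr_lip_const \<sigma> R * cmod (\<phi>' x)" for x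
  proof -
    have "\<bar>\<phi> x \<bullet> \<phi>' x + \<phi>' x \<bullet> \<phi> x\<bar> \<le> 2 * (cmod (\<phi> x) * cmod (\<phi>' x))"
      using Cauchy_Schwarz_ineq2[of "\<phi> x" "\<phi>' x"] by (simp add: inner_commute)
    also have "\<dots> \<le> 2 * (r x powr (1 / 2) * cmod (\<phi>' x))"
    proof -
      have "cmod (\<phi> x) \<le> sqrt (r x)" using \<delta> by (intro real_le_rsqrt) (simp add: r(3))
      then show ?thesis using r(1)[of x] by (simp add: powr_half_sqrt mult_right_mono)
    qed
    finally have "\<sigma> * r x powr (\<sigma> - 1) * \<bar>\<phi> x \<bullet> \<phi>' x + \<phi>' x \<bullet> \<phi> x\<bar> \<le> \<sigma> * r x powr (\<sigma> - 1) * (2 * (r x powr (1 / 2) * cmod (\<phi>' x)))"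
      using \<sigma> by (intro mult_left_mono) auto
    also have "\<dots> = 2 * \<sigma> * (r x powr (\<sigma> - 1) * r x powr (1 / 2)) * cmod (\<phi>' x)" by (simp add: mult_ac)
    also have "r x powr (\<sigma> - 1) * r x powr (1 / 2) = r x powr (\<sigma> - 1 / 2)" by (simp flip: powr_add)
    also have "2 * \<sigma> * r x powr (\<sigma> - 1 / 2) * cmod (\<phi>' x) \<le> powr_lip_const \<sigma> R * cmod (\<phi>' x)"
      unfolding powr_lip_const_def using \<sigma> r[of x] by (intro mult_right_mono mult_left_mono powr_mono2) auto
    finally show ?thesis using \<sigma> by (simp add: a'_def abs_mult)
  qed
  have "\<bar>LINT x|?M. a' x * b x\<bar> \<le> (LINT x|?M. \<bar>a' x * b x\<bar>)" by (rule integral_abs_bound)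
  also have "\<dots> \<le> (LINT x|?M. powr_lip_const \<sigma> R * (cmod (\<phi>' x) * (cmod (\<psi> x))\<^sup>2))"
  proof (rule integral_mono)
    show "integrable ?M (\<lambda>x. powr_lip_const \<sigma> R * (cmod (\<phi>' x) * (cmod (\<psi> x))\<^sup>2))"
      by (rule int) (auto intro!: continuous_intros c)
    show "\<bar>a' x * b x\<bar> \<le> powr_lip_const \<sigma> R * (cmod (\<phi>' x) * (cmod (\<psi> x))\<^sup>2)" for x
      using mult_right_mono[OF a'_le, of "b x" x] by (simp add: b_def abs_mult power2_norm_eq_inner mult_ac)
  qed (use i2 in simp)
  finally have le: "\<bar>LINT x|?M. a x * b' x\<bar> \<le> powr_lip_const \<sigma> R * (LINT x|?M. cmod (\<phi>' x) * (cmod (\<psi> x))\<^sup>2)"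
    unfolding eq by simp
  have "integrable ?M (\<lambda>x. complex_of_real (a x) * \<psi>' x * cnj (\<psi> x))"
    by (rule continuous_compact_support_integrable(2)[OF _ K(1)])
       (use K(3) \<Omega> in \<open>auto intro!: continuous_intros cab c\<close>)
  then have "Re (LINT x|?M. complex_of_real (a x) * \<psi>' x * cnj (\<psi> x)) = (LINT x|?M. Re (complex_of_real (a x) * \<psi>' x * cnj (\<psi> x)))"
    by (rule integral_Re[symmetric])
  also have "(\<lambda>x. Re (complex_of_real (a x) * \<psi>' x * cnj (\<psi> x))) = (\<lambda>x. (1 / 2) * (a x * b' x))"
    by (auto simp: b'_def inner_complex_def algebra_simps)
  finally have "2 * \<bar>Re (LINT x|?M. complex_of_real (a x) * \<psi>' x * cnj (\<psi> x))\<bar> = \<bar>LINT x|?M. a x * b' x\<bar>" by simp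
  with le show ?thesis unfolding a_def r(3) \<phi>'_def \<psi>'_def by simp
qed

lemma H1_0_approx_AE:
  assumes "\<And>n. \<psi> n \<in> test_functions \<Omega>" "L2_tendsto \<Omega> \<psi> f" "L2_tendsto \<Omega> (\<lambda>n. dir_deriv 1 (\<psi> n)) g"
    "H1_0_grad \<Omega> f g" "open \<Omega>"
  obtains e where "e \<longlonglongrightarrow> 0" "\<And>n. AE x in lebesgue_on \<Omega>. cmod (\<psi> n x - f x) \<le> e n"
proof
  let ?e = "\<lambda>n. L2_norm \<Omega> (\<lambda>x. \<psi> n x - f x) + L2_norm \<Omega> (\<lambda>x. dir_deriv 1 (\<psi> n) x - g x)"
  show "?e \<longlonglongrightarrow> 0" using tendsto_add[OF L2_tendstoD(3)[OF assms(2)] L2_tendstoD(3)[OF assms(3)]] by simp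
  fix n
  note d = H1_0_grad_diff[OF H1_0_grad_test[OF assms(1) assms(5)] assms(4), of n]
  show "AE x in lebesgue_on \<Omega>. cmod (\<psi> n x - f x) \<le> ?e n"
    using H1_0_AE_bound[OF d assms(5)] by eventually_elim (use H1_norm_le[OF d assms(5)] in linarith)
qed

text \<open>Both sides of the bound for test functions are continuous in \<open>H\<^sup>1\<close>, and the regularisation may
tend to \<open>0\<close> along with the approximation. The constant allows for \<open>\<bar>\<phi> n\<bar> \<le> M + 1\<close> and \<open>\<delta> \<le> 1\<close>.\<close>

lemma chain_rule_bound:
  assumes \<sigma>: "1 / 2 \<le> \<sigma>" and \<Omega>: "open \<Omega>" and f: "H1_0_grad \<Omega> f g" and z: "H1_0_grad \<Omega> z w"
    and M: "H1_norm \<Omega> f \<le> M"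
  shows "2 * \<bar>Re (LINT x|lebesgue_on \<Omega>. complex_of_real (cmod (f x) powr (2 * \<sigma>)) * w x * cnj (z x))\<bar>
    \<le> powr_lip_const \<sigma> ((M + 1)\<^sup>2 + 1) * (LINT x|lebesgue_on \<Omega>. cmod (g x) * (cmod (z x))\<^sup>2)"
proof -
  let ?M = "lebesgue_on \<Omega>"
  obtain \<phi> where \<phi>: "\<And>n. \<phi> n \<in> test_functions \<Omega>" "L2_tendsto \<Omega> \<phi> f" "L2_tendsto \<Omega> (\<lambda>n. dir_deriv 1 (\<phi> n)) g"
    by (rule H1_0_gradE[OF f]) blast
  obtain \<psi> where \<psi>: "\<And>n. \<psi> n \<in> test_functions \<Omega>" "L2_tendsto \<Omega> \<psi> z" "L2_tendsto \<Omega> (\<lambda>n. dir_deriv 1 (\<psi> n)) w"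
    by (rule H1_0_gradE[OF z]) blast
  obtain e where e: "e \<longlonglongrightarrow> 0" "\<And>n. AE x in ?M. cmod (\<phi> n x - f x) \<le> e n"
    by (rule H1_0_approx_AE[OF \<phi> f \<Omega>]) blast
  obtain e' where e': "e' \<longlonglongrightarrow> 0" "\<And>n. AE x in ?M. cmod (\<psi> n x - z x) \<le> e' n"
    by (rule H1_0_approx_AE[OF \<psi> z \<Omega>]) blast
  have fM: "AE x in ?M. cmod (f x) \<le> M" using H1_0_AE_bound[OF f \<Omega>] by eventually_elim (use M in linarith)
  note m = L2_meas[OF H1_0_grad_L2(1)[OF f]] L2_meas[OF L2_tendstoD(1)[OF \<phi>(2)]] L2_meas[OF L2_tendstoD(1)[OF \<psi>(2)]] L2_meas[OF H1_0_grad_L2(1)[OF z]]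
  define \<delta> where "\<delta> n = 1 / real (Suc n)" for n
  have \<delta>: "\<delta> n > 0" "\<delta> n \<le> 1" for n by (auto simp: \<delta>_def)
  have \<delta>0: "\<delta> \<longlonglongrightarrow> 0" unfolding \<delta>_def using LIMSEQ_inverse_real_of_nat by (simp add: inverse_eq_divide)
  \<comment> \<open>The regularised modulus, whose power \<open>2 \<sigma>\<close> is the coefficient of the regularised bound.\<close>
  define rs where "rs n x = sqrt ((cmod (\<phi> n x))\<^sup>2 + \<delta> n)" for n x
  have rs: "rs n x powr (2 * \<sigma>) = ((cmod (\<phi> n x))\<^sup>2 + \<delta> n) powr \<sigma>" for n x
  proof -
    have "rs n x = ((cmod (\<phi> n x))\<^sup>2 + \<delta> n) powr (1 / 2)"
      unfolding rs_def using \<delta>(1)[of n] by (simp add: powr_half_sqrt)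
    then show ?thesis by (simp add: powr_powr)
  qed
  have "L2_tendsto \<Omega> (\<lambda>n x. complex_of_real (rs n x powr (2 * \<sigma>)) * dir_deriv 1 (\<psi> n) x) (\<lambda>x. complex_of_real (cmod (f x) powr (2 * \<sigma>)) * w x)"
  proof (rule L2_tendsto_powr_mult[OF \<sigma> \<psi>(3), where e = "\<lambda>n. e n + sqrt (\<delta> n)"])
    show "AE x in ?M. \<bar>rs n x - cmod (f x)\<bar> \<le> e n + sqrt (\<delta> n)" for n
      using e(2)[of n]
    proof eventually_elim
      case (elim x)
      have "rs n x \<le> cmod (\<phi> n x) + sqrt (\<delta> n)"
        unfolding rs_def using \<delta>(1)[of n] sqrt_add_le_add_sqrt[of "(cmod (\<phi> n x))\<^sup>2" "\<delta> n"] by simp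
      moreover have "cmod (\<phi> n x) \<le> rs n x"
        unfolding rs_def using \<delta>(1)[of n] by (intro real_le_rsqrt) simp
      moreover have "\<bar>cmod (\<phi> n x) - cmod (f x)\<bar> \<le> e n" using elim norm_triangle_ineq3[of "\<phi> n x" "f x"] by linarith
      moreover have "0 \<le> sqrt (\<delta> n)" using \<delta>(1)[of n] by simp
      ultimately show ?case by linarith
    qed
    show "(\<lambda>n. e n + sqrt (\<delta> n)) \<longlonglongrightarrow> 0" using tendsto_add[OF e(1) tendsto_real_sqrt[OF \<delta>0]] by simp
    show "rs n \<in> borel_measurable ?M" for n unfolding rs_def using m(2)[of n] by measurable
    show "(\<lambda>x. cmod (f x)) \<in> borel_measurable ?M" using m(1) by measurable
  qed (use \<delta>(1) fM in \<open>auto simp: rs_def less_imp_le\<close>)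
  from L2_tendsto_integral_mult[OF this L2_tendsto_cnj[OF \<psi>(2)]]
  have lim1: "(\<lambda>n. LINT x|?M. complex_of_real (((cmod (\<phi> n x))\<^sup>2 + \<delta> n) powr \<sigma>) * dir_deriv 1 (\<psi> n) x * cnj (\<psi> n x))
     \<longlonglongrightarrow> (LINT x|?M. complex_of_real (cmod (f x) powr (2 * \<sigma>)) * w x * cnj (z x))" unfolding rs .
  have "L2_tendsto \<Omega> (\<lambda>n x. \<psi> n x * cnj (\<psi> n x)) (\<lambda>x. z x * cnj (z x))"
    by (rule L2_tendsto_mult_bounded[OF L2_tendsto_cnj[OF \<psi>(2)] m(3,4) H1_0_AE_bound[OF z \<Omega>] e'(2,1)])
  from L2_tendsto_integral_mult[OF L2_tendsto_cmod[OF \<phi>(3)] this]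
  have "(\<lambda>n. LINT x|?M. complex_of_real (cmod (dir_deriv 1 (\<phi> n) x) * (cmod (\<psi> n x))\<^sup>2)) \<longlonglongrightarrow> (LINT x|?M. complex_of_real (cmod (g x) * (cmod (z x))\<^sup>2))"
    by (simp add: complex_norm_square[symmetric])
  then have lim2: "(\<lambda>n. LINT x|?M. cmod (dir_deriv 1 (\<phi> n) x) * (cmod (\<psi> n x))\<^sup>2) \<longlonglongrightarrow> (LINT x|?M. cmod (g x) * (cmod (z x))\<^sup>2)"
    unfolding integral_complex_of_real tendsto_of_real_iff .
  have "(\<lambda>n. sqrt ((L2_norm \<Omega> (\<phi> n))\<^sup>2 + (L2_norm \<Omega> (dir_deriv 1 (\<phi> n)))\<^sup>2)) \<longlonglongrightarrow> H1_norm \<Omega> f"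
    unfolding H1_0_grad_weak_deriv(3)[OF f \<Omega>] by (intro tendsto_intros L2_tendsto_norm \<phi>)
  then have "eventually (\<lambda>n. sqrt ((L2_norm \<Omega> (\<phi> n))\<^sup>2 + (L2_norm \<Omega> (dir_deriv 1 (\<phi> n)))\<^sup>2) < M + 1) sequentially"
    by (rule order_tendstoD(2)) (use M in simp)
  then have ev: "eventually (\<lambda>n. 2 * \<bar>Re (LINT x|?M. complex_of_real (((cmod (\<phi> n x))\<^sup>2 + \<delta> n) powr \<sigma>) * dir_deriv 1 (\<psi> n) x * cnj (\<psi> n x))\<bar>
      \<le> powr_lip_const \<sigma> ((M + 1)\<^sup>2 + 1) * (LINT x|?M. cmod (dir_deriv 1 (\<phi> n) x) * (cmod (\<psi> n x))\<^sup>2)) sequentially"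
  proof eventually_elim
    case (elim n)
    have "(cmod (\<phi> n x))\<^sup>2 + \<delta> n \<le> (M + 1)\<^sup>2 + 1" for x
      using test_function_sup_bound[OF \<phi>(1) \<Omega>, of n x] elim \<delta>[of n] by (intro add_mono power_mono) auto
    then show ?case by (rule regularized_chain_rule_bound[OF \<sigma> \<Omega> \<phi>(1) \<psi>(1) \<delta>(1)])
  qed
  show ?thesis
    by (rule tendsto_le[OF sequentially_bot _ _ ev])
       (intro tendsto_mult tendsto_const lim2 tendsto_rabs tendsto_Re lim1)+
qed

text \<open>The right-hand side \<open>\<i> f\<^sub>x\<^sub>x - \<bar>f\<bar>\<^sup>2\<^sup>\<sigma> f\<^sub>x\<close> of the equation, solved for the time derivative, as a form
on pairs of a function and its derivative; \<open>g\<close> is the derivative of \<open>f\<close>. It is bilinear, like the pairing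
of distributions, so that energies arise from conjugated arguments.\<close>

definition dnls_form :: "real set \<Rightarrow> real \<Rightarrow> (real \<Rightarrow> complex) \<Rightarrow> (real \<Rightarrow> complex) \<Rightarrow> (real \<Rightarrow> complex) \<Rightarrow> (real \<Rightarrow> complex) \<Rightarrow> complex"
  where "dnls_form \<Omega> \<sigma> f g \<psi> \<psi>' = - \<i> * (LINT x|lebesgue_on \<Omega>. g x * \<psi>' x)
    - (LINT x|lebesgue_on \<Omega>. complex_of_real (cmod (f x) powr (2 * \<sigma>)) * g x * \<psi> x)"

lemma powr_mult_L2:
  assumes \<sigma>: "1 / 2 \<le> \<sigma>" and f: "f \<in> borel_measurable (lebesgue_on \<Omega>)" "AE x in lebesgue_on \<Omega>. cmod (f x) \<le> M" and g: "g \<in> L2 \<Omega>"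
  shows "(\<lambda>x. complex_of_real (cmod (f x) powr (2 * \<sigma>)) * g x) \<in> L2 \<Omega>"
    "L2_norm \<Omega> (\<lambda>x. complex_of_real (cmod (f x) powr (2 * \<sigma>)) * g x) \<le> M powr (2 * \<sigma>) * L2_norm \<Omega> g"
proof -
  have m: "(\<lambda>x. complex_of_real (cmod (f x) powr (2 * \<sigma>))) \<in> borel_measurable (lebesgue_on \<Omega>)"
    using f(1) by measurable
  have b: "AE x in lebesgue_on \<Omega>. cmod (complex_of_real (cmod (f x) powr (2 * \<sigma>))) \<le> M powr (2 * \<sigma>)"
    using f(2) by eventually_elim (use \<sigma> in \<open>auto intro!: powr_mono2\<close>)
  show "(\<lambda>x. complex_of_real (cmod (f x) powr (2 * \<sigma>)) * g x) \<in> L2 \<Omega>"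
    by (rule L2_mult_bounded(1)[OF g m b])
  show "L2_norm \<Omega> (\<lambda>x. complex_of_real (cmod (f x) powr (2 * \<sigma>)) * g x) \<le> M powr (2 * \<sigma>) * L2_norm \<Omega> g"
    using L2_mult_bounded(2)[OF g m b] by simp
qed

lemma dnls_form_bound:
  assumes \<sigma>: "1 / 2 \<le> \<sigma>" and f: "f \<in> borel_measurable (lebesgue_on \<Omega>)" "AE x in lebesgue_on \<Omega>. cmod (f x) \<le> M"
    and g: "g \<in> L2 \<Omega>" "L2_norm \<Omega> g \<le> M" and \<psi>: "\<psi> \<in> L2 \<Omega>" "\<psi>' \<in> L2 \<Omega>"
  shows "cmod (dnls_form \<Omega> \<sigma> f g \<psi> \<psi>') \<le> (1 + M powr (2 * \<sigma>)) * M * (L2_norm \<Omega> \<psi> + L2_norm \<Omega> \<psi>')"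
proof -
  have M: "0 \<le> M" using g(2) L2_norm_nonneg[of \<Omega> g] by linarith
  have "cmod (dnls_form \<Omega> \<sigma> f g \<psi> \<psi>') \<le> cmod (LINT x|lebesgue_on \<Omega>. g x * \<psi>' x)
     + cmod (LINT x|lebesgue_on \<Omega>. (complex_of_real (cmod (f x) powr (2 * \<sigma>)) * g x) * \<psi> x)"
    unfolding dnls_form_def by (rule order_trans[OF norm_triangle_ineq4]) (simp add: norm_mult)
  also have "\<dots> \<le> L2_norm \<Omega> g * L2_norm \<Omega> \<psi>' + L2_norm \<Omega> (\<lambda>x. complex_of_real (cmod (f x) powr (2 * \<sigma>)) * g x) * L2_norm \<Omega> \<psi>"
    by (intro add_mono L2_integral_mult_le g \<psi> powr_mult_L2(1)[OF \<sigma> f g(1)])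
  also have "\<dots> \<le> M * L2_norm \<Omega> \<psi>' + (M powr (2 * \<sigma>) * M) * L2_norm \<Omega> \<psi>"
    by (intro add_mono mult_right_mono g order_trans[OF powr_mult_L2(2)[OF \<sigma> f g(1)]] mult_left_mono) auto
  also have "\<dots> \<le> (1 + M powr (2 * \<sigma>)) * M * (L2_norm \<Omega> \<psi> + L2_norm \<Omega> \<psi>')"
    using M by (simp add: algebra_simps)
  finally show ?thesis .
qed

lemma dnls_form_diff:
  assumes \<sigma>: "1 / 2 \<le> \<sigma>" and f: "f \<in> borel_measurable (lebesgue_on \<Omega>)" "AE x in lebesgue_on \<Omega>. cmod (f x) \<le> M"
    and g: "g \<in> L2 \<Omega>" and \<psi>: "\<psi> \<in> L2 \<Omega>" "\<psi>' \<in> L2 \<Omega>" "\<theta> \<in> L2 \<Omega>" "\<theta>' \<in> L2 \<Omega>"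
  shows "dnls_form \<Omega> \<sigma> f g (\<lambda>x. \<psi> x - \<theta> x) (\<lambda>x. \<psi>' x - \<theta>' x) = dnls_form \<Omega> \<sigma> f g \<psi> \<psi>' - dnls_form \<Omega> \<sigma> f g \<theta> \<theta>'"
  using L2_integrable_mult[OF g \<psi>(2)] L2_integrable_mult[OF g \<psi>(4)]
    L2_integrable_mult[OF powr_mult_L2(1)[OF \<sigma> f g] \<psi>(1)] L2_integrable_mult[OF powr_mult_L2(1)[OF \<sigma> f g] \<psi>(3)]
  by (simp add: dnls_form_def right_diff_distrib)

lemma integrable_weight:
  assumes "g \<in> L2 \<Omega>" "z \<in> L2 \<Omega>" "AE x in lebesgue_on \<Omega>. cmod (z x) \<le> M"
  shows "integrable (lebesgue_on \<Omega>) (\<lambda>x. cmod (g x) * (cmod (z x))\<^sup>2)"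
proof -
  have "(\<lambda>x. z x * z x) \<in> L2 \<Omega>" by (rule L2_mult_bounded(1)[OF assms(2) L2_meas[OF assms(2)] assms(3)])
  from L2_integrable_norm_mult[OF assms(1) this] show ?thesis by (simp add: norm_mult power2_eq_square)
qed

text \<open>Split \<open>\<bar>f1\<bar>\<^sup>2\<^sup>\<sigma> g1 - \<bar>f2\<bar>\<^sup>2\<^sup>\<sigma> g2\<close> into \<open>\<bar>f1\<bar>\<^sup>2\<^sup>\<sigma> w\<close> and \<open>(\<bar>f1\<bar>\<^sup>2\<^sup>\<sigma> - \<bar>f2\<bar>\<^sup>2\<^sup>\<sigma>) g2\<close>. The first part, paired
with \<open>cnj z\<close>, contains a derivative of \<open>\<bar>z\<bar>\<^sup>2\<close> and is integrated by parts; the second is at most a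
constant times \<open>\<bar>z\<bar> \<bar>g2\<bar>\<close>. The second-order term contributes \<open>- \<i> \<parallel>w\<parallel>\<^sup>2\<close>, whose real part is \<open>0\<close>.\<close>

lemma dnls_form_energy:
  assumes \<sigma>: "1 / 2 \<le> \<sigma>" and \<Omega>: "open \<Omega>" and f1: "H1_0_grad \<Omega> f1 g1" "H1_norm \<Omega> f1 \<le> M"
    and f2: "H1_0_grad \<Omega> f2 g2" "H1_norm \<Omega> f2 \<le> M"
  defines "z \<equiv> \<lambda>x. f1 x - f2 x" and "w \<equiv> \<lambda>x. g1 x - g2 x"
  shows "\<bar>Re (dnls_form \<Omega> \<sigma> f1 g1 (\<lambda>x. cnj (z x)) (\<lambda>x. cnj (w x)) - dnls_form \<Omega> \<sigma> f2 g2 (\<lambda>x. cnj (z x)) (\<lambda>x. cnj (w x)))\<bar>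
    \<le> powr_lip_const \<sigma> ((M + 1)\<^sup>2 + 1) * ((LINT x|lebesgue_on \<Omega>. cmod (g1 x) * (cmod (z x))\<^sup>2) + (LINT x|lebesgue_on \<Omega>. cmod (g2 x) * (cmod (z x))\<^sup>2))"
proof -
  let ?M = "lebesgue_on \<Omega>" and ?K = "powr_lip_const \<sigma> ((M + 1)\<^sup>2 + 1)"
  define p1 where "p1 x = complex_of_real (cmod (f1 x) powr (2 * \<sigma>))" for x
  define p2 where "p2 x = complex_of_real (cmod (f2 x) powr (2 * \<sigma>))" for x
  note L = H1_0_grad_L2[OF f1(1)] H1_0_grad_L2[OF f2(1)]
  have zw: "H1_0_grad \<Omega> z w" unfolding z_def w_def by (rule H1_0_grad_diff[OF f1(1) f2(1)])
  note Lz = H1_0_grad_L2[OF zw] L2_cnj[OF H1_0_grad_L2(1)[OF zw]] L2_cnj[OF H1_0_grad_L2(2)[OF zw]]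
  have b: "AE x in ?M. cmod (f1 x) \<le> M" "AE x in ?M. cmod (f2 x) \<le> M"
    using H1_0_AE_bound[OF f1(1) \<Omega>] H1_0_AE_bound[OF f2(1) \<Omega>]
    by (eventually_elim, use f1(2) f2(2) in linarith)+
  have M0: "0 \<le> M" using f1(2) L2_norm_le_H1_norm(1)[OF f1(1) \<Omega>] L2_norm_nonneg[of \<Omega> f1] by linarith
  have pL: "(\<lambda>x. p1 x * g1 x) \<in> L2 \<Omega>" "(\<lambda>x. p2 x * g2 x) \<in> L2 \<Omega>" "(\<lambda>x. p1 x * w x) \<in> L2 \<Omega>" "(\<lambda>x. p1 x * g2 x) \<in> L2 \<Omega>"
    unfolding p1_def p2_def by (rule powr_mult_L2(1)[OF \<sigma> L2_meas b(1)] powr_mult_L2(1)[OF \<sigma> L2_meas b(2)]; rule L Lz)+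
  have "(LINT x|?M. g1 x * cnj (w x)) - (LINT x|?M. g2 x * cnj (w x)) = (LINT x|?M. complex_of_real ((cmod (w x))\<^sup>2))"
  proof -
    have "(LINT x|?M. g1 x * cnj (w x)) - (LINT x|?M. g2 x * cnj (w x)) = (LINT x|?M. g1 x * cnj (w x) - g2 x * cnj (w x))"
      by (intro Bochner_Integration.integral_diff[symmetric] L2_integrable_mult L Lz)
    also have "\<dots> = (LINT x|?M. complex_of_real ((cmod (w x))\<^sup>2))"
      by (intro Bochner_Integration.integral_cong refl)
         (simp only: left_diff_distrib[symmetric] complex_norm_square w_def)
    finally show ?thesis .
  qed
  also have "\<dots> = complex_of_real (LINT x|?M. (cmod (w x))\<^sup>2)" by (rule integral_complex_of_real)
  finally have 1: "Re (- \<i> * (LINT x|?M. g1 x * cnj (w x)) - - \<i> * (LINT x|?M. g2 x * cnj (w x))) = 0"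
    by (simp flip: right_diff_distrib)
       (metis Im_complex_of_real minus_complex.simps(2) right_minus_eq)
  have d: "(LINT x|?M. p1 x * g1 x * cnj (z x)) - (LINT x|?M. p2 x * g2 x * cnj (z x))
     = (LINT x|?M. p1 x * w x * cnj (z x)) + (LINT x|?M. (p1 x * g2 x - p2 x * g2 x) * cnj (z x))"
  proof -
    have "(LINT x|?M. p1 x * g1 x * cnj (z x)) - (LINT x|?M. p2 x * g2 x * cnj (z x))
      = (LINT x|?M. p1 x * g1 x * cnj (z x) - p2 x * g2 x * cnj (z x))"
      by (intro Bochner_Integration.integral_diff[symmetric] L2_integrable_mult pL Lz)
    also have "\<dots> = (LINT x|?M. p1 x * w x * cnj (z x) + (p1 x * g2 x - p2 x * g2 x) * cnj (z x))"
      by (simp add: w_def algebra_simps)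
    also have "\<dots> = (LINT x|?M. p1 x * w x * cnj (z x)) + (LINT x|?M. (p1 x * g2 x - p2 x * g2 x) * cnj (z x))"
      by (intro Bochner_Integration.integral_add L2_integrable_mult pL Lz L2_diff)
    finally show ?thesis .
  qed
  have zM: "AE x in ?M. cmod (z x) \<le> H1_norm \<Omega> z" by (rule H1_0_AE_bound[OF zw \<Omega>])
  have i: "integrable ?M (\<lambda>x. cmod (g1 x) * (cmod (z x))\<^sup>2)" "integrable ?M (\<lambda>x. cmod (g2 x) * (cmod (z x))\<^sup>2)"
    by (rule integrable_weight[OF _ Lz(1) zM], rule L)+
  have A: "2 * \<bar>Re (LINT x|?M. p1 x * w x * cnj (z x))\<bar> \<le> ?K * (LINT x|?M. cmod (g1 x) * (cmod (z x))\<^sup>2)"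
    unfolding p1_def by (rule chain_rule_bound[OF \<sigma> \<Omega> f1(1) zw f1(2)])
  have "cmod (LINT x|?M. (p1 x * g2 x - p2 x * g2 x) * cnj (z x)) \<le> (LINT x|?M. ?K * (cmod (g2 x) * (cmod (z x))\<^sup>2))"
  proof (rule order_trans[OF integral_norm_bound], rule integral_mono_AE)
    show "integrable ?M (\<lambda>x. cmod ((p1 x * g2 x - p2 x * g2 x) * cnj (z x)))"
      by (intro integrable_norm L2_integrable_mult pL Lz L2_diff)
    show "integrable ?M (\<lambda>x. ?K * (cmod (g2 x) * (cmod (z x))\<^sup>2))" using i(2) by simp
    show "AE x in ?M. cmod ((p1 x * g2 x - p2 x * g2 x) * cnj (z x)) \<le> ?K * (cmod (g2 x) * (cmod (z x))\<^sup>2)"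
      using b
    proof eventually_elim
      case (elim x)
      have sq: "c\<^sup>2 \<le> (M + 1)\<^sup>2 + 1" if "0 \<le> c" "c \<le> M" for c
      proof -
        have "c\<^sup>2 \<le> (M + 1)\<^sup>2" by (rule power_mono) (use that in auto)
        then show ?thesis by linarith
      qed
      have "cmod (p1 x - p2 x) = \<bar>cmod (f1 x) powr (2 * \<sigma>) - cmod (f2 x) powr (2 * \<sigma>)\<bar>"
        by (simp add: p1_def p2_def flip: of_real_diff)
      also have "\<dots> \<le> ?K * \<bar>cmod (f1 x) - cmod (f2 x)\<bar>"
        by (intro powr_lipschitz \<sigma> sq elim) auto
      also have "\<dots> \<le> ?K * cmod (z x)"
        unfolding z_def by (intro mult_left_mono norm_triangle_ineq3 powr_lip_const_nonneg \<sigma>)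
      finally have "cmod (p1 x - p2 x) * (cmod (g2 x) * cmod (z x)) \<le> ?K * cmod (z x) * (cmod (g2 x) * cmod (z x))"
        by (intro mult_right_mono) auto
      moreover have "cmod ((p1 x * g2 x - p2 x * g2 x) * cnj (z x)) = cmod (p1 x - p2 x) * (cmod (g2 x) * cmod (z x))"
        by (simp add: norm_mult flip: left_diff_distrib)
      ultimately show ?case by (simp add: power2_eq_square mult_ac)
    qed
  qed
  then have B: "cmod (LINT x|?M. (p1 x * g2 x - p2 x * g2 x) * cnj (z x)) \<le> ?K * (LINT x|?M. cmod (g2 x) * (cmod (z x))\<^sup>2)" by simp
  have "Re (dnls_form \<Omega> \<sigma> f1 g1 (\<lambda>x. cnj (z x)) (\<lambda>x. cnj (w x)) - dnls_form \<Omega> \<sigma> f2 g2 (\<lambda>x. cnj (z x)) (\<lambda>x. cnj (w x)))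
    = - Re ((LINT x|?M. p1 x * g1 x * cnj (z x)) - (LINT x|?M. p2 x * g2 x * cnj (z x)))"
    using 1 unfolding dnls_form_def p1_def p2_def by simp
  then have "\<bar>Re (dnls_form \<Omega> \<sigma> f1 g1 (\<lambda>x. cnj (z x)) (\<lambda>x. cnj (w x)) - dnls_form \<Omega> \<sigma> f2 g2 (\<lambda>x. cnj (z x)) (\<lambda>x. cnj (w x)))\<bar>
    \<le> \<bar>Re (LINT x|?M. p1 x * w x * cnj (z x))\<bar> + cmod (LINT x|?M. (p1 x * g2 x - p2 x * g2 x) * cnj (z x))"
    unfolding d using abs_Re_le_cmod[of "LINT x|?M. (p1 x * g2 x - p2 x * g2 x) * cnj (z x)"] by simp
  with A B show ?thesis by (simp add: distrib_left)
qed

text \<open>The coefficients \<open>a + b sqrt n\<close> and, below, \<open>c / 2 ^ n\<close> of the differential inequality. The bound \<open>2 M\<close>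
is that of the supremum of the difference of two functions in the ball of radius \<open>M\<close>.\<close>

definition growth_const :: "real \<Rightarrow> real \<Rightarrow> real \<Rightarrow> nat \<Rightarrow> real"
  where "growth_const \<sigma> h M n = powr_lip_const \<sigma> ((M + 1)\<^sup>2 + 1) * (2 * (sqrt (2 / h) * M + sqrt (16 * real n * M\<^sup>2) + sqrt (2 * h) * (2 * M)\<^sup>2))"

definition growth_err :: "real \<Rightarrow> real \<Rightarrow> real \<Rightarrow> nat \<Rightarrow> real"
  where "growth_err \<sigma> h M n = powr_lip_const \<sigma> ((M + 1)\<^sup>2 + 1) * (2 * (sqrt (2 * h) / 2 ^ n * M\<^sup>2))"

lemma dnls_form_log_energy:
  assumes \<sigma>: "1 / 2 \<le> \<sigma>" and \<Omega>: "open \<Omega>" and f1: "H1_0_grad \<Omega> f1 g1" "H1_norm \<Omega> f1 \<le> M" "gagliardo \<Omega> g1 \<le> ennreal (M\<^sup>2)"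
    and f2: "H1_0_grad \<Omega> f2 g2" "H1_norm \<Omega> f2 \<le> M" "gagliardo \<Omega> g2 \<le> ennreal (M\<^sup>2)"
    and h: "h > 0" and x: "\<And>x. x \<in> \<Omega> \<Longrightarrow> {x..x+h} \<subseteq> \<Omega> \<or> {x-h..x} \<subseteq> \<Omega>"
  defines "z \<equiv> \<lambda>x. f1 x - f2 x" and "w \<equiv> \<lambda>x. g1 x - g2 x"
  shows "\<bar>Re (dnls_form \<Omega> \<sigma> f1 g1 (\<lambda>x. cnj (z x)) (\<lambda>x. cnj (w x)) - dnls_form \<Omega> \<sigma> f2 g2 (\<lambda>x. cnj (z x)) (\<lambda>x. cnj (w x)))\<bar>
    \<le> growth_const \<sigma> h M n * (L2_norm \<Omega> z)\<^sup>2 + growth_err \<sigma> h M n"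
proof -
  let ?K = "powr_lip_const \<sigma> ((M + 1)\<^sup>2 + 1)"
  let ?B = "sqrt (2 / h) * M + sqrt (16 * real n * M\<^sup>2) + sqrt (2 * h) * (2 * M)\<^sup>2"
  have zw: "H1_0_grad \<Omega> z w" unfolding z_def w_def by (rule H1_0_grad_diff[OF f1(1) f2(1)])
  have zM: "AE x in lebesgue_on \<Omega>. cmod (z x) \<le> 2 * M"
    using H1_0_AE_bound[OF f1(1) \<Omega>] H1_0_AE_bound[OF f2(1) \<Omega>]
  proof eventually_elim
    case (elim x)
    then show ?case using norm_triangle_ineq4[of "f1 x" "f2 x"] f1(2) f2(2) unfolding z_def by linarith
  qed
  have bound: "(LINT x|lebesgue_on \<Omega>. cmod (g x) * (cmod (z x))\<^sup>2) \<le> ?B * (L2_norm \<Omega> z)\<^sup>2 + sqrt (2 * h) / 2 ^ n * M\<^sup>2"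
    if f: "H1_0_grad \<Omega> f g" "H1_norm \<Omega> f \<le> M" "gagliardo \<Omega> g \<le> ennreal (M\<^sup>2)" for f g
  proof -
    have "L2_norm \<Omega> g \<le> M" using L2_norm_le_H1_norm(2)[OF f(1) \<Omega>] f(2) by linarith
    then have "(sqrt (2 / h) * L2_norm \<Omega> g + sqrt (16 * real n * M\<^sup>2) + sqrt (2 * h) * (2 * M)\<^sup>2) * (L2_norm \<Omega> z)\<^sup>2 \<le> ?B * (L2_norm \<Omega> z)\<^sup>2"
      using h by (intro mult_right_mono add_mono mult_left_mono) auto
    moreover have "(LINT x|lebesgue_on \<Omega>. cmod (g x) * (cmod (z x))\<^sup>2) \<le>
      (sqrt (2 / h) * L2_norm \<Omega> g + sqrt (16 * real n * M\<^sup>2) + sqrt (2 * h) * (2 * M)\<^sup>2) * (L2_norm \<Omega> z)\<^sup>2 + sqrt (2 * h) / 2 ^ n * M\<^sup>2"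
      by (rule log_interpolation[OF H1_0_grad_L2(2)[OF f(1)] \<Omega> f(3) _ h x H1_0_grad_L2(1)[OF zw] zM]) simp
    ultimately show ?thesis by linarith
  qed
  have "\<bar>Re (dnls_form \<Omega> \<sigma> f1 g1 (\<lambda>x. cnj (z x)) (\<lambda>x. cnj (w x)) - dnls_form \<Omega> \<sigma> f2 g2 (\<lambda>x. cnj (z x)) (\<lambda>x. cnj (w x)))\<bar>
    \<le> ?K * ((LINT x|lebesgue_on \<Omega>. cmod (g1 x) * (cmod (z x))\<^sup>2) + (LINT x|lebesgue_on \<Omega>. cmod (g2 x) * (cmod (z x))\<^sup>2))"
    unfolding z_def w_def by (rule dnls_form_energy[OF \<sigma> \<Omega> f1(1,2) f2(1,2)])
  also have "\<dots> \<le> ?K * ((?B * (L2_norm \<Omega> z)\<^sup>2 + sqrt (2 * h) / 2 ^ n * M\<^sup>2) + (?B * (L2_norm \<Omega> z)\<^sup>2 + sqrt (2 * h) / 2 ^ n * M\<^sup>2))"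
    by (intro mult_left_mono add_mono bound[OF f1] bound[OF f2] powr_lip_const_nonneg \<sigma>)
  finally show ?thesis unfolding growth_const_def growth_err_def by (simp add: algebra_simps)
qed

lemma H1_0_imp_L2_tendsto:
  assumes fs: "\<And>n. fs n \<in> H1_0 \<Omega>" and f: "f \<in> H1_0 \<Omega>" and \<Omega>: "open \<Omega>"
    and lim: "(\<lambda>n. H1_norm \<Omega> (\<lambda>x. fs n x - f x)) \<longlonglongrightarrow> 0"
  shows "L2_tendsto \<Omega> fs f" "L2_tendsto \<Omega> (\<lambda>n. weak_deriv \<Omega> (fs n)) (weak_deriv \<Omega> f)"
    "AE x in lebesgue_on \<Omega>. cmod (fs n x - f x) \<le> H1_norm \<Omega> (\<lambda>x. fs n x - f x)"
proof -
  note gs = H1_0_imp_grad[OF fs \<Omega>] and g = H1_0_imp_grad[OF f \<Omega>]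
  note d = H1_0_grad_diff[OF gs g]
  have b1: "norm (L2_norm \<Omega> (\<lambda>x. fs n x - f x)) \<le> H1_norm \<Omega> (\<lambda>x. fs n x - f x)" for n
    using L2_norm_le_H1_norm(1)[OF d \<Omega>] by simp
  have b2: "norm (L2_norm \<Omega> (\<lambda>x. weak_deriv \<Omega> (fs n) x - weak_deriv \<Omega> f x)) \<le> H1_norm \<Omega> (\<lambda>x. fs n x - f x)" for n
    using L2_norm_le_H1_norm(2)[OF d \<Omega>] by simp
  show "L2_tendsto \<Omega> fs f" "L2_tendsto \<Omega> (\<lambda>n. weak_deriv \<Omega> (fs n)) (weak_deriv \<Omega> f)"
    unfolding L2_tendsto_def
    using H1_0_grad_L2[OF gs] H1_0_grad_L2[OF g] Lim_null_comparison[OF always_eventually[OF allI[OF b1]] lim]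
      Lim_null_comparison[OF always_eventually[OF allI[OF b2]] lim] by auto
  show "AE x in lebesgue_on \<Omega>. cmod (fs n x - f x) \<le> H1_norm \<Omega> (\<lambda>x. fs n x - f x)"
    by (rule H1_0_AE_bound[OF d \<Omega>])
qed

text \<open>Continuity in \<open>H\<^sup>1\<close> is what makes the nonlinear term of a strongly measurable solution measurable in
time.\<close>

lemma nonlinearity_continuous:
  assumes \<sigma>: "1 / 2 \<le> \<sigma>" and fs: "\<And>n. fs n \<in> H1_0 \<Omega>" and f: "f \<in> H1_0 \<Omega>" and \<Omega>: "open \<Omega>"
    and lim: "(\<lambda>n. H1_norm \<Omega> (\<lambda>x. fs n x - f x)) \<longlonglongrightarrow> 0" and \<psi>: "\<psi> \<in> L2 \<Omega>"
  shows "(\<lambda>n. LINT x|lebesgue_on \<Omega>. complex_of_real (cmod (fs n x) powr (2 * \<sigma>)) * weak_deriv \<Omega> (fs n) x * \<psi> x)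
    \<longlonglongrightarrow> (LINT x|lebesgue_on \<Omega>. complex_of_real (cmod (f x) powr (2 * \<sigma>)) * weak_deriv \<Omega> f x * \<psi> x)"
proof (rule L2_tendsto_integral_mult[OF _ L2_tendsto_const[OF \<psi>]])
  note t = H1_0_imp_L2_tendsto[OF fs f \<Omega> lim]
  show "L2_tendsto \<Omega> (\<lambda>n x. complex_of_real (cmod (fs n x) powr (2 * \<sigma>)) * weak_deriv \<Omega> (fs n) x) (\<lambda>x. complex_of_real (cmod (f x) powr (2 * \<sigma>)) * weak_deriv \<Omega> f x)"
  proof (rule L2_tendsto_powr_mult[OF \<sigma> t(2), where e = "\<lambda>n. H1_norm \<Omega> (\<lambda>x. fs n x - f x)"])
    show "(\<lambda>x. cmod (fs n x)) \<in> borel_measurable (lebesgue_on \<Omega>)" for n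
      using L2_meas[OF L2_tendstoD(1)[OF t(1)], of n] by measurable
    show "(\<lambda>x. cmod (f x)) \<in> borel_measurable (lebesgue_on \<Omega>)"
      using L2_meas[OF L2_tendstoD(2)[OF t(1)]] by measurable
    show "AE x in lebesgue_on \<Omega>. cmod (f x) \<le> H1_norm \<Omega> f"
      by (rule H1_0_AE_bound[OF H1_0_imp_grad[OF f \<Omega>] \<Omega>])
    show "AE x in lebesgue_on \<Omega>. \<bar>cmod (fs n x) - cmod (f x)\<bar> \<le> H1_norm \<Omega> (\<lambda>x. fs n x - f x)" for n
      using t(3)[of n] by eventually_elim (meson norm_triangle_ineq3 order_trans)
  qed (use lim in simp_all)
qed

section \<open>From distributions in time to increments\<close>

lemma borel_measurable_lebesgue_on_AE:
  fixes f g :: "real \<Rightarrow> complex"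
  assumes f: "f \<in> borel_measurable (lebesgue_on I)" and I: "I \<in> sets lebesgue"
    and ae: "AE x in lebesgue_on I. f x = g x"
  shows "g \<in> borel_measurable (lebesgue_on I)"
proof -
  define f0 where "f0 x = (if x \<in> I then f x else 0)" for x
  define g0 where "g0 x = (if x \<in> I then g x else 0)" for x
  have f0: "f0 \<in> borel_measurable lebesgue" unfolding f0_def by (rule borel_measurable_if_I[OF f I])
  have "AE x in lebesgue. f0 x = g0 x"
    using ae I by (auto simp: AE_restrict_space_iff f0_def g0_def elim!: eventually_mono)
  then obtain N where N: "{x. f0 x \<noteq> g0 x} \<subseteq> N" "N \<in> null_sets lebesgue"
    by (auto simp: eventually_ae_filter)
  have null: "A \<in> null_sets lebesgue" if "A \<subseteq> N" for A
    using null_sets_completion_subset[OF that N(2)] .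
  have "g0 \<in> borel_measurable lebesgue"
  proof (rule measurableI)
    fix A :: "complex set" assume A: "A \<in> sets borel"
    have "g0 -` A \<inter> space lebesgue = (f0 -` A - N) \<union> (g0 -` A \<inter> N)"
    proof (rule set_eqI)
      fix x
      have "f0 x = g0 x" if "x \<notin> N" using N(1) that by blast
      then show "x \<in> g0 -` A \<inter> space lebesgue \<longleftrightarrow> x \<in> (f0 -` A - N) \<union> (g0 -` A \<inter> N)"
        by (cases "x \<in> N") simp_all
    qed
    moreover have "f0 -` A \<in> sets lebesgue" using measurable_sets[OF f0 A] by simp
    moreover have "N \<in> sets lebesgue" "g0 -` A \<inter> N \<in> sets lebesgue"
      using N(2) null[of "g0 -` A \<inter> N"] by auto
    ultimately show "g0 -` A \<inter> space lebesgue \<in> sets lebesgue"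
      by (simp only: sets.Un sets.Diff)
  qed simp
  then show ?thesis unfolding g0_def by (rule borel_measurable_if_D)
qed

lemma H1_norm_le_H32_norm: "H1_norm \<Omega> f \<le> H32_norm \<Omega> f"
  unfolding H32_norm_def by (rule real_le_rsqrt) simp

text \<open>A continuous functional maps the approximating simple functions to simple functions, and a limit
almost everywhere of measurable functions is measurable because Lebesgue measure is complete.\<close>

lemma functional_measurable:
  fixes \<Phi> :: "(real \<Rightarrow> complex) \<Rightarrow> complex"
  assumes u: "u \<in> Linfty I (H32 \<Omega> \<inter> H1_0 \<Omega>) (H32_norm \<Omega>)" and I: "I \<in> sets lebesgue"
    and \<Phi>: "\<And>fs f. (\<And>n. fs n \<in> H1_0 \<Omega>) \<Longrightarrow> f \<in> H1_0 \<Omega> \<Longrightarrow>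
      (\<lambda>n. H1_norm \<Omega> (\<lambda>x. fs n x - f x)) \<longlonglongrightarrow> 0 \<Longrightarrow> (\<lambda>n. \<Phi> (fs n)) \<longlonglongrightarrow> \<Phi> f"
  shows "(\<lambda>t. \<Phi> (u t)) \<in> borel_measurable (lebesgue_on I)"
proof -
  obtain s C where s: "\<And>n. simple_function (lebesgue_on I) (s n)" "\<And>n t. t \<in> I \<Longrightarrow> s n t \<in> H32 \<Omega> \<inter> H1_0 \<Omega>"
    "AE t in lebesgue_on I. (\<lambda>n. H32_norm \<Omega> (s n t - u t)) \<longlonglongrightarrow> 0"
    and C: "AE t in lebesgue_on I. u t \<in> H32 \<Omega> \<inter> H1_0 \<Omega> \<and> H32_norm \<Omega> (u t) \<le> C"
    using u unfolding Linfty_def by blast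
  have m: "(\<lambda>t. \<Phi> (s n t)) \<in> borel_measurable (lebesgue_on I)" for n
    by (rule borel_measurable_simple_function[OF simple_function_compose1[OF s(1)]])
  have "AE t in lebesgue_on I. t \<in> I" by (rule AE_I2) simp
  then have "AE t in lebesgue_on I. lim (\<lambda>n. \<Phi> (s n t)) = \<Phi> (u t)"
    using s(3) C
  proof eventually_elim
    case (elim t)
    have "(\<lambda>n. H1_norm \<Omega> (\<lambda>x. s n t x - u t x)) \<longlonglongrightarrow> 0"
    proof (rule Lim_null_comparison[OF always_eventually elim(2)], rule allI)
      show "norm (H1_norm \<Omega> (\<lambda>x. s n t x - u t x)) \<le> H32_norm \<Omega> (s n t - u t)" for n
        using H1_norm_le_H32_norm[of \<Omega> "s n t - u t"] by (simp add: fun_diff_def H1_norm_def)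
    qed
    then have "(\<lambda>n. \<Phi> (s n t)) \<longlonglongrightarrow> \<Phi> (u t)"
      using s(2)[OF elim(1)] elim(3) by (intro \<Phi>) auto
    then show ?case by (rule limI)
  qed
  from borel_measurable_lebesgue_on_AE[OF borel_measurable_lim_metric[OF m] I this] show ?thesis .
qed

lemma concentrated_average:
  fixes W :: "real \<Rightarrow> complex"
  assumes ab: "a < b" "{a..b} \<subseteq> I" and I: "open I" and W: "continuous_on {a..b} W"
    and r: "continuous_on UNIV r" "\<And>x. 0 \<le> r x" "\<And>x. x \<notin> {a..b} \<Longrightarrow> r x = 0"
    and r1: "(LINT x|lborel. indicator {a..b} x *\<^sub>R r x) = (1::real)"
    and e: "\<And>x. x \<in> {a..b} \<Longrightarrow> cmod (W x - c) \<le> e"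
  shows "cmod ((LINT x|lebesgue_on I. complex_of_real (r x) * W x) - c) \<le> e"
    "integrable (lebesgue_on I) (\<lambda>x. complex_of_real (r x) * W x)"
proof -
  define k where "k x = indicator {a..b} x *\<^sub>R (complex_of_real (r x) * W x)" for x
  have cont: "continuous_on {a..b} (\<lambda>x. complex_of_real (r x) * W x)"
    by (intro continuous_intros W continuous_on_subset[OF r(1)]) simp
  have k: "integrable lborel k" unfolding k_def by (rule borel_integrable_compact[OF compact_Icc cont])
  have mk: "k \<in> borel_measurable borel" using borel_measurable_integrable[OF k] by simp
  have eq: "indicator I x *\<^sub>R (complex_of_real (r x) * W x) = k x" for x
    using ab(2) r(3)[of x] by (auto simp: k_def indicator_def)
  have "integrable lebesgue (\<lambda>x. indicator I x *\<^sub>R (complex_of_real (r x) * W x))"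
    unfolding eq using k mk by (simp add: integrable_completion)
  then show "integrable (lebesgue_on I) (\<lambda>x. complex_of_real (r x) * W x)"
    using I by (simp add: integrable_restrict_space)
  have "(LINT x|lebesgue_on I. complex_of_real (r x) * W x) = (LINT x|lebesgue. indicator I x *\<^sub>R (complex_of_real (r x) * W x))"
    using I by (intro integral_restrict_space) simp
  also have "\<dots> = (LINT x|lborel. k x)" unfolding eq using mk by (simp add: integral_completion)
  finally have 1: "(LINT x|lebesgue_on I. complex_of_real (r x) * W x) = (LINT x|lborel. k x)" .
  have ir: "integrable lborel (\<lambda>x. indicator {a..b} x *\<^sub>R r x)"
    by (rule borel_integrable_compact[OF compact_Icc continuous_on_subset[OF r(1)]]) simp
  have ic: "integrable lborel (\<lambda>x. (indicator {a..b} x *\<^sub>R r x) *\<^sub>R c)"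
    using ir by simp
  have "(LINT x|lborel. (indicator {a..b} x *\<^sub>R r x) *\<^sub>R c) = c"
    using ir r1 by (simp only: integral_scaleR_left scaleR_one)
  then have "(LINT x|lborel. k x) - c = (LINT x|lborel. k x - (indicator {a..b} x *\<^sub>R r x) *\<^sub>R c)"
    using Bochner_Integration.integral_diff[OF k ic] by simp
  also have "cmod \<dots> \<le> (LINT x|lborel. e * (indicator {a..b} x *\<^sub>R r x))"
  proof (rule order_trans[OF integral_norm_bound], rule integral_mono)
    show "integrable lborel (\<lambda>x. cmod (k x - (indicator {a..b} x *\<^sub>R r x) *\<^sub>R c))"
      by (intro integrable_norm Bochner_Integration.integrable_diff k ic)
    show "integrable lborel (\<lambda>x. e * (indicator {a..b} x *\<^sub>R r x))" by (rule integrable_mult_right[OF ir])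
    show "cmod (k x - (indicator {a..b} x *\<^sub>R r x) *\<^sub>R c) \<le> e * (indicator {a..b} x *\<^sub>R r x)" for x
    proof (cases "x \<in> {a..b}")
      case True
      then have "k x - (indicator {a..b} x *\<^sub>R r x) *\<^sub>R c = complex_of_real (r x) * (W x - c)"
        by (simp add: k_def scaleR_conv_of_real right_diff_distrib)
      then have "cmod (k x - (indicator {a..b} x *\<^sub>R r x) *\<^sub>R c) = r x * cmod (W x - c)"
        using r(2)[of x] by (simp add: norm_mult)
      also have "\<dots> \<le> r x * e" by (rule mult_left_mono[OF e[OF True] r(2)])
      finally show ?thesis using True by (simp add: mult.commute)
    qed (simp add: k_def)
  qed
  also have "\<dots> = e" using r1 by (simp only: integral_mult_right_zero)
  finally show "cmod ((LINT x|lebesgue_on I. complex_of_real (r x) * W x) - c) \<le> e" unfolding 1 .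
qed

text \<open>Test the equation with a smooth cut-off \<open>\<eta>\<close> with values in \<open>[0, 1]\<close> that rises from \<open>0\<close> to \<open>1\<close> on
\<open>[s, s + \<epsilon>]\<close> and falls back on \<open>[t - \<epsilon>, t]\<close>. Its derivative is a difference of two averaging kernels, so the
left-hand side is close to \<open>W s - W t\<close>. Since \<open>\<eta>\<close> vanishes outside \<open>(s, t)\<close>, the bound for \<open>A\<close> is required
only there, and no primitive of \<open>A\<close> has to be formed.\<close>

lemma weak_time_derivative_bound:
  fixes W A :: "real \<Rightarrow> complex"
  assumes I: "open I" and st: "s < t" "{s..t} \<subseteq> I" and W: "continuous_on I W"
    and weak: "\<And>\<eta>. \<eta> \<in> test_functions I \<Longrightarrow> (LINT \<tau>|lebesgue_on I. dir_deriv 1 \<eta> \<tau> * W \<tau>) = - (LINT \<tau>|lebesgue_on I. \<eta> \<tau> * A \<tau>)"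
    and S: "AE \<tau> in lebesgue_on I. s < \<tau> \<longrightarrow> \<tau> < t \<longrightarrow> \<bar>Re (A \<tau>)\<bar> \<le> S" "0 \<le> S"
    and int: "\<And>\<eta>. \<eta> \<in> test_functions I \<Longrightarrow> integrable (lebesgue_on I) (\<lambda>\<tau>. \<eta> \<tau> * A \<tau>)"
  shows "\<bar>Re (W t - W s)\<bar> \<le> S * (t - s)"
proof (rule field_le_epsilon)
  fix e :: real assume e: "e > 0"
  obtain \<rho> \<Theta> :: "real \<Rightarrow> real" where \<Theta>: "\<And>k. C_k k \<Theta>" "\<And>x. (\<Theta> has_real_derivative \<rho> x) (at x)"
    "\<And>x. x \<le> 0 \<Longrightarrow> \<Theta> x = 0" "\<And>x. 1 \<le> x \<Longrightarrow> \<Theta> x = 1" "mono \<Theta>"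
    "continuous_on UNIV \<rho>" "\<And>x. \<rho> x \<ge> 0" "\<And>x. x \<le> 0 \<or> 1 \<le> x \<Longrightarrow> \<rho> x = 0"
    using smooth_step_exists by metis
  have near: "\<exists>d>0. \<forall>x\<in>I. \<bar>x - y\<bar> \<le> d \<longrightarrow> cmod (W x - W y) \<le> e / 2" if y: "y \<in> I" for y
  proof -
    obtain d where d: "d > 0" "\<And>x. x \<in> I \<Longrightarrow> dist x y < d \<Longrightarrow> dist (W x) (W y) < e / 2"
      using W[unfolded continuous_on_iff, rule_format, OF y, of "e / 2"] e by auto
    show ?thesis using d by (intro exI[of _ "d / 2"]) (auto simp: dist_norm intro!: less_imp_le)
  qed
  have sI: "s \<in> I" "t \<in> I" using st by auto
  obtain d1 where d1: "d1 > 0" "\<And>x. x \<in> I \<Longrightarrow> \<bar>x - s\<bar> \<le> d1 \<Longrightarrow> cmod (W x - W s) \<le> e / 2" using near[OF sI(1)] by blast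
  obtain d2 where d2: "d2 > 0" "\<And>x. x \<in> I \<Longrightarrow> \<bar>x - t\<bar> \<le> d2 \<Longrightarrow> cmod (W x - W t) \<le> e / 2" using near[OF sI(2)] by blast
  define \<epsilon> where "\<epsilon> = min (t - s) (min d1 d2)"
  have \<epsilon>: "\<epsilon> > 0" "\<epsilon> \<le> t - s" "\<epsilon> \<le> d1" "\<epsilon> \<le> d2" using st d1(1) d2(1) by (auto simp: \<epsilon>_def)
  \<comment> \<open>The step that rises from \<open>0\<close> to \<open>1\<close> on \<open>[a, a + \<epsilon>]\<close>, written in the affine form to which the closure of smoothness under affine substitutions applies.\<close>
  define \<Theta>a where "\<Theta>a a \<tau> = \<Theta> (- (a / \<epsilon>) + \<tau> / \<epsilon>)" for a \<tau>
  define ra where "ra a \<tau> = \<rho> (- (a / \<epsilon>) + \<tau> / \<epsilon>) / \<epsilon>" for a \<tau>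
  have arg: "- (a / \<epsilon>) + \<tau> / \<epsilon> = (\<tau> - a) / \<epsilon>" for a \<tau> by (simp add: diff_divide_distrib)
  have C\<Theta>: "C_k k (\<Theta>a a)" for k a
    unfolding \<Theta>a_def by (rule C_k_compose_affine[OF bounded_linear_divide \<Theta>(1)])
  have d\<Theta>: "(\<Theta>a a has_real_derivative ra a \<tau>) (at \<tau>)" for a \<tau>
    unfolding \<Theta>a_def ra_def
    by (rule DERIV_chain2[OF \<Theta>(2), of _ "1 / \<epsilon>", simplified]) (use \<epsilon> in \<open>auto intro!: derivative_eq_intros\<close>)
  have cra: "continuous_on X (ra a)" for X a
    unfolding ra_def using \<epsilon>(1) by (intro continuous_intros continuous_on_compose2[OF \<Theta>(6)]) auto
  have ra0: "0 \<le> ra a \<tau>" for a \<tau> using \<Theta>(7) \<epsilon>(1) by (simp add: ra_def)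
  have raout: "ra a \<tau> = 0" if "\<tau> \<notin> {a..a+\<epsilon>}" for a \<tau>
  proof -
    have "(\<tau> - a) / \<epsilon> \<le> 0 \<or> 1 \<le> (\<tau> - a) / \<epsilon>"
      using that \<epsilon>(1) by (auto simp: divide_le_0_iff pos_le_divide_eq)
    then show ?thesis unfolding ra_def arg by (simp add: \<Theta>(8))
  qed
  have ra1: "(LINT \<tau>|lborel. indicator {a..a+\<epsilon>} \<tau> *\<^sub>R ra a \<tau>) = 1" for a
  proof -
    have "(LINT \<tau>|lborel. indicator {a..a+\<epsilon>} \<tau> *\<^sub>R ra a \<tau>) = \<Theta>a a (a + \<epsilon>) - \<Theta>a a a"
    proof (rule integral_FTC_atLeastAtMost[OF _ _ cra])
      show "(\<Theta>a a has_vector_derivative ra a \<tau>) (at \<tau> within {a..a + \<epsilon>})" for \<tau>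
        using d\<Theta>[of a \<tau>] unfolding has_real_derivative_iff_has_vector_derivative by (rule has_vector_derivative_at_within)
    qed (use \<epsilon> in simp)
    also have "\<dots> = 1" unfolding \<Theta>a_def arg using \<Theta>(3)[of 0] \<Theta>(4)[of 1] \<epsilon>(1) by simp
    finally show ?thesis .
  qed
  define \<eta> where "\<eta> \<tau> = complex_of_real (\<Theta>a s \<tau> + - \<Theta>a (t - \<epsilon>) \<tau>)" for \<tau>
  have \<Theta>le: "\<Theta>a (t - \<epsilon>) \<tau> \<le> \<Theta>a s \<tau>" for \<tau>
    unfolding \<Theta>a_def arg using \<epsilon> by (intro monoD[OF \<Theta>(5)] divide_right_mono) auto
  have \<Theta>01: "0 \<le> \<Theta> x" "\<Theta> x \<le> 1" for x
  proof -
    show "0 \<le> \<Theta> x" using monoD[OF \<Theta>(5), of "min x 0" x] \<Theta>(3)[of "min x 0"] by simp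
    show "\<Theta> x \<le> 1" using monoD[OF \<Theta>(5), of x "max x 1"] \<Theta>(4)[of "max x 1"] by simp
  qed
  have \<eta>out: "\<eta> \<tau> = 0" if "\<tau> \<notin> {s<..<t}" for \<tau>
  proof (cases "\<tau> \<le> s")
    case True
    have "\<Theta>a s \<tau> = 0" unfolding \<Theta>a_def arg using True \<epsilon>(1) by (intro \<Theta>(3)) (simp add: divide_le_0_iff)
    moreover have "0 \<le> \<Theta>a (t - \<epsilon>) \<tau>" by (simp add: \<Theta>a_def \<Theta>01)
    ultimately have "\<Theta>a (t - \<epsilon>) \<tau> = 0" using \<Theta>le[of \<tau>] by simp
    with \<open>\<Theta>a s \<tau> = 0\<close> show ?thesis by (simp add: \<eta>_def)
  next
    case False
    with that have "t \<le> \<tau>" by simp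
    then have "1 \<le> (\<tau> - s) / \<epsilon>" "1 \<le> (\<tau> - (t - \<epsilon>)) / \<epsilon>"
      using \<epsilon> by (auto simp: pos_le_divide_eq)
    then have "\<Theta>a s \<tau> = 1" "\<Theta>a (t - \<epsilon>) \<tau> = 1"
      unfolding \<Theta>a_def arg using \<Theta>(4) by blast+
    then show ?thesis by (simp add: \<eta>_def)
  qed
  have \<eta>1: "cmod (\<eta> \<tau>) \<le> 1" for \<tau>
  proof -
    have "0 \<le> \<Theta>a s \<tau> + - \<Theta>a (t - \<epsilon>) \<tau>" "\<Theta>a s \<tau> + - \<Theta>a (t - \<epsilon>) \<tau> \<le> 1"
      using \<Theta>le[of \<tau>] \<Theta>01[of "- (s / \<epsilon>) + \<tau> / \<epsilon>"] \<Theta>01[of "- ((t - \<epsilon>) / \<epsilon>) + \<tau> / \<epsilon>"] unfolding \<Theta>a_def by linarith+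
    then show ?thesis unfolding \<eta>_def norm_of_real by simp
  qed
  have \<eta>: "\<eta> \<in> test_functions I"
  proof (rule test_functionsI[of _ "{s..t}"])
    show "C_k k \<eta>" for k
      unfolding \<eta>_def
      by (rule C_k_bounded_linear[OF bounded_linear_of_real C_k_add[OF C\<Theta> C_k_bounded_linear[OF bounded_linear_minus[OF bounded_linear_ident] C\<Theta>]]])
    show "{z. \<eta> z \<noteq> 0} \<subseteq> {s..t}"
    proof
      fix z assume "z \<in> {z. \<eta> z \<noteq> 0}"
      then have "z \<in> {s<..<t}" using \<eta>out[of z] by blast
      then show "z \<in> {s..t}" by simp
    qed
  qed (use st in auto)
  have d\<eta>: "dir_deriv 1 \<eta> = (\<lambda>\<tau>. complex_of_real (ra s \<tau>) - complex_of_real (ra (t - \<epsilon>) \<tau>))"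
  proof (rule ext, rule dir_deriv_1_eq)
    fix \<tau>
    have "((\<lambda>\<tau>. \<Theta>a s \<tau> + - \<Theta>a (t - \<epsilon>) \<tau>) has_vector_derivative (ra s \<tau> - ra (t - \<epsilon>) \<tau>)) (at \<tau>)"
      using DERIV_diff[OF d\<Theta>[of s \<tau>] d\<Theta>[of "t - \<epsilon>" \<tau>]] unfolding has_real_derivative_iff_has_vector_derivative by simp
    then have "((\<lambda>\<tau>. complex_of_real (\<Theta>a s \<tau> + - \<Theta>a (t - \<epsilon>) \<tau>)) has_vector_derivative complex_of_real (ra s \<tau> - ra (t - \<epsilon>) \<tau>)) (at \<tau>)"
      by (rule bounded_linear.has_vector_derivative[OF bounded_linear_of_real])
    then show "(\<eta> has_vector_derivative complex_of_real (ra s \<tau>) - complex_of_real (ra (t - \<epsilon>) \<tau>)) (at \<tau>)"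
      unfolding \<eta>_def[abs_def] by (simp only: of_real_diff)
  qed
  have sub: "{s..s+\<epsilon>} \<subseteq> I" "{t-\<epsilon>..t-\<epsilon>+\<epsilon>} \<subseteq> I" using \<epsilon> st by auto
  have ends: "s < s + \<epsilon>" "t - \<epsilon> < t - \<epsilon> + \<epsilon>" using \<epsilon>(1) by simp_all
  have near_s: "cmod (W x - W s) \<le> e / 2" if "x \<in> {s..s+\<epsilon>}" for x
    using that \<epsilon> sub(1) by (intro d1(2)) auto
  have near_t: "cmod (W x - W t) \<le> e / 2" if "x \<in> {t-\<epsilon>..t-\<epsilon>+\<epsilon>}" for x
    using that \<epsilon> sub(2) by (intro d2(2)) auto
  have as: "cmod ((LINT x|lebesgue_on I. complex_of_real (ra s x) * W x) - W s) \<le> e / 2"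
    "integrable (lebesgue_on I) (\<lambda>x. complex_of_real (ra s x) * W x)"
    by (rule concentrated_average[OF ends(1) sub(1) I continuous_on_subset[OF W sub(1)] cra ra0 raout ra1 near_s], assumption+)+
  have at: "cmod ((LINT x|lebesgue_on I. complex_of_real (ra (t - \<epsilon>) x) * W x) - W t) \<le> e / 2"
    "integrable (lebesgue_on I) (\<lambda>x. complex_of_real (ra (t - \<epsilon>) x) * W x)"
    by (rule concentrated_average[OF ends(2) sub(2) I continuous_on_subset[OF W sub(2)] cra ra0 raout ra1 near_t], assumption+)+
  have "(LINT \<tau>|lebesgue_on I. dir_deriv 1 \<eta> \<tau> * W \<tau>) = (LINT x|lebesgue_on I. complex_of_real (ra s x) * W x) - (LINT x|lebesgue_on I. complex_of_real (ra (t - \<epsilon>) x) * W x)"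
    unfolding d\<eta> left_diff_distrib by (rule Bochner_Integration.integral_diff[OF as(2) at(2)])
  then have eq: "W t - W s = ((LINT x|lebesgue_on I. complex_of_real (ra s x) * W x) - W s)
      - ((LINT x|lebesgue_on I. complex_of_real (ra (t - \<epsilon>) x) * W x) - W t) + (LINT \<tau>|lebesgue_on I. \<eta> \<tau> * A \<tau>)"
    using weak[OF \<eta>] by (simp add: algebra_simps)
  have "\<bar>Re (LINT \<tau>|lebesgue_on I. \<eta> \<tau> * A \<tau>)\<bar> \<le> S * (t - s)"
  proof -
    have ind: "integrable (lebesgue_on I) (\<lambda>\<tau>. S * (cmod (indicator {s..t} \<tau>))\<^sup>2)"
      by (rule integrable_mult_right[OF L2_integrable_square[OF L2_indicator(1)[OF I]]])
    have "\<bar>LINT \<tau>|lebesgue_on I. Re (\<eta> \<tau> * A \<tau>)\<bar> \<le> (LINT \<tau>|lebesgue_on I. \<bar>Re (\<eta> \<tau> * A \<tau>)\<bar>)"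
      by (rule integral_abs_bound)
    also have "\<dots> \<le> (LINT \<tau>|lebesgue_on I. S * (cmod (indicator {s..t} \<tau>))\<^sup>2)"
    proof (rule integral_mono_AE[OF _ ind])
      show "integrable (lebesgue_on I) (\<lambda>\<tau>. \<bar>Re (\<eta> \<tau> * A \<tau>)\<bar>)" by (intro integrable_abs integrable_Re int[OF \<eta>])
      show "AE \<tau> in lebesgue_on I. \<bar>Re (\<eta> \<tau> * A \<tau>)\<bar> \<le> S * (cmod (indicator {s..t} \<tau>))\<^sup>2"
        using S(1)
      proof eventually_elim
        case (elim \<tau>)
        show ?case
        proof (cases "\<tau> \<in> {s<..<t}")
          case True
          have "Re (\<eta> \<tau> * A \<tau>) = Re (\<eta> \<tau>) * Re (A \<tau>)" by (simp add: \<eta>_def)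
          moreover have "\<bar>Re (\<eta> \<tau>)\<bar> \<le> 1" using abs_Re_le_cmod[of "\<eta> \<tau>"] \<eta>1[of \<tau>] by linarith
          ultimately have "\<bar>Re (\<eta> \<tau> * A \<tau>)\<bar> \<le> 1 * S"
            using elim True by (simp only: abs_mult) (intro mult_mono; simp)
          then show ?thesis using True by simp
        qed (use \<eta>out S(2) in simp)
      qed
    qed
    also have "\<dots> = S * (L2_norm I (indicator {s..t}))\<^sup>2" unfolding L2_norm_power2 by simp
    also have "\<dots> = S * (t - s)" using integral_indicator_Icc(2)[OF st(2) _ I] st(1) by simp
    finally show ?thesis using integral_Re[OF int[OF \<eta>]] by simp
  qed
  moreover have "\<bar>Re (W t - W s)\<bar> \<le> e / 2 + e / 2 + \<bar>Re (LINT \<tau>|lebesgue_on I. \<eta> \<tau> * A \<tau>)\<bar>"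
  proof -
    have "\<bar>Re ((LINT x|lebesgue_on I. complex_of_real (ra s x) * W x) - W s)\<bar> \<le> e / 2"
      "\<bar>Re ((LINT x|lebesgue_on I. complex_of_real (ra (t - \<epsilon>) x) * W x) - W t)\<bar> \<le> e / 2"
      using order_trans[OF abs_Re_le_cmod as(1)] order_trans[OF abs_Re_le_cmod at(1)] .
    then show ?thesis unfolding eq plus_complex.simps minus_complex.simps by linarith
  qed
  ultimately show "\<bar>Re (W t - W s)\<bar> \<le> S * (t - s) + e" by linarith
qed

text \<open>The supremum that defines the dual norm runs over the closed unit ball. Dividing by \<open>H1_norm g + 1\<close> instead
of \<open>H1_norm g\<close> moves \<open>g\<close> into it even when its norm is \<open>0\<close>.\<close>

lemma Hminus1_pairing_le:
  assumes l: "l \<in> Hminus1 \<Omega>" "k \<in> Hminus1 \<Omega>" and g: "H1_0_grad \<Omega> g g'" and \<Omega>: "open \<Omega>"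
  shows "cmod (l g - k g) \<le> (H1_norm \<Omega> g + 1) * Hminus1_norm \<Omega> (\<lambda>g. l g - k g)"
proof -
  obtain C where C: "\<And>g. g \<in> H1_0 \<Omega> \<Longrightarrow> cmod (l g) \<le> C * H1_norm \<Omega> g" using l(1) unfolding Hminus1_def by blast
  obtain D where D: "\<And>g. g \<in> H1_0 \<Omega> \<Longrightarrow> cmod (k g) \<le> D * H1_norm \<Omega> g" using l(2) unfolding Hminus1_def by blast
  have lin: "l (\<lambda>x. a * g x + b * g x) = a * l g + b * l g" "k (\<lambda>x. a * g x + b * g x) = a * k g + b * k g" for a b
    using l H1_0_gradI[OF g \<Omega>] unfolding Hminus1_def by blast+
  define c where "c = complex_of_real (1 / (H1_norm \<Omega> g + 1))"
  have pos: "H1_norm \<Omega> g + 1 > 0" by (simp add: H1_norm_def add_nonneg_pos)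
  have cg: "H1_0_grad \<Omega> (\<lambda>x. c * g x) (\<lambda>x. c * g' x)" by (rule H1_0_grad_scale[OF g])
  have "H1_norm \<Omega> (\<lambda>x. c * g x) = cmod c * H1_norm \<Omega> g"
    unfolding H1_0_grad_weak_deriv(3)[OF cg \<Omega>] H1_0_grad_weak_deriv(3)[OF g \<Omega>] L2_norm_scale
    by (simp add: power_mult_distrib real_sqrt_mult flip: distrib_left)
  also have "\<dots> \<le> 1" using pos by (simp add: c_def norm_divide H1_norm_def divide_le_eq del: of_real_add of_real_divide)
  finally have n: "H1_norm \<Omega> (\<lambda>x. c * g x) \<le> 1" .
  have "bdd_above ((\<lambda>g. cmod (l g - k g)) ` {g \<in> H1_0 \<Omega>. H1_norm \<Omega> g \<le> 1})"
  proof (rule bdd_aboveI2)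
    fix f assume f: "f \<in> {g \<in> H1_0 \<Omega>. H1_norm \<Omega> g \<le> 1}"
    have "0 \<le> H1_norm \<Omega> f" by (simp add: H1_norm_def)
    moreover have "H1_norm \<Omega> f \<le> 1" using f by simp
    ultimately have "C * H1_norm \<Omega> f \<le> \<bar>C\<bar> * 1" "D * H1_norm \<Omega> f \<le> \<bar>D\<bar> * 1"
      by (intro mult_mono; simp)+
    then show "cmod (l f - k f) \<le> \<bar>C\<bar> + \<bar>D\<bar>"
      using C[of f] D[of f] f norm_triangle_ineq4[of "l f" "k f"] by simp
  qed
  then have "cmod (l (\<lambda>x. c * g x) - k (\<lambda>x. c * g x)) \<le> Hminus1_norm \<Omega> (\<lambda>g. l g - k g)"
    unfolding Hminus1_norm_def using H1_0_gradI[OF cg \<Omega>] n by (intro cSUP_upper) auto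
  moreover have "l (\<lambda>x. c * g x) - k (\<lambda>x. c * g x) = c * (l g - k g)"
    using lin(1)[of c 0] lin(2)[of c 0] by (simp add: right_diff_distrib)
  moreover have "cmod c = 1 / (H1_norm \<Omega> g + 1)" using pos by (simp add: c_def del: of_real_add of_real_divide)
  ultimately show ?thesis using pos by (simp add: norm_mult divide_le_eq mult.commute)
qed

lemma bounded_integrable_Ioo:
  fixes f :: "real \<Rightarrow> complex"
  assumes "f \<in> borel_measurable (lebesgue_on {a<..<b})" "AE x in lebesgue_on {a<..<b}. cmod (f x) \<le> B"
  shows "integrable (lebesgue_on {a<..<b}) f"
proof -
  have "finite_measure (lebesgue_on {a<..<b})" by (rule finite_measure_lebesgue_on) simp
  then show ?thesis using finite_measure.integrable_const_bound[of _ f B] assms by blast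
qed

text \<open>Test functions \<open>\<eta>(t) \<xi>(x)\<close> turn the distributional equation into \<open>W' = A\<close> on the time interval, where
\<open>W t = \<integral> u(t) \<xi>\<close> for almost every \<open>t\<close>. The functional \<open>w\<close> supplies the continuous version of \<open>W\<close>. One
derivative is moved from \<open>\<xi>\<close> to \<open>u(t)\<close>, so that only \<open>\<xi>\<close> and its first derivative occur in \<open>A\<close>.\<close>

lemma solution_test_equation:
  assumes \<sigma>: "1 / 2 \<le> \<sigma>" and \<Omega>: "open \<Omega>" and T: "T > 0" and sol: "dnls_solution T \<Omega> \<sigma> u"
    and C: "AE t in lebesgue_on {-T<..<T}. u t \<in> H1_0 \<Omega> \<and> H1_norm \<Omega> (u t) \<le> C"
    and w: "\<And>t. t \<in> {-T<..<T} \<Longrightarrow> w t \<in> Hminus1 \<Omega>"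
    "\<And>t. t \<in> {-T<..<T} \<Longrightarrow> ((\<lambda>s. Hminus1_norm \<Omega> (\<lambda>g. w s g - w t g)) \<longlongrightarrow> 0) (at t within {-T<..<T})"
    "AE t in lebesgue_on {-T<..<T}. \<forall>g\<in>H1_0 \<Omega>. w t g = L2_functional \<Omega> (u t) g"
    and \<xi>: "\<xi> \<in> test_functions \<Omega>"
  defines "A \<equiv> \<lambda>t. dnls_form \<Omega> \<sigma> (u t) (weak_deriv \<Omega> (u t)) \<xi> (dir_deriv 1 \<xi>)"
  shows "continuous_on {-T<..<T} (\<lambda>t. w t \<xi>)"
    and "\<And>\<eta>. \<eta> \<in> test_functions {-T<..<T} \<Longrightarrow>
      (LINT t|lebesgue_on {-T<..<T}. dir_deriv 1 \<eta> t * w t \<xi>) = - (LINT t|lebesgue_on {-T<..<T}. \<eta> t * A t)"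
    and "\<And>\<eta>. \<eta> \<in> test_functions {-T<..<T} \<Longrightarrow> integrable (lebesgue_on {-T<..<T}) (\<lambda>t. \<eta> t * A t)"
proof -
  let ?I = "{-T<..<T}" and ?M = "lebesgue_on \<Omega>"
  let ?MI = "lebesgue_on ?I"
  define \<xi>' where "\<xi>' = dir_deriv 1 \<xi>"
  have \<xi>': "\<xi>' \<in> test_functions \<Omega>" unfolding \<xi>'_def by (rule test_functions_deriv[OF \<xi>])
  have \<xi>g: "H1_0_grad \<Omega> \<xi> \<xi>'" unfolding \<xi>'_def by (rule H1_0_grad_test[OF \<xi> \<Omega>])
  note L = test_functions_L2[OF \<xi> \<Omega>] test_functions_L2[OF \<xi>' \<Omega>]
  have u: "u \<in> Linfty ?I (H32 \<Omega> \<inter> H1_0 \<Omega>) (H32_norm \<Omega>)" using sol by (simp add: dnls_solution_def)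
  show contW: "continuous_on ?I (\<lambda>t. w t \<xi>)"
    unfolding continuous_on_def
  proof (intro ballI)
    fix t assume t: "t \<in> ?I"
    have "((\<lambda>s. (H1_norm \<Omega> \<xi> + 1) * Hminus1_norm \<Omega> (\<lambda>g. w s g - w t g)) \<longlongrightarrow> 0) (at t within ?I)"
      by (rule tendsto_mult_right_zero[OF w(2)[OF t]])
    then have "((\<lambda>s. w s \<xi> - w t \<xi>) \<longlongrightarrow> 0) (at t within ?I)"
    proof (rule Lim_null_comparison[rotated])
      show "\<forall>\<^sub>F s in at t within ?I. cmod (w s \<xi> - w t \<xi>) \<le> (H1_norm \<Omega> \<xi> + 1) * Hminus1_norm \<Omega> (\<lambda>g. w s g - w t g)"
        unfolding eventually_at_filter
        by (intro always_eventually allI impI Hminus1_pairing_le[OF w(1) w(1)[OF t] \<xi>g \<Omega>])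
    qed
    then show "((\<lambda>s. w s \<xi>) \<longlongrightarrow> w t \<xi>) (at t within ?I)" by (simp add: LIM_zero_iff)
  qed
  define P where "P t = (LINT x|?M. u t x * \<xi> x)" for t
  define Q where "Q t = (LINT x|?M. weak_deriv \<Omega> (u t) x * \<xi>' x)" for t
  define N where "N t = (LINT x|?M. complex_of_real (cmod (u t x) powr (2 * \<sigma>)) * weak_deriv \<Omega> (u t) x * \<xi> x)" for t
  define Q2 where "Q2 t = (LINT x|?M. u t x * dir_deriv 1 \<xi>' x)" for t
  have A: "A = (\<lambda>t. - \<i> * Q t - N t)" unfolding A_def dnls_form_def Q_def N_def \<xi>'_def by simp
  have Is: "?I \<in> sets lebesgue" by simp
  have mP: "P \<in> borel_measurable ?MI" unfolding P_def[abs_def]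
    by (rule functional_measurable[OF u Is, of "\<lambda>f. LINT x|?M. f x * \<xi> x"])
       (rule L2_tendsto_integral_mult[OF H1_0_imp_L2_tendsto(1)[OF _ _ \<Omega>] L2_tendsto_const[OF L(1)]])
  have mQ: "Q \<in> borel_measurable ?MI" unfolding Q_def[abs_def]
    by (rule functional_measurable[OF u Is, of "\<lambda>f. LINT x|?M. weak_deriv \<Omega> f x * \<xi>' x"])
       (rule L2_tendsto_integral_mult[OF H1_0_imp_L2_tendsto(2)[OF _ _ \<Omega>] L2_tendsto_const[OF L(2)]])
  have mQ2: "Q2 \<in> borel_measurable ?MI" unfolding Q2_def[abs_def]
    by (rule functional_measurable[OF u Is, of "\<lambda>f. LINT x|?M. f x * dir_deriv 1 \<xi>' x"])
       (rule L2_tendsto_integral_mult[OF H1_0_imp_L2_tendsto(1)[OF _ _ \<Omega>] L2_tendsto_const[OF test_functions_L2[OF test_functions_deriv[OF \<xi>'] \<Omega>]]])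
  have mN: "N \<in> borel_measurable ?MI" unfolding N_def[abs_def]
    by (rule functional_measurable[OF u Is, of "\<lambda>f. LINT x|?M. complex_of_real (cmod (f x) powr (2 * \<sigma>)) * weak_deriv \<Omega> f x * \<xi> x"])
       (rule nonlinearity_continuous[OF \<sigma> _ _ \<Omega> _ L(1)])
  have grad: "AE t in ?MI. H1_0_grad \<Omega> (u t) (weak_deriv \<Omega> (u t)) \<and> H1_norm \<Omega> (u t) \<le> C"
    using C by eventually_elim (auto intro: H1_0_imp_grad[OF _ \<Omega>])
  have bQ: "AE t in ?MI. cmod (Q t) \<le> C * L2_norm \<Omega> \<xi>'"
    using grad
  proof eventually_elim
    case (elim t)
    then have g: "H1_0_grad \<Omega> (u t) (weak_deriv \<Omega> (u t))" by blast
    have "cmod (Q t) \<le> L2_norm \<Omega> (weak_deriv \<Omega> (u t)) * L2_norm \<Omega> \<xi>'"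
      unfolding Q_def by (rule L2_integral_mult_le[OF H1_0_grad_L2(2)[OF g] L(2)])
    also have "\<dots> \<le> C * L2_norm \<Omega> \<xi>'"
      using L2_norm_le_H1_norm(2)[OF g \<Omega>] elim by (intro mult_right_mono) auto
    finally show ?case .
  qed
  have bN: "AE t in ?MI. cmod (N t) \<le> C powr (2 * \<sigma>) * C * L2_norm \<Omega> \<xi>"
    using grad
  proof eventually_elim
    case (elim t)
    then have g: "H1_0_grad \<Omega> (u t) (weak_deriv \<Omega> (u t))" by blast
    have b: "AE x in ?M. cmod (u t x) \<le> C"
      using H1_0_AE_bound[OF g \<Omega>] by eventually_elim (use elim in linarith)
    note p = powr_mult_L2[OF \<sigma> L2_meas[OF H1_0_grad_L2(1)[OF g]] b H1_0_grad_L2(2)[OF g]]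
    have "cmod (N t) \<le> L2_norm \<Omega> (\<lambda>x. complex_of_real (cmod (u t x) powr (2 * \<sigma>)) * weak_deriv \<Omega> (u t) x) * L2_norm \<Omega> \<xi>"
      unfolding N_def by (rule L2_integral_mult_le[OF p(1) L(1)])
    also have "\<dots> \<le> C powr (2 * \<sigma>) * C * L2_norm \<Omega> \<xi>"
    proof (intro mult_right_mono order_trans[OF p(2)] mult_left_mono)
      show "L2_norm \<Omega> (weak_deriv \<Omega> (u t)) \<le> C" using L2_norm_le_H1_norm(2)[OF g \<Omega>] elim by linarith
    qed auto
    finally show ?case .
  qed
  have QQ2: "AE t in ?MI. Q2 t = - Q t"
    using grad
  proof eventually_elim
    case (elim t)
    then have "has_L2_weak_deriv \<Omega> (u t) (weak_deriv \<Omega> (u t))" using H1_0_grad_has_weak_deriv[OF _ \<Omega>] by blast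
    then show ?case unfolding Q2_def Q_def using \<xi>' by (simp add: has_L2_weak_deriv_def)
  qed
  have PW: "AE t in ?MI. P t = w t \<xi>"
    using w(3) by eventually_elim (simp add: P_def L2_functional_def H1_0_gradI[OF \<xi>g \<Omega>])
  fix \<eta> :: "real \<Rightarrow> complex" assume \<eta>: "\<eta> \<in> test_functions ?I"
  have c\<eta>: "continuous_on UNIV \<eta>" "continuous_on UNIV (dir_deriv 1 \<eta>)"
    by (rule test_functions_continuous[OF \<eta>] test_functions_continuous[OF test_functions_deriv[OF \<eta>]])+
  have m\<eta>: "\<eta> \<in> borel_measurable ?MI" "dir_deriv 1 \<eta> \<in> borel_measurable ?MI"
    by (rule borel_measurable_lebesgue_on_continuous[OF c\<eta>(1)] borel_measurable_lebesgue_on_continuous[OF c\<eta>(2)])+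
  obtain B where B: "B > 0" "\<And>x. cmod (\<eta> x) \<le> B" by (rule test_functions_bounded[OF \<eta>]) blast
  have int: "integrable ?MI (\<lambda>t. \<eta> t * f t)" if "f \<in> borel_measurable ?MI" "AE t in ?MI. cmod (f t) \<le> K" for f K
  proof (rule bounded_integrable_Ioo)
    show "(\<lambda>t. \<eta> t * f t) \<in> borel_measurable ?MI" by (rule borel_measurable_times[OF m\<eta>(1) that(1)])
    show "AE t in ?MI. cmod (\<eta> t * f t) \<le> B * K"
      using that(2)
    proof eventually_elim
      case (elim t)
      show ?case unfolding norm_mult by (rule mult_mono[OF B(2) elim]) (use B(1) in simp_all)
    qed
  qed
  note iQ = int[OF mQ bQ] and iN = int[OF mN bN]
  have iA: "(\<lambda>t. \<eta> t * A t) = (\<lambda>t. - \<i> * (\<eta> t * Q t) - \<eta> t * N t)" by (auto simp: A algebra_simps)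
  show "integrable ?MI (\<lambda>t. \<eta> t * A t)" unfolding iA
    by (intro Bochner_Integration.integrable_diff integrable_mult_right iQ iN)
  have LA: "(LINT t|?MI. \<eta> t * A t) = - \<i> * (LINT t|?MI. \<eta> t * Q t) - (LINT t|?MI. \<eta> t * N t)"
    unfolding iA using iQ iN by (simp add: Bochner_Integration.integral_diff)
  define \<Psi> where "\<Psi> z = \<eta> (fst z) * \<xi> (snd z)" for z
  have \<Psi>: "\<Psi> \<in> test_functions (?I \<times> \<Omega>)" unfolding \<Psi>_def by (rule tensor_test_function[OF \<eta> \<xi>])
  have d1: "dir_deriv (1, 0) \<Psi> = (\<lambda>z. dir_deriv 1 \<eta> (fst z) * \<xi> (snd z))"
    unfolding \<Psi>_def by (rule dir_deriv_tensor(1)[OF \<eta> \<xi>])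
  have d2: "dir_deriv (0, 1) (dir_deriv (0, 1) \<Psi>) = (\<lambda>z. \<eta> (fst z) * dir_deriv 1 \<xi>' (snd z))"
    unfolding \<Psi>_def dir_deriv_tensor(2)[OF \<eta> \<xi>] \<xi>'_def[symmetric] by (rule dir_deriv_tensor(2)[OF \<eta> \<xi>'])
  have out: "(LINT x|?M. f x * (c * g x)) = c * (LINT x|?M. f x * g x)" for f g :: "real \<Rightarrow> complex" and c
    by (simp add: mult.left_commute)
  have p1: "pairing ?I \<Omega> u (dir_deriv (1, 0) \<Psi>) = (LINT t|?MI. dir_deriv 1 \<eta> t * P t)"
    unfolding pairing_def d1 P_def by (simp add: out)
  have p2: "pairing ?I \<Omega> u (dir_deriv (0, 1) (dir_deriv (0, 1) \<Psi>)) = (LINT t|?MI. \<eta> t * Q2 t)"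
    unfolding pairing_def d2 Q2_def by (simp add: out)
  have p3: "pairing ?I \<Omega> (\<lambda>t x. complex_of_real (cmod (u t x) powr (2 * \<sigma>)) * weak_deriv \<Omega> (u t) x) \<Psi> = (LINT t|?MI. \<eta> t * N t)"
    unfolding pairing_def \<Psi>_def N_def by (simp add: out)
  have Q2Q: "(LINT t|?MI. \<eta> t * Q2 t) = - (LINT t|?MI. \<eta> t * Q t)"
  proof -
    have "(LINT t|?MI. \<eta> t * Q2 t) = (LINT t|?MI. - (\<eta> t * Q t))"
      by (rule integral_cong_AE[OF borel_measurable_times[OF m\<eta>(1) mQ2] borel_measurable_uminus[OF borel_measurable_times[OF m\<eta>(1) mQ]]])
         (use QQ2 in \<open>auto elim: eventually_mono\<close>)
    then show ?thesis by simp
  qed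
  have mW: "(\<lambda>t. w t \<xi>) \<in> borel_measurable ?MI"
    by (rule continuous_imp_measurable_on_sets_lebesgue[OF contW Is])
  have PWi: "(LINT t|?MI. dir_deriv 1 \<eta> t * P t) = (LINT t|?MI. dir_deriv 1 \<eta> t * w t \<xi>)"
    by (rule integral_cong_AE[OF borel_measurable_times[OF m\<eta>(2) mP] borel_measurable_times[OF m\<eta>(2) mW]])
       (use PW in \<open>auto elim: eventually_mono\<close>)
  have "\<i> * (- (LINT t|?MI. dir_deriv 1 \<eta> t * w t \<xi>)) + - (LINT t|?MI. \<eta> t * Q t) + \<i> * (LINT t|?MI. \<eta> t * N t) = 0"
    using sol \<Psi> unfolding dnls_solution_def dnls_distributional_def p1[symmetric] p3[symmetric] Q2Q[symmetric] p2[symmetric] PWi[symmetric]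
    by blast
  then have "\<i> * (LINT t|?MI. dir_deriv 1 \<eta> t * w t \<xi>) = - (LINT t|?MI. \<eta> t * Q t) + \<i> * (LINT t|?MI. \<eta> t * N t)"
    by (simp add: algebra_simps add_eq_0_iff)
  then have "- \<i> * (\<i> * (LINT t|?MI. dir_deriv 1 \<eta> t * w t \<xi>)) = - \<i> * (- (LINT t|?MI. \<eta> t * Q t) + \<i> * (LINT t|?MI. \<eta> t * N t))"
    by (rule arg_cong)
  then show "(LINT t|?MI. dir_deriv 1 \<eta> t * w t \<xi>) = - (LINT t|?MI. \<eta> t * A t)"
    unfolding LA by (simp add: algebra_simps)
qed

section \<open>Trajectories\<close>

text \<open>The two parts of the \<open>H\<^sup>3\<^sup>/\<^sup>2\<close> norm are bounded separately; the seminorm is kept as an extended real,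
whose bound contains its finiteness.\<close>

definition H32_ball :: "real set \<Rightarrow> real \<Rightarrow> (real \<Rightarrow> complex) \<Rightarrow> bool"
  where "H32_ball \<Omega> M f \<longleftrightarrow> f \<in> H1_0 \<Omega> \<and> H1_norm \<Omega> f \<le> M \<and> gagliardo \<Omega> (weak_deriv \<Omega> f) \<le> ennreal (M\<^sup>2)"

lemma H32_ballI:
  assumes f: "f \<in> H32 \<Omega> \<inter> H1_0 \<Omega>" "H32_norm \<Omega> f \<le> C" and C: "C \<le> M"
  shows "H32_ball \<Omega> M f"
proof -
  let ?g = "gagliardo \<Omega> (weak_deriv \<Omega> f)"
  have "H1_norm \<Omega> f \<le> M" using H1_norm_le_H32_norm[of \<Omega> f] f(2) C by linarith
  moreover have "?g \<le> ennreal (M\<^sup>2)"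
  proof -
    have fin: "?g = ennreal (enn2real ?g)" using f(1) by (simp add: H32_def)
    have "enn2real ?g \<le> (H32_norm \<Omega> f)\<^sup>2" by (simp add: H32_norm_def)
    also have "\<dots> \<le> M\<^sup>2" using f(2) C by (intro power_mono) (auto simp: H32_norm_def)
    finally show ?thesis by (subst fin) (rule ennreal_leI)
  qed
  ultimately show ?thesis using f(1) by (simp add: H32_ball_def)
qed

lemma H32_ballD:
  assumes "H32_ball \<Omega> M f" "open \<Omega>"
  shows "H1_0_grad \<Omega> f (weak_deriv \<Omega> f)" "H1_norm \<Omega> f \<le> M" "gagliardo \<Omega> (weak_deriv \<Omega> f) \<le> ennreal (M\<^sup>2)"
    "f \<in> L2 \<Omega>" "weak_deriv \<Omega> f \<in> L2 \<Omega>" "L2_norm \<Omega> f \<le> M" "L2_norm \<Omega> (weak_deriv \<Omega> f) \<le> M"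
    "AE x in lebesgue_on \<Omega>. cmod (f x) \<le> M" "0 \<le> M"
proof -
  show g: "H1_0_grad \<Omega> f (weak_deriv \<Omega> f)" and M: "H1_norm \<Omega> f \<le> M" "gagliardo \<Omega> (weak_deriv \<Omega> f) \<le> ennreal (M\<^sup>2)"
    using assms H1_0_imp_grad by (auto simp: H32_ball_def)
  show "f \<in> L2 \<Omega>" "weak_deriv \<Omega> f \<in> L2 \<Omega>" using H1_0_grad_L2[OF g] by auto
  show n: "L2_norm \<Omega> f \<le> M" "L2_norm \<Omega> (weak_deriv \<Omega> f) \<le> M"
    using L2_norm_le_H1_norm[OF g assms(2)] M by linarith+
  show "AE x in lebesgue_on \<Omega>. cmod (f x) \<le> M"
    using H1_0_AE_bound[OF g assms(2)] by eventually_elim (use M in linarith)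
  show "0 \<le> M" using n(1) L2_norm_nonneg[of \<Omega> f] by linarith
qed

abbreviation dnls_op :: "real set \<Rightarrow> real \<Rightarrow> (real \<Rightarrow> complex) \<Rightarrow> (real \<Rightarrow> complex) \<Rightarrow> (real \<Rightarrow> complex) \<Rightarrow> complex"
  where "dnls_op \<Omega> \<sigma> f \<equiv> dnls_form \<Omega> \<sigma> f (weak_deriv \<Omega> f)"

text \<open>The information about a solution that enters the energy estimate. The set \<open>G\<close> collects the times at
which the representative \<open>U t\<close> has all desired properties; the function \<open>A\<close> is only required to agree
almost everywhere with the form, because \<open>U\<close> may be modified at one time.\<close>

definition trajectory :: "real set \<Rightarrow> real \<Rightarrow> real set \<Rightarrow> real set \<Rightarrow> real \<Rightarrow> (real \<Rightarrow> real \<Rightarrow> complex) \<Rightarrow> bool"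
  where "trajectory \<Omega> \<sigma> I G M U \<longleftrightarrow> G \<subseteq> I \<and> (AE t in lebesgue_on I. t \<in> G) \<and> (\<forall>t\<in>G. H32_ball \<Omega> M (U t)) \<and>
    (\<forall>\<xi>\<in>test_functions \<Omega>. \<exists>W A. continuous_on I W \<and>
      (\<forall>t\<in>G. W t = (LINT x|lebesgue_on \<Omega>. U t x * \<xi> x)) \<and>
      (AE t in lebesgue_on I. A t = dnls_op \<Omega> \<sigma> (U t) \<xi> (dir_deriv 1 \<xi>)) \<and>
      (\<forall>\<eta>\<in>test_functions I. integrable (lebesgue_on I) (\<lambda>t. \<eta> t * A t) \<and>
        (LINT t|lebesgue_on I. dir_deriv 1 \<eta> t * W t) = - (LINT t|lebesgue_on I. \<eta> t * A t)))"

lemma AE_lebesgue_on_neq: "AE t in lebesgue_on I. t \<noteq> (c::real)" if "I \<in> sets lebesgue"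
proof -
  have "AE t in lebesgue. t \<noteq> c" by (rule AE_completion[OF AE_lborel_singleton])
  then show ?thesis using that by (auto simp: AE_restrict_space_iff elim: eventually_mono)
qed

text \<open>Redefining \<open>u\<close> at time \<open>0\<close> as the initial value puts \<open>0\<close> into \<open>G\<close>, so that the energy vanishes at a time
of \<open>G\<close>. The set may be shrunk and the bound increased, which allows two solutions to share both.\<close>

lemma solution_trajectory:
  assumes \<sigma>: "1 / 2 \<le> \<sigma>" and \<Omega>: "open \<Omega>" and T: "T > 0" and \<phi>: "\<phi> \<in> H32 \<Omega> \<inter> H1_0 \<Omega>"
    and sol: "dnls_solution T \<Omega> \<sigma> u" and init: "initial_data {-T<..<T} \<Omega> u \<phi>"
  obtains G M where "0 \<in> G" "\<And>G' M'. G' \<subseteq> G \<Longrightarrow> (AE t in lebesgue_on {-T<..<T}. t \<in> G') \<Longrightarrow> M \<le> M' \<Longrightarrow> trajectory \<Omega> \<sigma> {-T<..<T} G' M' (u(0 := \<phi>))"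
    "AE t in lebesgue_on {-T<..<T}. t \<in> G"
proof -
  let ?I = "{-T<..<T}"
  obtain C where C: "AE t in lebesgue_on ?I. u t \<in> H32 \<Omega> \<inter> H1_0 \<Omega> \<and> H32_norm \<Omega> (u t) \<le> C"
    using sol unfolding dnls_solution_def Linfty_def by blast
  obtain w where w: "\<And>t. t \<in> ?I \<Longrightarrow> w t \<in> Hminus1 \<Omega>"
    "\<And>t. t \<in> ?I \<Longrightarrow> ((\<lambda>s. Hminus1_norm \<Omega> (\<lambda>g. w s g - w t g)) \<longlongrightarrow> 0) (at t within ?I)"
    "AE t in lebesgue_on ?I. \<forall>g\<in>H1_0 \<Omega>. w t g = L2_functional \<Omega> (u t) g"
    "\<And>g. g \<in> H1_0 \<Omega> \<Longrightarrow> w 0 g = L2_functional \<Omega> \<phi> g"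
    using init unfolding initial_data_def by blast
  define U where "U = u(0 := \<phi>)"
  define M where "M = max C (H32_norm \<Omega> \<phi>)"
  define G where "G = {t \<in> ?I. H32_ball \<Omega> M (U t) \<and> (\<forall>g\<in>H1_0 \<Omega>. w t g = L2_functional \<Omega> (U t) g)}"
  have aeU: "AE t in lebesgue_on ?I. U t = u t"
  proof -
    have "AE t in lebesgue_on ?I. t \<noteq> 0" by (rule AE_lebesgue_on_neq) simp
    then show ?thesis by eventually_elim (simp add: U_def)
  qed
  have aeI: "AE t in lebesgue_on ?I. t \<in> ?I" by (rule AE_I2) simp
  have aeG: "AE t in lebesgue_on ?I. t \<in> G"
    using aeU aeI C w(3)
  proof eventually_elim
    case (elim t)
    have "H32_ball \<Omega> M (u t)" by (rule H32_ballI[of _ _ C]) (use elim in \<open>auto simp: M_def\<close>)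
    with elim show ?case by (simp add: G_def)
  qed
  have "H32_ball \<Omega> M \<phi>" by (rule H32_ballI[OF \<phi> order_refl]) (simp add: M_def)
  then have G0: "0 \<in> G" using T w(4) by (simp add: G_def U_def)
  have C1: "AE t in lebesgue_on ?I. u t \<in> H1_0 \<Omega> \<and> H1_norm \<Omega> (u t) \<le> C"
    using C by eventually_elim (use H1_norm_le_H32_norm order_trans in blast)
  show thesis
  proof (rule that[OF G0 _ aeG])
    fix G' M' assume G': "G' \<subseteq> G" "AE t in lebesgue_on ?I. t \<in> G'" and M': "M \<le> M'"
    show "trajectory \<Omega> \<sigma> ?I G' M' (u(0 := \<phi>))"
      unfolding trajectory_def U_def[symmetric]
    proof (intro conjI ballI)
      show "G' \<subseteq> ?I" using G'(1) by (auto simp: G_def)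
      show "AE t in lebesgue_on ?I. t \<in> G'" by (rule G')
      fix t assume "t \<in> G'"
      then have b: "H32_ball \<Omega> M (U t)" using G'(1) by (auto simp: G_def)
      have "0 \<le> M" by (rule H32_ballD(9)[OF b \<Omega>])
      then have le: "ennreal (M\<^sup>2) \<le> ennreal (M'\<^sup>2)" using M' by (intro ennreal_leI power_mono)
      show "H32_ball \<Omega> M' (U t)"
        unfolding H32_ball_def using b[unfolded H32_ball_def] M' order_trans[OF _ le] by simp
    next
      fix \<xi> assume \<xi>: "\<xi> \<in> test_functions \<Omega>"
      note e = solution_test_equation[OF \<sigma> \<Omega> T sol C1 w(1-3) \<xi>]
      have \<xi>H: "\<xi> \<in> H1_0 \<Omega>" by (rule H1_0_gradI[OF H1_0_grad_test[OF \<xi> \<Omega>] \<Omega>])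
      have W: "\<forall>t\<in>G'. w t \<xi> = (LINT x|lebesgue_on \<Omega>. U t x * \<xi> x)"
        using G'(1) \<xi>H by (auto simp: G_def L2_functional_def)
      have A: "AE t in lebesgue_on ?I. dnls_op \<Omega> \<sigma> (u t) \<xi> (dir_deriv 1 \<xi>) = dnls_op \<Omega> \<sigma> (U t) \<xi> (dir_deriv 1 \<xi>)"
        using aeU by eventually_elim simp
      show "\<exists>W A. continuous_on ?I W \<and> (\<forall>t\<in>G'. W t = (LINT x|lebesgue_on \<Omega>. U t x * \<xi> x)) \<and>
        (AE t in lebesgue_on ?I. A t = dnls_op \<Omega> \<sigma> (U t) \<xi> (dir_deriv 1 \<xi>)) \<and>
        (\<forall>\<eta>\<in>test_functions ?I. integrable (lebesgue_on ?I) (\<lambda>t. \<eta> t * A t) \<and>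
          (LINT t|lebesgue_on ?I. dir_deriv 1 \<eta> t * W t) = - (LINT t|lebesgue_on ?I. \<eta> t * A t))"
      proof (rule exI[of _ "\<lambda>t. w t \<xi>"], rule exI[of _ "\<lambda>t. dnls_op \<Omega> \<sigma> (u t) \<xi> (dir_deriv 1 \<xi>)"], intro conjI)
        show "\<forall>\<eta>\<in>test_functions ?I. integrable (lebesgue_on ?I) (\<lambda>t. \<eta> t * dnls_op \<Omega> \<sigma> (u t) \<xi> (dir_deriv 1 \<xi>)) \<and>
          (LINT t|lebesgue_on ?I. dir_deriv 1 \<eta> t * w t \<xi>) = - (LINT t|lebesgue_on ?I. \<eta> t * dnls_op \<Omega> \<sigma> (u t) \<xi> (dir_deriv 1 \<xi>))"
          using e(2,3) by simp
      qed (use e(1) W A in blast)+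
    qed
  qed
qed

lemma continuous_times_test_integrable:
  assumes \<eta>: "\<eta> \<in> test_functions I" and I: "open (I :: real set)" and W: "continuous_on I W"
  shows "integrable (lebesgue_on I) (\<lambda>t. \<eta> t * W t)"
proof -
  obtain K where K: "\<And>k. C_k k \<eta>" "compact K" "K \<subseteq> I" "\<And>z. z \<notin> K \<Longrightarrow> \<eta> z = 0"
    using \<eta> by (rule test_functionsE) blast
  have c: "continuous_on K (\<lambda>t. \<eta> t * W t)"
    by (intro continuous_on_mult test_functions_continuous[OF \<eta>] continuous_on_subset[OF W K(3)])
  have i: "integrable lborel (\<lambda>t. indicator K t *\<^sub>R (\<eta> t * W t))"
    by (rule borel_integrable_compact[OF K(2) c])
  have "(\<lambda>t. indicator K t *\<^sub>R (\<eta> t * W t)) = (\<lambda>t. indicator I t *\<^sub>R (\<eta> t * W t))"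
    using K(3,4) by (auto simp: indicator_def fun_eq_iff)
  with i have "integrable lebesgue (\<lambda>t. indicator I t *\<^sub>R (\<eta> t * W t))"
    using integrable_completion[OF borel_measurable_integrable[OF i]] by simp
  then show ?thesis using I by (simp add: integrable_restrict_space)
qed

text \<open>The factor \<open>c\<close> covers a single solution (\<open>c = 0\<close>) and the difference of two (\<open>c = 1\<close>).\<close>

lemma trajectory_increment_test:
  assumes I: "open I" "is_interval I" and U: "trajectory \<Omega> \<sigma> I G M U" and V: "trajectory \<Omega> \<sigma> I G M V"
    and \<xi>: "\<xi> \<in> test_functions \<Omega>" and st: "s \<in> G" "t \<in> G" "s < t" and S: "0 \<le> S"
    "\<And>\<tau>. \<tau> \<in> G \<Longrightarrow> \<bar>Re (dnls_op \<Omega> \<sigma> (U \<tau>) \<xi> (dir_deriv 1 \<xi>) - c * dnls_op \<Omega> \<sigma> (V \<tau>) \<xi> (dir_deriv 1 \<xi>))\<bar> \<le> S \<or> \<tau> \<notin> {s..t}"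
  shows "\<bar>Re (((LINT x|lebesgue_on \<Omega>. U t x * \<xi> x) - c * (LINT x|lebesgue_on \<Omega>. V t x * \<xi> x))
     - ((LINT x|lebesgue_on \<Omega>. U s x * \<xi> x) - c * (LINT x|lebesgue_on \<Omega>. V s x * \<xi> x)))\<bar> \<le> S * (t - s)"
proof -
  obtain W A where W: "continuous_on I W" "\<forall>t\<in>G. W t = (LINT x|lebesgue_on \<Omega>. U t x * \<xi> x)"
    "AE t in lebesgue_on I. A t = dnls_op \<Omega> \<sigma> (U t) \<xi> (dir_deriv 1 \<xi>)"
    and WA: "\<And>\<eta>. \<eta> \<in> test_functions I \<Longrightarrow> integrable (lebesgue_on I) (\<lambda>t. \<eta> t * A t)"
      "\<And>\<eta>. \<eta> \<in> test_functions I \<Longrightarrow> (LINT t|lebesgue_on I. dir_deriv 1 \<eta> t * W t) = - (LINT t|lebesgue_on I. \<eta> t * A t)"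
    using U \<xi> unfolding trajectory_def by meson
  obtain W' A' where W': "continuous_on I W'" "\<forall>t\<in>G. W' t = (LINT x|lebesgue_on \<Omega>. V t x * \<xi> x)"
    "AE t in lebesgue_on I. A' t = dnls_op \<Omega> \<sigma> (V t) \<xi> (dir_deriv 1 \<xi>)"
    and WA': "\<And>\<eta>. \<eta> \<in> test_functions I \<Longrightarrow> integrable (lebesgue_on I) (\<lambda>t. \<eta> t * A' t)"
      "\<And>\<eta>. \<eta> \<in> test_functions I \<Longrightarrow> (LINT t|lebesgue_on I. dir_deriv 1 \<eta> t * W' t) = - (LINT t|lebesgue_on I. \<eta> t * A' t)"
    using V \<xi> unfolding trajectory_def by meson
  have G: "G \<subseteq> I" "AE t in lebesgue_on I. t \<in> G" using U by (auto simp: trajectory_def)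
  have iA: "integrable (lebesgue_on I) (\<lambda>\<tau>. \<eta> \<tau> * (A \<tau> - c * A' \<tau>))" and LA: "(LINT \<tau>|lebesgue_on I. \<eta> \<tau> * (A \<tau> - c * A' \<tau>))
      = (LINT \<tau>|lebesgue_on I. \<eta> \<tau> * A \<tau>) - c * (LINT \<tau>|lebesgue_on I. \<eta> \<tau> * A' \<tau>)" if \<eta>: "\<eta> \<in> test_functions I" for \<eta>
  proof -
    have eq: "(\<lambda>\<tau>. \<eta> \<tau> * (A \<tau> - c * A' \<tau>)) = (\<lambda>\<tau>. \<eta> \<tau> * A \<tau> - c * (\<eta> \<tau> * A' \<tau>))" by (auto simp: algebra_simps)
    show "integrable (lebesgue_on I) (\<lambda>\<tau>. \<eta> \<tau> * (A \<tau> - c * A' \<tau>))"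
      unfolding eq by (intro Bochner_Integration.integrable_diff integrable_mult_right WA(1) WA'(1) \<eta>)
    show "(LINT \<tau>|lebesgue_on I. \<eta> \<tau> * (A \<tau> - c * A' \<tau>)) = (LINT \<tau>|lebesgue_on I. \<eta> \<tau> * A \<tau>) - c * (LINT \<tau>|lebesgue_on I. \<eta> \<tau> * A' \<tau>)"
      unfolding eq using WA(1)[OF \<eta>] WA'(1)[OF \<eta>] by (simp add: Bochner_Integration.integral_diff)
  qed
  have "\<bar>Re ((W t - c * W' t) - (W s - c * W' s))\<bar> \<le> S * (t - s)"
  proof (rule weak_time_derivative_bound[where A = "\<lambda>\<tau>. A \<tau> - c * A' \<tau>", OF I(1) st(3)])
    have stI: "s \<in> I" "t \<in> I" using st G(1) by auto
    show "{s..t} \<subseteq> I"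
    proof
      fix x assume "x \<in> {s..t}"
      then show "x \<in> I" using mem_is_interval_1_I[OF I(2) stI, of x] by simp
    qed
    show "continuous_on I (\<lambda>t. W t - c * W' t)" by (intro continuous_intros W W')
    show "AE \<tau> in lebesgue_on I. s < \<tau> \<longrightarrow> \<tau> < t \<longrightarrow> \<bar>Re (A \<tau> - c * A' \<tau>)\<bar> \<le> S"
      using W(3) W'(3) G(2)
    proof eventually_elim
      case (elim \<tau>)
      then show ?case using S(2)[of \<tau>] by auto
    qed
    fix \<eta> :: "real \<Rightarrow> complex" assume \<eta>: "\<eta> \<in> test_functions I"
    show "integrable (lebesgue_on I) (\<lambda>\<tau>. \<eta> \<tau> * (A \<tau> - c * A' \<tau>))" by (rule iA[OF \<eta>])
    have eq: "(\<lambda>\<tau>. dir_deriv 1 \<eta> \<tau> * (W \<tau> - c * W' \<tau>)) = (\<lambda>\<tau>. dir_deriv 1 \<eta> \<tau> * W \<tau> - c * (dir_deriv 1 \<eta> \<tau> * W' \<tau>))" by (auto simp: algebra_simps)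
    have "(LINT \<tau>|lebesgue_on I. dir_deriv 1 \<eta> \<tau> * (W \<tau> - c * W' \<tau>)) = (LINT \<tau>|lebesgue_on I. dir_deriv 1 \<eta> \<tau> * W \<tau>) - c * (LINT \<tau>|lebesgue_on I. dir_deriv 1 \<eta> \<tau> * W' \<tau>)"
      unfolding eq
      using continuous_times_test_integrable[OF test_functions_deriv[OF \<eta>] I(1) W(1)] continuous_times_test_integrable[OF test_functions_deriv[OF \<eta>] I(1) W'(1)]
      by (simp add: Bochner_Integration.integral_diff)
    then show "(LINT \<tau>|lebesgue_on I. dir_deriv 1 \<eta> \<tau> * (W \<tau> - c * W' \<tau>)) = - (LINT \<tau>|lebesgue_on I. \<eta> \<tau> * (A \<tau> - c * A' \<tau>))"
      unfolding LA[OF \<eta>] WA(2)[OF \<eta>] WA'(2)[OF \<eta>] by simp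
  qed (rule S(1))
  then show ?thesis using W(2) W'(2) st by simp
qed

definition form_const :: "real \<Rightarrow> real \<Rightarrow> real" where "form_const \<sigma> M = (1 + M powr (2 * \<sigma>)) * M"

lemma dnls_op_bound:
  assumes "1 / 2 \<le> \<sigma>" "open \<Omega>" "H32_ball \<Omega> M f" "\<psi> \<in> L2 \<Omega>" "\<psi>' \<in> L2 \<Omega>"
  shows "cmod (dnls_op \<Omega> \<sigma> f \<psi> \<psi>') \<le> form_const \<sigma> M * (L2_norm \<Omega> \<psi> + L2_norm \<Omega> \<psi>')"
  unfolding form_const_def
  by (rule dnls_form_bound[OF assms(1) L2_meas[OF H32_ballD(4)[OF assms(3,2)]] H32_ballD(8)[OF assms(3,2)] H32_ballD(5,7)[OF assms(3,2)] assms(4,5)])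

lemma dnls_op_diff:
  assumes "1 / 2 \<le> \<sigma>" "open \<Omega>" "H32_ball \<Omega> M f" "\<psi> \<in> L2 \<Omega>" "\<psi>' \<in> L2 \<Omega>" "\<theta> \<in> L2 \<Omega>" "\<theta>' \<in> L2 \<Omega>"
  shows "dnls_op \<Omega> \<sigma> f (\<lambda>x. \<psi> x - \<theta> x) (\<lambda>x. \<psi>' x - \<theta>' x) = dnls_op \<Omega> \<sigma> f \<psi> \<psi>' - dnls_op \<Omega> \<sigma> f \<theta> \<theta>'"
  by (rule dnls_form_diff[OF assms(1) L2_meas[OF H32_ballD(4)[OF assms(3,2)]] H32_ballD(8)[OF assms(3,2)] H32_ballD(5)[OF assms(3,2)] assms(4-7)])

text \<open>Only the inequality is extended from test functions to \<open>H\<^sup>1\<^sub>0\<close>; since the bound for test functions near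
\<open>f\<close> differs little from \<open>S\<close>, uniformly in \<open>\<tau>\<close>, questions of measurability in time arise for test
functions only.\<close>

lemma trajectory_increment:
  assumes \<sigma>: "1 / 2 \<le> \<sigma>" and \<Omega>: "open \<Omega>" and I: "open I" "is_interval I"
    and U: "trajectory \<Omega> \<sigma> I G M U" and V: "trajectory \<Omega> \<sigma> I G M V"
    and f: "H1_0_grad \<Omega> f g" and st: "s \<in> G" "t \<in> G" and S: "0 \<le> S"
    "\<And>\<tau>. \<tau> \<in> G \<Longrightarrow> \<bar>\<tau> - s\<bar> \<le> \<bar>t - s\<bar> \<Longrightarrow> \<bar>Re (dnls_op \<Omega> \<sigma> (U \<tau>) f g - c * dnls_op \<Omega> \<sigma> (V \<tau>) f g)\<bar> \<le> S"
  shows "\<bar>Re (((LINT x|lebesgue_on \<Omega>. U t x * f x) - c * (LINT x|lebesgue_on \<Omega>. V t x * f x))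
     - ((LINT x|lebesgue_on \<Omega>. U s x * f x) - c * (LINT x|lebesgue_on \<Omega>. V s x * f x)))\<bar> \<le> S * \<bar>t - s\<bar>"
proof -
  define D where "D \<theta> = Re (((LINT x|lebesgue_on \<Omega>. U t x * \<theta> x) - c * (LINT x|lebesgue_on \<Omega>. V t x * \<theta> x))
     - ((LINT x|lebesgue_on \<Omega>. U s x * \<theta> x) - c * (LINT x|lebesgue_on \<Omega>. V s x * \<theta> x)))" for \<theta>
  obtain \<psi> where \<psi>: "\<And>n. \<psi> n \<in> test_functions \<Omega>" "L2_tendsto \<Omega> \<psi> f" "L2_tendsto \<Omega> (\<lambda>n. dir_deriv 1 (\<psi> n)) g"
    by (rule H1_0_gradE[OF f]) blast
  note L = L2_tendstoD[OF \<psi>(2)] L2_tendstoD[OF \<psi>(3)]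
  have bU: "H32_ball \<Omega> M (U \<tau>)" and bV: "H32_ball \<Omega> M (V \<tau>)" if "\<tau> \<in> G" for \<tau>
    using U V that by (auto simp: trajectory_def)
  have M: "0 \<le> M" by (rule H32_ballD(9)[OF bU[OF st(1)] \<Omega>])
  then have K: "0 \<le> form_const \<sigma> M" by (simp add: form_const_def)
  define e where "e n = L2_norm \<Omega> (\<lambda>x. \<psi> n x - f x) + L2_norm \<Omega> (\<lambda>x. dir_deriv 1 (\<psi> n) x - g x)" for n
  define B where "B n = S + (1 + cmod c) * (form_const \<sigma> M * e n)" for n
  have e0: "0 \<le> e n" for n by (simp add: e_def)
  have B0: "0 \<le> B n" for n using S(1) K e0 by (simp add: B_def)
  have elim: "e \<longlonglongrightarrow> 0" unfolding e_def using tendsto_add[OF L(3) L(6)] by simp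
  have Blim: "B \<longlonglongrightarrow> S" unfolding B_def
    using tendsto_add[OF tendsto_const tendsto_mult[OF tendsto_const tendsto_mult[OF tendsto_const elim]], of S "1 + cmod c" "form_const \<sigma> M"] by simp
  have le: "\<bar>Re (dnls_op \<Omega> \<sigma> (U \<tau>) (\<psi> n) (dir_deriv 1 (\<psi> n)) - c * dnls_op \<Omega> \<sigma> (V \<tau>) (\<psi> n) (dir_deriv 1 (\<psi> n)))\<bar> \<le> B n"
    if \<tau>: "\<tau> \<in> G" "\<bar>\<tau> - s\<bar> \<le> \<bar>t - s\<bar>" for n \<tau>
  proof -
    define a where "a = dnls_op \<Omega> \<sigma> (U \<tau>) (\<lambda>x. \<psi> n x - f x) (\<lambda>x. dir_deriv 1 (\<psi> n) x - g x)"
    define b where "b = dnls_op \<Omega> \<sigma> (V \<tau>) (\<lambda>x. \<psi> n x - f x) (\<lambda>x. dir_deriv 1 (\<psi> n) x - g x)"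
    have ab: "cmod a \<le> form_const \<sigma> M * e n" "cmod b \<le> form_const \<sigma> M * e n"
      unfolding a_def b_def e_def
      by (rule dnls_op_bound[OF \<sigma> \<Omega> bU[OF \<tau>(1)] L2_diff[OF L(1,2)] L2_diff[OF L(4,5)]]
        dnls_op_bound[OF \<sigma> \<Omega> bV[OF \<tau>(1)] L2_diff[OF L(1,2)] L2_diff[OF L(4,5)]])+
    have "dnls_op \<Omega> \<sigma> (U \<tau>) (\<psi> n) (dir_deriv 1 (\<psi> n)) - c * dnls_op \<Omega> \<sigma> (V \<tau>) (\<psi> n) (dir_deriv 1 (\<psi> n))
      = (dnls_op \<Omega> \<sigma> (U \<tau>) f g - c * dnls_op \<Omega> \<sigma> (V \<tau>) f g) + (a - c * b)"
      unfolding a_def b_def dnls_op_diff[OF \<sigma> \<Omega> bU[OF \<tau>(1)] L(1,4,2,5)] dnls_op_diff[OF \<sigma> \<Omega> bV[OF \<tau>(1)] L(1,4,2,5)]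
      by (simp add: algebra_simps)
    moreover have "\<bar>Re (a - c * b)\<bar> \<le> (1 + cmod c) * (form_const \<sigma> M * e n)"
    proof -
      have "\<bar>Re (a - c * b)\<bar> \<le> cmod a + cmod c * cmod b"
        using abs_Re_le_cmod[of "a - c * b"] norm_triangle_ineq4[of a "c * b"] unfolding norm_mult by linarith
      also have "\<dots> \<le> form_const \<sigma> M * e n + cmod c * (form_const \<sigma> M * e n)"
        by (intro add_mono mult_left_mono ab) simp
      finally show ?thesis by (simp add: algebra_simps)
    qed
    ultimately show ?thesis using S(2)[OF \<tau>] unfolding B_def by simp
  qed
  have test: "\<bar>D (\<psi> n)\<bar> \<le> B n * \<bar>t - s\<bar>" for n
  proof -
    consider "s < t" | "t < s" | "s = t" by linarith
    then show ?thesis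
    proof cases
      case 1
      have "\<bar>D (\<psi> n)\<bar> \<le> B n * (t - s)" unfolding D_def
        by (rule trajectory_increment_test[OF I U V \<psi>(1) st 1 B0]) (use le 1 in fastforce)
      then show ?thesis using 1 by simp
    next
      case 2
      have "\<bar>Re (((LINT x|lebesgue_on \<Omega>. U s x * \<psi> n x) - c * (LINT x|lebesgue_on \<Omega>. V s x * \<psi> n x))
         - ((LINT x|lebesgue_on \<Omega>. U t x * \<psi> n x) - c * (LINT x|lebesgue_on \<Omega>. V t x * \<psi> n x)))\<bar> \<le> B n * (s - t)"
        by (rule trajectory_increment_test[OF I U V \<psi>(1) st(2,1) 2 B0]) (use le 2 in fastforce)
      then show ?thesis using 2 unfolding D_def by (simp add: abs_minus_commute)
    qed (simp add: D_def)
  qed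
  have lim: "(\<lambda>n. LINT x|lebesgue_on \<Omega>. h x * \<psi> n x) \<longlonglongrightarrow> (LINT x|lebesgue_on \<Omega>. h x * f x)" if "h \<in> L2 \<Omega>" for h
    by (rule L2_tendsto_integral_mult[OF L2_tendsto_const[OF that] \<psi>(2)])
  have "(\<lambda>n. \<bar>D (\<psi> n)\<bar>) \<longlonglongrightarrow> \<bar>D f\<bar>"
    unfolding D_def using H32_ballD(4)[OF bU \<Omega>] H32_ballD(4)[OF bV \<Omega>] st
    by (intro tendsto_rabs tendsto_Re tendsto_diff tendsto_mult tendsto_const lim) auto
  moreover have "(\<lambda>n. B n * \<bar>t - s\<bar>) \<longlonglongrightarrow> S * \<bar>t - s\<bar>" by (rule tendsto_mult[OF Blim tendsto_const])
  ultimately show ?thesis unfolding D_def[symmetric]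
    by (rule LIMSEQ_le) (use test in blast)
qed

section \<open>Continuity in \<open>H\<^sup>1\<close> and increments of the energy\<close>

lemma L2_norm_power2_eq:
  assumes "f \<in> L2 \<Omega>"
  shows "(LINT x|lebesgue_on \<Omega>. f x * cnj (f x)) = complex_of_real ((L2_norm \<Omega> f)\<^sup>2)"
proof -
  have "(LINT x|lebesgue_on \<Omega>. f x * cnj (f x)) = (LINT x|lebesgue_on \<Omega>. complex_of_real ((cmod (f x))\<^sup>2))"
    by (simp only: complex_norm_square)
  then show ?thesis by (simp only: integral_complex_of_real L2_norm_power2)
qed

text \<open>With \<open>\<delta> = U t - U s\<close>, the increment tested with \<open>cnj \<delta>\<close> gives \<open>\<parallel>\<delta>\<parallel>\<^sup>2 \<le> C \<bar>t - s\<bar>\<close>. Interpolation bounds the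
squared norm of the derivative of \<open>\<delta>\<close> by \<open>6 h M\<^sup>2 + (18 / h\<^sup>2) \<parallel>\<delta>\<parallel>\<^sup>2\<close>: first choose \<open>h\<close> small, then \<open>\<bar>t - s\<bar>\<close>.\<close>

lemma trajectory_H1_continuous:
  assumes \<sigma>: "1 / 2 \<le> \<sigma>" and \<Omega>: "open \<Omega>" and I: "open I" "is_interval I" and U: "trajectory \<Omega> \<sigma> I G M U"
    and h0: "h0 > 0" "\<And>h x. 0 < h \<Longrightarrow> h \<le> h0 \<Longrightarrow> x \<in> \<Omega> \<Longrightarrow> {x..x+h} \<subseteq> \<Omega> \<or> {x-h..x} \<subseteq> \<Omega>"
    and \<kappa>: "\<kappa> > 0"
  shows "\<exists>d>0. \<forall>s\<in>G. \<forall>t\<in>G. \<bar>t - s\<bar> < d \<longrightarrow>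
    L2_norm \<Omega> (\<lambda>x. U t x - U s x) + L2_norm \<Omega> (\<lambda>x. weak_deriv \<Omega> (U t) x - weak_deriv \<Omega> (U s) x) \<le> \<kappa>"
proof -
  have b: "H32_ball \<Omega> M (U t)" if "t \<in> G" for t using U that by (auto simp: trajectory_def)
  show ?thesis
  proof (cases "G = {}")
    case True then show ?thesis by (auto intro: zero_less_one)
  next
    case False
    then obtain t0 where "t0 \<in> G" by blast
    then have M: "0 \<le> M" using H32_ballD(9)[OF b \<Omega>] by blast
    define K where "K = form_const \<sigma> M"
    have K: "0 \<le> K" using M by (simp add: K_def form_const_def)
    \<comment> \<open>Makes the contribution of the seminorm at most \<open>\<kappa>\<^sup>2 / 8\<close>.\<close>
    define h where "h = min h0 (\<kappa>\<^sup>2 / (48 * (M\<^sup>2 + 1)))"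
    have h: "0 < h" "h \<le> h0" "h \<le> \<kappa>\<^sup>2 / (48 * (M\<^sup>2 + 1))"
      using h0(1) \<kappa> by (auto simp: h_def intro!: divide_pos_pos add_nonneg_pos)
    define c where "c = 1 + 18 / h\<^sup>2"
    have c: "c \<ge> 1" by (simp add: c_def)
    define d where "d = \<kappa>\<^sup>2 / (8 * c * (4 * K * M + 1))"
    have cK: "8 * c * (4 * K * M + 1) > 0" using c K M by (intro mult_pos_pos add_nonneg_pos) auto
    have d: "d > 0" unfolding d_def using \<kappa> cK by simp
    have hM: "6 * h * M\<^sup>2 \<le> \<kappa>\<^sup>2 / 8"
    proof -
      have "h * (48 * (M\<^sup>2 + 1)) \<le> \<kappa>\<^sup>2" using h(3) by (simp add: pos_le_divide_eq add_nonneg_pos)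
      moreover have "h * (48 * M\<^sup>2) \<le> h * (48 * (M\<^sup>2 + 1))" using h(1) by (intro mult_left_mono) auto
      ultimately show ?thesis by (simp add: algebra_simps)
    qed
    show ?thesis
    proof (intro exI[of _ d] conjI ballI impI)
      show "d > 0" by (rule d)
      fix s t assume st: "s \<in> G" "t \<in> G" "\<bar>t - s\<bar> < d"
      define \<delta> where "\<delta> x = U t x - U s x" for x
      define \<delta>' where "\<delta>' x = weak_deriv \<Omega> (U t) x - weak_deriv \<Omega> (U s) x" for x
      note bt = H32_ballD[OF b[OF st(2)] \<Omega>] and bs = H32_ballD[OF b[OF st(1)] \<Omega>]
      have \<delta>g: "H1_0_grad \<Omega> \<delta> \<delta>'" unfolding \<delta>_def \<delta>'_def by (rule H1_0_grad_diff[OF bt(1) bs(1)])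
      note L\<delta> = H1_0_grad_L2[OF \<delta>g]
      have n: "L2_norm \<Omega> \<delta> \<le> 2 * M" "L2_norm \<Omega> \<delta>' \<le> 2 * M"
        unfolding \<delta>_def \<delta>'_def
        using L2_norm_triangle_diff[OF bt(4) bs(4)] L2_norm_triangle_diff[OF bt(5) bs(5)] bt(6,7) bs(6,7) by linarith+
      have "\<bar>Re (((LINT x|lebesgue_on \<Omega>. U t x * cnj (\<delta> x)) - 0 * (LINT x|lebesgue_on \<Omega>. U t x * cnj (\<delta> x)))
        - ((LINT x|lebesgue_on \<Omega>. U s x * cnj (\<delta> x)) - 0 * (LINT x|lebesgue_on \<Omega>. U s x * cnj (\<delta> x))))\<bar> \<le> (K * (4 * M)) * \<bar>t - s\<bar>"
      proof (rule trajectory_increment[OF \<sigma> \<Omega> I U U H1_0_grad_cnj[OF \<delta>g] st(1,2)])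
        show "0 \<le> K * (4 * M)" using K M by simp
        fix \<tau> assume \<tau>: "\<tau> \<in> G"
        have "cmod (dnls_op \<Omega> \<sigma> (U \<tau>) (\<lambda>x. cnj (\<delta> x)) (\<lambda>x. cnj (\<delta>' x))) \<le> K * (L2_norm \<Omega> \<delta> + L2_norm \<Omega> \<delta>')"
          using dnls_op_bound[OF \<sigma> \<Omega> b[OF \<tau>] L2_cnj[OF L\<delta>(1)] L2_cnj[OF L\<delta>(2)]] by (simp add: K_def L2_norm_cnj)
        also have "\<dots> \<le> K * (4 * M)" using n K by (intro mult_left_mono) auto
        finally show "\<bar>Re (dnls_op \<Omega> \<sigma> (U \<tau>) (\<lambda>x. cnj (\<delta> x)) (\<lambda>x. cnj (\<delta>' x)) - 0 * dnls_op \<Omega> \<sigma> (U \<tau>) (\<lambda>x. cnj (\<delta> x)) (\<lambda>x. cnj (\<delta>' x)))\<bar> \<le> K * (4 * M)"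
          using order_trans[OF abs_Re_le_cmod] by simp
      qed
      moreover have "(LINT x|lebesgue_on \<Omega>. U t x * cnj (\<delta> x)) - (LINT x|lebesgue_on \<Omega>. U s x * cnj (\<delta> x)) = complex_of_real ((L2_norm \<Omega> \<delta>)\<^sup>2)"
        unfolding L2_norm_power2_eq[OF L\<delta>(1), symmetric]
        using L2_integrable_mult[OF bt(4) L2_cnj[OF L\<delta>(1)]] L2_integrable_mult[OF bs(4) L2_cnj[OF L\<delta>(1)]]
        by (simp add: \<delta>_def left_diff_distrib)
      ultimately have "\<bar>(L2_norm \<Omega> \<delta>)\<^sup>2\<bar> \<le> K * (4 * M) * \<bar>t - s\<bar>"
        by (simp only: mult_zero_left diff_0_right Re_complex_of_real)
      then have D: "(L2_norm \<Omega> \<delta>)\<^sup>2 \<le> 4 * K * M * \<bar>t - s\<bar>" by (simp add: mult_ac)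
      have ineq: "(L2_norm \<Omega> \<delta>')\<^sup>2 \<le> 6 * h * M\<^sup>2 + 18 / h\<^sup>2 * (L2_norm \<Omega> \<delta>)\<^sup>2"
      proof (rule gradient_interpolation[OF \<delta>g \<Omega> _ bt(5) bs(5) bt(3) bs(3) _ h(1) h0(2)[OF h(1,2)]])
        show "AE x in lebesgue_on \<Omega>. \<delta>' x = weak_deriv \<Omega> (U t) x - weak_deriv \<Omega> (U s) x" by (simp add: \<delta>'_def)
      qed simp_all
      have small: "c * (L2_norm \<Omega> \<delta>)\<^sup>2 \<le> \<kappa>\<^sup>2 / 8"
      proof -
        have "c * (L2_norm \<Omega> \<delta>)\<^sup>2 \<le> c * ((4 * K * M + 1) * \<bar>t - s\<bar>)"
          using D c by (intro mult_left_mono) (auto simp: algebra_simps)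
        also have "\<dots> \<le> c * ((4 * K * M + 1) * d)"
          using st(3) c K M by (intro mult_left_mono) auto
        also have "\<dots> = \<kappa>\<^sup>2 / 8" using cK unfolding d_def by (simp add: field_simps)
        finally show ?thesis .
      qed
      have e1: "(L2_norm \<Omega> \<delta>)\<^sup>2 \<le> \<kappa>\<^sup>2 / 8"
        using small mult_right_mono[OF c, of "(L2_norm \<Omega> \<delta>)\<^sup>2"] by simp
      have e2: "(L2_norm \<Omega> \<delta>')\<^sup>2 \<le> \<kappa>\<^sup>2 / 4"
      proof -
        have "18 / h\<^sup>2 * (L2_norm \<Omega> \<delta>)\<^sup>2 \<le> c * (L2_norm \<Omega> \<delta>)\<^sup>2" unfolding c_def by (intro mult_right_mono) auto
        with ineq hM small show ?thesis by linarith
      qed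
      have half: "(\<kappa> / 2)\<^sup>2 = \<kappa>\<^sup>2 / 4" by (simp add: power_divide)
      have "L2_norm \<Omega> \<delta> \<le> \<kappa> / 2"
        by (rule power2_le_imp_le) (use e1 \<kappa> zero_le_power2[of \<kappa>] half in linarith)+
      moreover have "L2_norm \<Omega> \<delta>' \<le> \<kappa> / 2"
        by (rule power2_le_imp_le) (use e2 \<kappa> half in linarith)+
      ultimately have "L2_norm \<Omega> \<delta> + L2_norm \<Omega> \<delta>' \<le> \<kappa>" by linarith
      then show "L2_norm \<Omega> (\<lambda>x. U t x - U s x) + L2_norm \<Omega> (\<lambda>x. weak_deriv \<Omega> (U t) x - weak_deriv \<Omega> (U s) x) \<le> \<kappa>"
        unfolding \<delta>_def \<delta>'_def .
    qed
  qed
qed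

text \<open>With \<open>\<delta> = z t - z s\<close> one has \<open>E t - E s = 2 Re \<integral> \<delta> cnj (z s) + \<parallel>\<delta>\<parallel>\<^sup>2\<close>. In the first term the form at
times \<open>\<tau>\<close> between \<open>s\<close> and \<open>t\<close> is tested with \<open>z s\<close>, which is close to \<open>z \<tau>\<close> in \<open>H\<^sup>1\<close>, so the energy bound at
time \<open>\<tau>\<close> applies. The second term is at most \<open>\<bar>t - s\<bar>\<close> times the \<open>H\<^sup>1\<close> norm of \<open>\<delta>\<close>, hence
\<open>o(\<bar>t - s\<bar>)\<close>: this is where continuity in \<open>H\<^sup>1\<close> is indispensable.\<close>

lemma energy_increment:
  assumes \<sigma>: "1 / 2 \<le> \<sigma>" and \<Omega>: "open \<Omega>" and I: "open I" "is_interval I"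
    and U: "trajectory \<Omega> \<sigma> I G M U" and V: "trajectory \<Omega> \<sigma> I G M V" and M: "0 \<le> M"
    and h0: "h0 > 0" "\<And>h x. 0 < h \<Longrightarrow> h \<le> h0 \<Longrightarrow> x \<in> \<Omega> \<Longrightarrow> {x..x+h} \<subseteq> \<Omega> \<or> {x-h..x} \<subseteq> \<Omega>"
    and \<eta>: "\<eta> > 0"
  defines "E \<equiv> \<lambda>t. (L2_norm \<Omega> (\<lambda>x. U t x - V t x))\<^sup>2"
  shows "\<exists>d>0. \<forall>s\<in>G. \<forall>t\<in>G. \<bar>t - s\<bar> < d \<longrightarrow>
    \<bar>E t - E s\<bar> \<le> \<bar>t - s\<bar> * (2 * growth_const \<sigma> h0 M n * E s + 2 * growth_err \<sigma> h0 M n + \<eta>)"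
proof -
  define K where "K = form_const \<sigma> M"
  have K: "0 \<le> K" using M by (simp add: K_def form_const_def)
  define \<Lambda> where "\<Lambda> = growth_const \<sigma> h0 M n"
  have \<Lambda>: "0 \<le> \<Lambda>" unfolding \<Lambda>_def growth_const_def
    using M h0(1) powr_lip_const_nonneg[OF \<sigma>] by (intro mult_nonneg_nonneg add_nonneg_nonneg) auto
  define \<epsilon> where "\<epsilon> = growth_err \<sigma> h0 M n"
  have \<epsilon>: "0 \<le> \<epsilon>" unfolding \<epsilon>_def growth_err_def
    using M h0(1) powr_lip_const_nonneg[OF \<sigma>] by (intro mult_nonneg_nonneg) auto
  \<comment> \<open>The denominator collects the errors that are proportional to the modulus of continuity \<open>\<kappa>\<close>.\<close>
  define \<kappa> where "\<kappa> = \<eta> / (16 * M * \<Lambda> + 12 * K + 1)"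
  have den: "16 * M * \<Lambda> + 12 * K + 1 > 0" using M \<Lambda> K by (intro add_nonneg_pos add_nonneg_nonneg) auto
  have \<kappa>: "\<kappa> > 0" unfolding \<kappa>_def using \<eta> den by simp
  have \<kappa>\<eta>: "(16 * M * \<Lambda> + 12 * K) * \<kappa> \<le> \<eta>"
  proof -
    have "(16 * M * \<Lambda> + 12 * K) * \<kappa> \<le> (16 * M * \<Lambda> + 12 * K + 1) * \<kappa>" using \<kappa> by simp
    also have "\<dots> = \<eta>" unfolding \<kappa>_def using den by simp
    finally show ?thesis .
  qed
  obtain d1 where d1: "d1 > 0" "\<And>s t. s \<in> G \<Longrightarrow> t \<in> G \<Longrightarrow> \<bar>t - s\<bar> < d1 \<Longrightarrow>
    L2_norm \<Omega> (\<lambda>x. U t x - U s x) + L2_norm \<Omega> (\<lambda>x. weak_deriv \<Omega> (U t) x - weak_deriv \<Omega> (U s) x) \<le> \<kappa>"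
    using trajectory_H1_continuous[OF \<sigma> \<Omega> I U h0 \<kappa>] by blast
  obtain d2 where d2: "d2 > 0" "\<And>s t. s \<in> G \<Longrightarrow> t \<in> G \<Longrightarrow> \<bar>t - s\<bar> < d2 \<Longrightarrow>
    L2_norm \<Omega> (\<lambda>x. V t x - V s x) + L2_norm \<Omega> (\<lambda>x. weak_deriv \<Omega> (V t) x - weak_deriv \<Omega> (V s) x) \<le> \<kappa>"
    using trajectory_H1_continuous[OF \<sigma> \<Omega> I V h0 \<kappa>] by blast
  define z where "z t x = U t x - V t x" for t x
  define w where "w t x = weak_deriv \<Omega> (U t) x - weak_deriv \<Omega> (V t) x" for t x
  have bU: "H32_ball \<Omega> M (U t)" and bV: "H32_ball \<Omega> M (V t)" if "t \<in> G" for t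
    using U V that by (auto simp: trajectory_def)
  have zw: "H1_0_grad \<Omega> (z t) (w t)" if "t \<in> G" for t
    unfolding z_def w_def by (rule H1_0_grad_diff[OF H32_ballD(1)[OF bU[OF that] \<Omega>] H32_ballD(1)[OF bV[OF that] \<Omega>]])
  have zL: "z t \<in> L2 \<Omega>" "w t \<in> L2 \<Omega>" if "t \<in> G" for t using H1_0_grad_L2[OF zw[OF that]] by auto
  have zM: "L2_norm \<Omega> (z t) \<le> 2 * M" if "t \<in> G" for t
    unfolding z_def using L2_norm_triangle_diff[OF H32_ballD(4)[OF bU[OF that] \<Omega>] H32_ballD(4)[OF bV[OF that] \<Omega>]]
      H32_ballD(6)[OF bU[OF that] \<Omega>] H32_ballD(6)[OF bV[OF that] \<Omega>] by linarith
  have E: "E t = (L2_norm \<Omega> (z t))\<^sup>2" for t by (simp add: E_def z_def[abs_def])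
  have close: "L2_norm \<Omega> (\<lambda>x. z t x - z s x) + L2_norm \<Omega> (\<lambda>x. w t x - w s x) \<le> 2 * \<kappa>"
    if st: "s \<in> G" "t \<in> G" "\<bar>t - s\<bar> < min d1 d2" for s t
  proof -
    note Us = H32_ballD(4,5)[OF bU[OF st(1)] \<Omega>] and Ut = H32_ballD(4,5)[OF bU[OF st(2)] \<Omega>]
      and Vs = H32_ballD(4,5)[OF bV[OF st(1)] \<Omega>] and Vt = H32_ballD(4,5)[OF bV[OF st(2)] \<Omega>]
    have eq: "z t x - z s x = (U t x - U s x) - (V t x - V s x)"
      "w t x - w s x = (weak_deriv \<Omega> (U t) x - weak_deriv \<Omega> (U s) x) - (weak_deriv \<Omega> (V t) x - weak_deriv \<Omega> (V s) x)" for x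
      by (auto simp: z_def w_def)
    show ?thesis unfolding eq
      using L2_norm_triangle_diff[OF L2_diff[OF Ut(1) Us(1)] L2_diff[OF Vt(1) Vs(1)]]
        L2_norm_triangle_diff[OF L2_diff[OF Ut(2) Us(2)] L2_diff[OF Vt(2) Vs(2)]] d1(2)[OF st(1,2)] d2(2)[OF st(1,2)] st(3)
      by simp
  qed
  have split: "\<bar>Re (dnls_op \<Omega> \<sigma> (U \<tau>) f f' - 1 * dnls_op \<Omega> \<sigma> (V \<tau>) f f')\<bar> \<le> 2 * (K * (L2_norm \<Omega> f + L2_norm \<Omega> f'))"
    if "\<tau> \<in> G" "f \<in> L2 \<Omega>" "f' \<in> L2 \<Omega>" for \<tau> f f'
  proof -
    have "\<bar>Re (dnls_op \<Omega> \<sigma> (U \<tau>) f f' - 1 * dnls_op \<Omega> \<sigma> (V \<tau>) f f')\<bar> \<le> cmod (dnls_op \<Omega> \<sigma> (U \<tau>) f f') + cmod (dnls_op \<Omega> \<sigma> (V \<tau>) f f')"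
      using abs_Re_le_cmod[of "dnls_op \<Omega> \<sigma> (U \<tau>) f f' - dnls_op \<Omega> \<sigma> (V \<tau>) f f'"]
        norm_triangle_ineq4[of "dnls_op \<Omega> \<sigma> (U \<tau>) f f'" "dnls_op \<Omega> \<sigma> (V \<tau>) f f'"] unfolding mult_1 by linarith
    then show ?thesis
      using dnls_op_bound[OF \<sigma> \<Omega> bU[OF that(1)] that(2,3)] dnls_op_bound[OF \<sigma> \<Omega> bV[OF that(1)] that(2,3)]
      unfolding K_def by linarith
  qed
  show ?thesis
  proof (intro exI[of _ "min d1 d2"] conjI ballI impI)
    show "min d1 d2 > 0" using d1(1) d2(1) by simp
    fix s t assume st: "s \<in> G" "t \<in> G" "\<bar>t - s\<bar> < min d1 d2"
    define \<delta> where "\<delta> x = z t x - z s x" for x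
    define \<delta>' where "\<delta>' x = w t x - w s x" for x
    have \<delta>g: "H1_0_grad \<Omega> \<delta> \<delta>'" unfolding \<delta>_def \<delta>'_def by (rule H1_0_grad_diff[OF zw zw]) (rule st)+
    note L\<delta> = H1_0_grad_L2[OF \<delta>g]
    have \<delta>\<kappa>: "L2_norm \<Omega> \<delta> + L2_norm \<Omega> \<delta>' \<le> 2 * \<kappa>" unfolding \<delta>_def \<delta>'_def by (rule close[OF st])
    have diffs: "((LINT x|lebesgue_on \<Omega>. U t x * cnj (f x)) - 1 * (LINT x|lebesgue_on \<Omega>. V t x * cnj (f x)))
      - ((LINT x|lebesgue_on \<Omega>. U s x * cnj (f x)) - 1 * (LINT x|lebesgue_on \<Omega>. V s x * cnj (f x))) = (LINT x|lebesgue_on \<Omega>. \<delta> x * cnj (f x))"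
      if "f \<in> L2 \<Omega>" for f
    proof -
      note i = L2_integrable_mult[OF _ L2_cnj[OF that]]
      note Us = i[OF H32_ballD(4)[OF bU[OF st(1)] \<Omega>]] and Ut = i[OF H32_ballD(4)[OF bU[OF st(2)] \<Omega>]]
        and Vs = i[OF H32_ballD(4)[OF bV[OF st(1)] \<Omega>]] and Vt = i[OF H32_ballD(4)[OF bV[OF st(2)] \<Omega>]]
      have "(\<lambda>x. \<delta> x * cnj (f x)) = (\<lambda>x. (U t x * cnj (f x) - V t x * cnj (f x)) - (U s x * cnj (f x) - V s x * cnj (f x)))"
        by (auto simp: \<delta>_def z_def algebra_simps)
      then show ?thesis using Us Ut Vs Vt by (simp add: Bochner_Integration.integral_diff)
    qed
    have A: "\<bar>Re (LINT x|lebesgue_on \<Omega>. \<delta> x * cnj (\<delta> x))\<bar> \<le> 4 * K * \<kappa> * \<bar>t - s\<bar>"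
      unfolding diffs[OF L\<delta>(1), symmetric]
    proof (rule trajectory_increment[OF \<sigma> \<Omega> I U V H1_0_grad_cnj[OF \<delta>g] st(1,2)])
      show "0 \<le> 4 * K * \<kappa>" using K \<kappa> by simp
      fix \<tau> assume "\<tau> \<in> G"
      from split[OF this L2_cnj[OF L\<delta>(1)] L2_cnj[OF L\<delta>(2)]]
      have "\<bar>Re (dnls_op \<Omega> \<sigma> (U \<tau>) (\<lambda>x. cnj (\<delta> x)) (\<lambda>x. cnj (\<delta>' x)) - 1 * dnls_op \<Omega> \<sigma> (V \<tau>) (\<lambda>x. cnj (\<delta> x)) (\<lambda>x. cnj (\<delta>' x)))\<bar>
        \<le> 2 * (K * (L2_norm \<Omega> \<delta> + L2_norm \<Omega> \<delta>'))" by (simp only: L2_norm_cnj)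
      also have "\<dots> \<le> 2 * (K * (2 * \<kappa>))" using \<delta>\<kappa> K by (intro mult_left_mono) auto
      finally show "\<bar>Re (dnls_op \<Omega> \<sigma> (U \<tau>) (\<lambda>x. cnj (\<delta> x)) (\<lambda>x. cnj (\<delta>' x)) - 1 * dnls_op \<Omega> \<sigma> (V \<tau>) (\<lambda>x. cnj (\<delta> x)) (\<lambda>x. cnj (\<delta>' x)))\<bar> \<le> 4 * K * \<kappa>"
        by (simp only: mult.assoc)
    qed
    define S where "S = \<Lambda> * (E s + 8 * M * \<kappa>) + \<epsilon> + 4 * K * \<kappa>"
    have S0: "0 \<le> S" unfolding S_def using \<Lambda> M \<kappa> \<epsilon> K by (simp add: E)
    have B: "\<bar>Re (LINT x|lebesgue_on \<Omega>. \<delta> x * cnj (z s x))\<bar> \<le> S * \<bar>t - s\<bar>"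
      unfolding diffs[OF zL(1)[OF st(1)], symmetric]
    proof (rule trajectory_increment[OF \<sigma> \<Omega> I U V H1_0_grad_cnj[OF zw[OF st(1)]] st(1,2) S0])
      fix \<tau> assume \<tau>: "\<tau> \<in> G" "\<bar>\<tau> - s\<bar> \<le> \<bar>t - s\<bar>"
      have \<tau>d: "\<bar>\<tau> - s\<bar> < min d1 d2" using \<tau>(2) st(3) by simp
      note cl = close[OF st(1) \<tau>(1) \<tau>d]
      define f where "f x = z \<tau> x - z s x" for x
      define f' where "f' x = w \<tau> x - w s x" for x
      have fL: "f \<in> L2 \<Omega>" "f' \<in> L2 \<Omega>" unfolding f_def f'_def using zL[OF st(1)] zL[OF \<tau>(1)] by (auto intro: L2_diff)
      have f\<kappa>: "L2_norm \<Omega> f + L2_norm \<Omega> f' \<le> 2 * \<kappa>" unfolding f_def f'_def by (rule cl)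
      have dec: "dnls_op \<Omega> \<sigma> h (\<lambda>x. cnj (f x)) (\<lambda>x. cnj (f' x)) = dnls_op \<Omega> \<sigma> h (\<lambda>x. cnj (z \<tau> x)) (\<lambda>x. cnj (w \<tau> x)) - dnls_op \<Omega> \<sigma> h (\<lambda>x. cnj (z s x)) (\<lambda>x. cnj (w s x))"
        if "H32_ball \<Omega> M h" for h
        unfolding f_def f'_def complex_cnj_diff
        by (rule dnls_op_diff[OF \<sigma> \<Omega> that]) (intro L2_cnj zL \<tau> st)+
      have main: "\<bar>Re (dnls_op \<Omega> \<sigma> (U \<tau>) (\<lambda>x. cnj (z \<tau> x)) (\<lambda>x. cnj (w \<tau> x)) - dnls_op \<Omega> \<sigma> (V \<tau>) (\<lambda>x. cnj (z \<tau> x)) (\<lambda>x. cnj (w \<tau> x)))\<bar> \<le> \<Lambda> * E \<tau> + \<epsilon>"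
        unfolding E \<Lambda>_def \<epsilon>_def z_def w_def
        by (rule dnls_form_log_energy[OF \<sigma> \<Omega> H32_ballD(1-3)[OF bU[OF \<tau>(1)] \<Omega>] H32_ballD(1-3)[OF bV[OF \<tau>(1)] \<Omega>] h0(1) h0(2)[OF h0(1) order_refl]])
      have err: "\<bar>Re (dnls_op \<Omega> \<sigma> (U \<tau>) (\<lambda>x. cnj (f x)) (\<lambda>x. cnj (f' x)) - 1 * dnls_op \<Omega> \<sigma> (V \<tau>) (\<lambda>x. cnj (f x)) (\<lambda>x. cnj (f' x)))\<bar> \<le> 4 * K * \<kappa>"
      proof -
        have "2 * (K * (L2_norm \<Omega> f + L2_norm \<Omega> f')) \<le> 2 * (K * (2 * \<kappa>))" using f\<kappa> K by (intro mult_left_mono) auto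
        then show ?thesis using split[OF \<tau>(1) L2_cnj[OF fL(1)] L2_cnj[OF fL(2)]] unfolding L2_norm_cnj by linarith
      qed
      have E\<tau>: "E \<tau> \<le> E s + 8 * M * \<kappa>"
      proof -
        have "L2_norm \<Omega> (z \<tau>) \<le> L2_norm \<Omega> f + L2_norm \<Omega> (z s)"
          using L2_norm_triangle[OF fL(1) zL(1)[OF st(1)]] by (simp add: f_def)
        moreover have "L2_norm \<Omega> f \<le> 2 * \<kappa>" using f\<kappa> L2_norm_nonneg[of \<Omega> f'] by linarith
        ultimately have "L2_norm \<Omega> (z \<tau>) - L2_norm \<Omega> (z s) \<le> 2 * \<kappa>" by linarith
        then have "(L2_norm \<Omega> (z \<tau>) - L2_norm \<Omega> (z s)) * (L2_norm \<Omega> (z \<tau>) + L2_norm \<Omega> (z s)) \<le> 2 * \<kappa> * (L2_norm \<Omega> (z \<tau>) + L2_norm \<Omega> (z s))"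
          by (intro mult_right_mono) auto
        also have "\<dots> \<le> 2 * \<kappa> * (2 * M + 2 * M)" using zM[OF \<tau>(1)] zM[OF st(1)] \<kappa> by (intro mult_left_mono add_mono) auto
        finally show ?thesis unfolding E by (simp add: power2_eq_square algebra_simps)
      qed
      have "\<Lambda> * E \<tau> \<le> \<Lambda> * (E s + 8 * M * \<kappa>)" by (rule mult_left_mono[OF E\<tau> \<Lambda>])
      with main err show "\<bar>Re (dnls_op \<Omega> \<sigma> (U \<tau>) (\<lambda>x. cnj (z s x)) (\<lambda>x. cnj (w s x)) - 1 * dnls_op \<Omega> \<sigma> (V \<tau>) (\<lambda>x. cnj (z s x)) (\<lambda>x. cnj (w s x)))\<bar> \<le> S"
        unfolding dec[OF bU[OF \<tau>(1)]] dec[OF bV[OF \<tau>(1)]] S_def by simp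
    qed
    have "E t - E s = 2 * Re (LINT x|lebesgue_on \<Omega>. \<delta> x * cnj (z s x)) + Re (LINT x|lebesgue_on \<Omega>. \<delta> x * cnj (\<delta> x))"
    proof -
      note i = L2_integrable_mult[OF zL(1)[OF st(1)] L2_cnj[OF zL(1)[OF st(1)]]] L2_integrable_mult[OF L\<delta>(1) L2_cnj[OF zL(1)[OF st(1)]]]
        L2_integrable_mult[OF zL(1)[OF st(1)] L2_cnj[OF L\<delta>(1)]] L2_integrable_mult[OF L\<delta>(1) L2_cnj[OF L\<delta>(1)]]
      have "(LINT x|lebesgue_on \<Omega>. z t x * cnj (z t x)) = (LINT x|lebesgue_on \<Omega>. z s x * cnj (z s x) + \<delta> x * cnj (z s x) + z s x * cnj (\<delta> x) + \<delta> x * cnj (\<delta> x))"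
        by (simp add: \<delta>_def algebra_simps)
      also have "\<dots> = (LINT x|lebesgue_on \<Omega>. z s x * cnj (z s x)) + (LINT x|lebesgue_on \<Omega>. \<delta> x * cnj (z s x))
         + (LINT x|lebesgue_on \<Omega>. z s x * cnj (\<delta> x)) + (LINT x|lebesgue_on \<Omega>. \<delta> x * cnj (\<delta> x))"
        using i by simp
      also have "(LINT x|lebesgue_on \<Omega>. z s x * cnj (\<delta> x)) = cnj (LINT x|lebesgue_on \<Omega>. \<delta> x * cnj (z s x))"
      proof -
        have "(\<lambda>x. z s x * cnj (\<delta> x)) = (\<lambda>x. cnj (\<delta> x * cnj (z s x)))" by (simp add: mult.commute)
        then show ?thesis
          by (simp only: Bochner_Integration.integral_bounded_linear[OF bounded_linear_cnj i(2)])
      qed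
      finally have "Re (LINT x|lebesgue_on \<Omega>. z t x * cnj (z t x)) = Re (LINT x|lebesgue_on \<Omega>. z s x * cnj (z s x))
         + 2 * Re (LINT x|lebesgue_on \<Omega>. \<delta> x * cnj (z s x)) + Re (LINT x|lebesgue_on \<Omega>. \<delta> x * cnj (\<delta> x))" by simp
      then show ?thesis
        unfolding L2_norm_power2_eq[OF zL(1)[OF st(1)]] L2_norm_power2_eq[OF zL(1)[OF st(2)]] E Re_complex_of_real by linarith
    qed
    then have "\<bar>E t - E s\<bar> \<le> 2 * (S * \<bar>t - s\<bar>) + 4 * K * \<kappa> * \<bar>t - s\<bar>" using A B by linarith
    also have "\<dots> = \<bar>t - s\<bar> * (2 * \<Lambda> * E s + 2 * \<epsilon> + (16 * M * \<Lambda> + 12 * K) * \<kappa>)"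
      unfolding S_def by (simp add: algebra_simps)
    also have "\<dots> \<le> \<bar>t - s\<bar> * (2 * \<Lambda> * E s + 2 * \<epsilon> + \<eta>)" using \<kappa>\<eta> by (intro mult_left_mono add_left_mono) auto
    finally show "\<bar>E t - E s\<bar> \<le> \<bar>t - s\<bar> * (2 * growth_const \<sigma> h0 M n * E s + 2 * growth_err \<sigma> h0 M n + \<eta>)"
      unfolding \<Lambda>_def \<epsilon>_def .
  qed
qed

section \<open>Gronwall on a dense set of times\<close>

text \<open>Density allows steps of length between \<open>d / 2\<close> and \<open>d\<close>, so finitely many steps suffice.\<close>

lemma locally_antimono_imp_antimono:
  fixes F :: "real \<Rightarrow> real"
  assumes d: "d > 0" and dense: "\<And>a b. a < b \<Longrightarrow> {a<..<b} \<subseteq> J \<Longrightarrow> \<exists>m\<in>G. a < m \<and> m < b"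
    and J: "\<And>a b. a \<in> G \<Longrightarrow> b \<in> G \<Longrightarrow> {a<..<b} \<subseteq> J"
    and loc: "\<And>s t. s \<in> G \<Longrightarrow> t \<in> G \<Longrightarrow> s < t \<Longrightarrow> t - s < d \<Longrightarrow> F t \<le> F s"
    and st: "s \<in> G" "t \<in> G" "s < t"
  shows "F t \<le> F s"
proof -
  have "F t \<le> F s" if "s \<in> G" "t \<in> G" "s < t" "t - s < real n * (d / 2)" for n s t
    using that
  proof (induction n arbitrary: s)
    case (Suc n)
    show ?case
    proof (cases "t - s < d")
      case True
      then show ?thesis using loc Suc.prems by blast
    next
      case False
      have "{s + d / 2<..<s + d} \<subseteq> J"
        using J[OF Suc.prems(1,2)] False d by (auto intro!: subsetD[OF J[OF Suc.prems(1,2)]])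
      then obtain m where m: "m \<in> G" "s + d / 2 < m" "m < s + d"
        using dense[of "s + d / 2" "s + d"] d by auto
      have mt: "m < t" using m(3) False by linarith
      have "t - m < real n * (d / 2)" using m(2) Suc.prems(4) by (simp add: algebra_simps)
      then have "F t \<le> F m" by (rule Suc.IH[OF m(1) Suc.prems(2) mt])
      also have "F m \<le> F s" using m d by (intro loc Suc.prems(1) m(1)) auto
      finally show ?thesis .
    qed
  qed simp
  moreover obtain n where "(t - s) / (d / 2) < real n" using reals_Archimedean2 by blast
  then have "t - s < real n * (d / 2)" using d by (simp add: pos_divide_less_eq)
  ultimately show ?thesis using st by blast
qed

text \<open>The function \<open>exp (- L t) E t - (e + \<eta>) t\<close> decreases along short steps, because
\<open>1 + x \<le> exp x\<close> absorbs the first-order term.\<close>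

lemma dense_Gronwall_forward:
  fixes E :: "real \<Rightarrow> real"
  assumes dense: "\<And>a b. a < b \<Longrightarrow> {a<..<b} \<subseteq> J \<Longrightarrow> \<exists>m\<in>G. a < m \<and> m < b"
    and J: "\<And>a b. a \<in> G \<Longrightarrow> b \<in> G \<Longrightarrow> {a<..<b} \<subseteq> J" and G0: "0 \<in> G"
    and E: "\<And>t. t \<in> G \<Longrightarrow> 0 \<le> E t" "E 0 = 0" and L: "0 \<le> L" and e: "0 \<le> e"
    and inc: "\<And>\<eta>. \<eta> > 0 \<Longrightarrow> \<exists>d>0. \<forall>s\<in>G. \<forall>t\<in>G. \<bar>t - s\<bar> < d \<longrightarrow> \<bar>E t - E s\<bar> \<le> \<bar>t - s\<bar> * (L * E s + e + \<eta>)"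
    and t: "t \<in> G" "0 < t"
  shows "E t \<le> e * t * exp (L * t)"
proof -
  have "exp (- (L * t)) * E t \<le> e * t + \<eta>'" if \<eta>': "\<eta>' > 0" for \<eta>'
  proof -
    define \<eta> where "\<eta> = \<eta>' / t"
    have \<eta>: "\<eta> > 0" using \<eta>' t by (simp add: \<eta>_def)
    obtain d where d: "d > 0" "\<And>s t. s \<in> G \<Longrightarrow> t \<in> G \<Longrightarrow> \<bar>t - s\<bar> < d \<Longrightarrow> \<bar>E t - E s\<bar> \<le> \<bar>t - s\<bar> * (L * E s + e + \<eta>)"
      using inc[OF \<eta>] by blast
    define F where "F \<tau> = exp (- (L * \<tau>)) * E \<tau> - (e + \<eta>) * \<tau>" for \<tau>
    have "F t \<le> F 0"
    proof (rule locally_antimono_imp_antimono[where d = d and J = "J \<inter> {0..}" and G = "G \<inter> {0..}" and F = F and s = 0 and t = t])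
      fix s t assume st: "s \<in> G \<inter> {0..}" "t \<in> G \<inter> {0..}" "s < t" "t - s < d"
      have "E t \<le> E s + (t - s) * (L * E s + e + \<eta>)" using d(2)[of s t] st by simp
      also have "\<dots> = (1 + L * (t - s)) * E s + (t - s) * (e + \<eta>)" by (simp add: algebra_simps)
      also have "\<dots> \<le> exp (L * (t - s)) * E s + (t - s) * (e + \<eta>)"
        using E(1) st exp_ge_add_one_self[of "L * (t - s)"] by (intro add_right_mono mult_right_mono) auto
      finally have "exp (- (L * t)) * E t \<le> exp (- (L * t)) * (exp (L * (t - s)) * E s + (t - s) * (e + \<eta>))"
        by (intro mult_left_mono) auto
      also have "\<dots> = exp (- (L * s)) * E s + exp (- (L * t)) * ((t - s) * (e + \<eta>))"
        by (simp add: distrib_left algebra_simps flip: exp_add mult.assoc)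
      also have "\<dots> \<le> exp (- (L * s)) * E s + 1 * ((t - s) * (e + \<eta>))"
        using L e \<eta> st by (intro add_left_mono mult_right_mono mult_nonneg_nonneg) auto
      finally show "F t \<le> F s" unfolding F_def by (simp add: algebra_simps)
    next
      fix a b :: real assume "a < b" "{a<..<b} \<subseteq> J \<inter> {0..}"
      then obtain m where m: "m \<in> G" "a < m" "m < b" using dense[of a b] by blast
      then have "m \<in> {a<..<b}" by simp
      then have "m \<in> J \<inter> {0..}" using \<open>{a<..<b} \<subseteq> J \<inter> {0..}\<close> by blast
      with m show "\<exists>m\<in>G \<inter> {0..}. a < m \<and> m < b" by blast
    next
      fix a b assume ab: "a \<in> G \<inter> {0..}" "b \<in> G \<inter> {0..}"
      then have "{a<..<b} \<subseteq> J" using J by blast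
      then show "{a<..<b} \<subseteq> J \<inter> {0..}" using ab by auto
    qed (use d G0 t in auto)
    then have "exp (- (L * t)) * E t \<le> (e + \<eta>) * t" by (simp add: F_def E(2))
    then show ?thesis using t by (simp add: \<eta>_def algebra_simps)
  qed
  then have "exp (- (L * t)) * E t \<le> e * t" by (rule field_le_epsilon)
  then have "exp (L * t) * (exp (- (L * t)) * E t) \<le> exp (L * t) * (e * t)" by (intro mult_left_mono) auto
  then show ?thesis by (simp add: mult_ac flip: mult.assoc exp_add)
qed

text \<open>Negative times follow by reflection, the hypothesis on increments being symmetric.\<close>

lemma dense_Gronwall:
  fixes E :: "real \<Rightarrow> real"
  assumes dense: "\<And>a b. a < b \<Longrightarrow> {a<..<b} \<subseteq> {-T<..<T} \<Longrightarrow> \<exists>m\<in>G. a < m \<and> m < b"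
    and G: "G \<subseteq> {-T<..<T}" "0 \<in> G"
    and E: "\<And>t. t \<in> G \<Longrightarrow> 0 \<le> E t" "E 0 = 0" and L: "0 \<le> L" and e: "0 \<le> e"
    and inc: "\<And>\<eta>. \<eta> > 0 \<Longrightarrow> \<exists>d>0. \<forall>s\<in>G. \<forall>t\<in>G. \<bar>t - s\<bar> < d \<longrightarrow> \<bar>E t - E s\<bar> \<le> \<bar>t - s\<bar> * (L * E s + e + \<eta>)"
    and t: "t \<in> G"
  shows "E t \<le> e * \<bar>t\<bar> * exp (L * \<bar>t\<bar>)"
proof -
  consider "t = 0" | "t > 0" | "t < 0" by linarith
  then show ?thesis
  proof cases
    case 2
    have "E t \<le> e * t * exp (L * t)"
    proof (rule dense_Gronwall_forward[OF dense _ G(2) E L e inc t 2])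
      show "{a<..<b} \<subseteq> {-T<..<T}" if "a \<in> G" "b \<in> G" for a b
        using subsetD[OF G(1) that(1)] subsetD[OF G(1) that(2)] by auto
    qed
    then show ?thesis using 2 by simp
  next
    case 3
    have mem: "- x \<in> G" if "x \<in> uminus ` G" for x using that by auto
    have "E (- (- t)) \<le> e * (- t) * exp (L * (- t))"
    proof (rule dense_Gronwall_forward[where G = "uminus ` G" and J = "{-T<..<T}" and E = "\<lambda>t. E (- t)"])
      fix a b :: real assume ab: "a < b" "{a<..<b} \<subseteq> {-T<..<T}"
      have "{-b<..<-a} \<subseteq> {-T<..<T}"
      proof
        fix x assume "x \<in> {-b<..<-a}"
        then have "- x \<in> {a<..<b}" by auto
        then have "- x \<in> {-T<..<T}" using ab(2) by blast
        then show "x \<in> {-T<..<T}" by auto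
      qed
      then obtain m where "m \<in> G" "- b < m" "m < - a" using dense[of "-b" "-a"] ab(1) by auto
      then show "\<exists>m\<in>uminus ` G. a < m \<and> m < b" by (intro bexI[of _ "- m"]) auto
    next
      show "{a<..<b} \<subseteq> {-T<..<T}" if "a \<in> uminus ` G" "b \<in> uminus ` G" for a b
        using subsetD[OF G(1) mem[OF that(1)]] subsetD[OF G(1) mem[OF that(2)]] by auto
      show "0 \<in> uminus ` G" using G(2) by (intro image_eqI[of _ _ 0]) auto
      show "0 \<le> E (- t)" if "t \<in> uminus ` G" for t using E(1)[OF mem[OF that]] .
      show "E (- 0) = 0" using E(2) by simp
      fix \<eta> :: real assume "\<eta> > 0"
      then obtain d where d: "d > 0" "\<And>s t. s \<in> G \<Longrightarrow> t \<in> G \<Longrightarrow> \<bar>t - s\<bar> < d \<Longrightarrow> \<bar>E t - E s\<bar> \<le> \<bar>t - s\<bar> * (L * E s + e + \<eta>)"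
        using inc by blast
      have "\<bar>E (- t) - E (- s)\<bar> \<le> \<bar>t - s\<bar> * (L * E (- s) + e + \<eta>)" if "s \<in> uminus ` G" "t \<in> uminus ` G" "\<bar>t - s\<bar> < d" for s t
        using d(2)[OF mem[OF that(1)] mem[OF that(2)]] that(3) by (simp add: abs_minus_commute)
      then show "\<exists>d>0. \<forall>s\<in>uminus ` G. \<forall>t\<in>uminus ` G. \<bar>t - s\<bar> < d \<longrightarrow> \<bar>E (- t) - E (- s)\<bar> \<le> \<bar>t - s\<bar> * (L * E (- s) + e + \<eta>)"
        using d(1) by blast
    qed (use t 3 L e in auto)
    then show ?thesis using 3 by simp
  qed (use E in simp)
qed

lemma AE_dense:
  fixes G :: "real set"
  assumes ae: "AE t in lebesgue_on I. t \<in> G" and I: "I \<in> sets lebesgue" and ab: "a < b" "{a<..<b} \<subseteq> I"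
  shows "\<exists>m\<in>G. a < m \<and> m < b"
proof (rule ccontr)
  assume no: "\<not> ?thesis"
  have "AE t in lebesgue. t \<in> I \<longrightarrow> t \<in> G" using ae I by (simp add: AE_restrict_space_iff)
  then have "AE t in lebesgue. t \<notin> {a<..<b}"
    by eventually_elim (use no ab(2) in auto)
  then have "emeasure lebesgue {a<..<b} = 0"
    by (subst (asm) AE_iff_measurable[of "{a<..<b}"]) auto
  then show False using ab(1) by simp
qed

text \<open>Completing the square gives \<open>b sqrt n \<le> (ln 2 / 2) n + b\<^sup>2 / (2 ln 2)\<close>, so half of the exponential
decay is left.\<close>

lemma exp_sqrt_over_power_tendsto_0:
  assumes "0 \<le> a" "0 \<le> b"
  shows "(\<lambda>n. exp (a + b * sqrt (real n)) / 2 ^ n) \<longlonglongrightarrow> 0"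
proof -
  define l where "l = ln (2::real)"
  have l: "l > 0" by (simp add: l_def)
  have le: "norm (exp (a + b * sqrt (real n)) / 2 ^ n) \<le> exp (a + b\<^sup>2 / (2 * l)) * exp (- (l / 2)) ^ n" for n
  proof -
    have "2 * b * sqrt (real n) \<le> l * real n + b\<^sup>2 / l"
    proof -
      have "0 \<le> (l * sqrt (real n) - b)\<^sup>2" by simp
      also have "\<dots> = l * (l * real n) - l * (2 * b * sqrt (real n)) + b\<^sup>2"
        by (simp add: power2_eq_square algebra_simps)
      finally have "l * (2 * b * sqrt (real n)) \<le> l * (l * real n) + b\<^sup>2" by simp
      also have "\<dots> = l * (l * real n + b\<^sup>2 / l)" using l by (simp add: distrib_left)
      finally show ?thesis using l by simp
    qed
    then have "a + b * sqrt (real n) - real n * l \<le> (a + b\<^sup>2 / (2 * l)) + real n * (- (l / 2))"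
      by (simp add: field_simps)
    then have "exp (a + b * sqrt (real n) - real n * l) \<le> exp ((a + b\<^sup>2 / (2 * l)) + real n * (- (l / 2)))" by simp
    moreover have "exp (a + b * sqrt (real n) - real n * l) = exp (a + b * sqrt (real n)) / 2 ^ n"
      unfolding exp_diff l_def by (simp add: exp_of_nat_mult)
    moreover have "exp ((a + b\<^sup>2 / (2 * l)) + real n * (- (l / 2))) = exp (a + b\<^sup>2 / (2 * l)) * exp (- (l / 2)) ^ n"
      unfolding exp_add[of "a + b\<^sup>2 / (2 * l)"] exp_of_nat_mult ..
    ultimately show ?thesis by simp
  qed
  have "(\<lambda>n. exp (- (l / 2)) ^ n) \<longlonglongrightarrow> 0"
    using l by (intro LIMSEQ_power_zero) simp
  then have "(\<lambda>n. exp (a + b\<^sup>2 / (2 * l)) * exp (- (l / 2)) ^ n) \<longlonglongrightarrow> 0"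
    by (rule tendsto_mult_right_zero)
  then show ?thesis by (rule Lim_null_comparison[OF always_eventually[OF allI[OF le]]])
qed

text \<open>Measured from the middle of a segment in \<open>\<Omega>\<close>, every point can move towards the far end of that
segment.\<close>

lemma interval_one_sided_segments:
  assumes "open (\<Omega> :: real set)" "is_interval \<Omega>" "\<Omega> \<noteq> {}"
  obtains h0 where "h0 > 0" "\<And>h x. 0 < h \<Longrightarrow> h \<le> h0 \<Longrightarrow> x \<in> \<Omega> \<Longrightarrow> {x..x+h} \<subseteq> \<Omega> \<or> {x-h..x} \<subseteq> \<Omega>"
proof -
  obtain a where a: "a \<in> \<Omega>" using assms(3) by blast
  obtain e where e: "e > 0" "cball a e \<subseteq> \<Omega>" using assms(1) a open_contains_cball by blast
  have b: "a + e \<in> \<Omega>" using e by (auto intro!: subsetD[OF e(2)] simp: dist_real_def)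
  show ?thesis
  proof (rule that[of "e / 2"])
    fix h x assume h: "0 < h" "h \<le> e / 2" and x: "x \<in> \<Omega>"
    show "{x..x+h} \<subseteq> \<Omega> \<or> {x-h..x} \<subseteq> \<Omega>"
    proof (cases "x \<le> a + e / 2")
      case True
      have "y \<in> \<Omega>" if "y \<in> {x..x+h}" for y
        by (rule mem_is_interval_1_I[OF assms(2) x b]) (use that True h in auto)
      then show ?thesis by blast
    next
      case False
      have "y \<in> \<Omega>" if "y \<in> {x-h..x}" for y
        by (rule mem_is_interval_1_I[OF assms(2) a x]) (use that False h in auto)
      then show ?thesis by blast
    qed
  qed (use e in simp)
qed

section \<open>Uniqueness of solutions\<close>

theorem theorem1p3:
  fixes \<Omega> :: "real set" and \<sigma> T :: real
    and \<phi> :: "real \<Rightarrow> complex" and u v :: "real \<Rightarrow> real \<Rightarrow> complex"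
  assumes "open \<Omega>" "is_interval \<Omega>" "\<Omega> \<noteq> {}"
    and "\<sigma> \<ge> 1 / 2"
    and "\<phi> \<in> H32 \<Omega> \<inter> H1_0 \<Omega>"
    and "T > 0"
    and "dnls_solution T \<Omega> \<sigma> u" "initial_data {-T<..<T} \<Omega> u \<phi>"
    and "dnls_solution T \<Omega> \<sigma> v" "initial_data {-T<..<T} \<Omega> v \<phi>"
  shows "AE t in lebesgue_on {-T<..<T}. AE x in lebesgue_on \<Omega>. u t x = v t x"
proof -
  let ?I = "{-T<..<T}"
  note \<Omega> = assms(1) and \<sigma> = assms(4)
  obtain Gu Mu where Gu: "0 \<in> Gu" "\<And>G' M'. G' \<subseteq> Gu \<Longrightarrow> (AE t in lebesgue_on ?I. t \<in> G') \<Longrightarrow> Mu \<le> M' \<Longrightarrow> trajectory \<Omega> \<sigma> ?I G' M' (u(0 := \<phi>))"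
    "AE t in lebesgue_on ?I. t \<in> Gu"
    by (rule solution_trajectory[OF \<sigma> \<Omega> assms(6,5,7,8)]) blast
  obtain Gv Mv where Gv: "0 \<in> Gv" "\<And>G' M'. G' \<subseteq> Gv \<Longrightarrow> (AE t in lebesgue_on ?I. t \<in> G') \<Longrightarrow> Mv \<le> M' \<Longrightarrow> trajectory \<Omega> \<sigma> ?I G' M' (v(0 := \<phi>))"
    "AE t in lebesgue_on ?I. t \<in> Gv"
    by (rule solution_trajectory[OF \<sigma> \<Omega> assms(6,5,9,10)]) blast
  define G where "G = Gu \<inter> Gv"
  define M where "M = max Mu Mv"
  define U where "U = u(0 := \<phi>)"
  define V where "V = v(0 := \<phi>)"
  have aeG: "AE t in lebesgue_on ?I. t \<in> G" using Gu(3) Gv(3) by eventually_elim (simp add: G_def)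
  have U: "trajectory \<Omega> \<sigma> ?I G M U" unfolding U_def by (rule Gu(2)[OF _ aeG]) (auto simp: G_def M_def)
  have V: "trajectory \<Omega> \<sigma> ?I G M V" unfolding V_def by (rule Gv(2)[OF _ aeG]) (auto simp: G_def M_def)
  have G0: "0 \<in> G" using Gu(1) Gv(1) by (simp add: G_def)
  have GI: "G \<subseteq> ?I" using U by (simp add: trajectory_def)
  have ball: "H32_ball \<Omega> M (U t)" "H32_ball \<Omega> M (V t)" if "t \<in> G" for t using U V that by (auto simp: trajectory_def)
  have M: "0 \<le> M" by (rule H32_ballD(9)[OF ball(1)[OF G0] \<Omega>])
  obtain h where h: "h > 0" "\<And>k x. 0 < k \<Longrightarrow> k \<le> h \<Longrightarrow> x \<in> \<Omega> \<Longrightarrow> {x..x+k} \<subseteq> \<Omega> \<or> {x-k..x} \<subseteq> \<Omega>"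
    by (rule interval_one_sided_segments[OF assms(1-3)]) blast
  define E where "E t = (L2_norm \<Omega> (\<lambda>x. U t x - V t x))\<^sup>2" for t
  define K where "K = powr_lip_const \<sigma> ((M + 1)\<^sup>2 + 1)"
  have K: "0 \<le> K" using powr_lip_const_nonneg[OF \<sigma>] by (simp add: K_def)
  have E0: "E t = 0" if t: "t \<in> G" for t
  proof -
    \<comment> \<open>With these constants Gronwall gives \<open>E t \<le> c exp (a + b sqrt n) / 2\<^sup>n\<close> for every \<open>n\<close>.\<close>
    define a where "a = 4 * K * (sqrt (2 / h) * M + sqrt (2 * h) * (2 * M)\<^sup>2) * \<bar>t\<bar>"
    define b where "b = 4 * K * (4 * M) * \<bar>t\<bar>"
    define c where "c = 4 * K * sqrt (2 * h) * M\<^sup>2 * \<bar>t\<bar>"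
    have ab: "0 \<le> a" "0 \<le> b" using K M h(1) by (auto simp: a_def b_def intro!: mult_nonneg_nonneg add_nonneg_nonneg)
    have "E t \<le> c * (exp (a + b * sqrt (real n)) / 2 ^ n)" for n
    proof -
      have nonneg: "0 \<le> growth_const \<sigma> h M n" "0 \<le> growth_err \<sigma> h M n"
        unfolding growth_const_def growth_err_def K_def[symmetric]
        using K M h(1) by (auto intro!: mult_nonneg_nonneg add_nonneg_nonneg)
      have "E t \<le> (2 * growth_err \<sigma> h M n) * \<bar>t\<bar> * exp (2 * growth_const \<sigma> h M n * \<bar>t\<bar>)"
      proof (rule dense_Gronwall[OF _ GI G0, where E = E])
        show "\<exists>m\<in>G. p < m \<and> m < q" if "p < q" "{p<..<q} \<subseteq> ?I" for p q
          by (rule AE_dense[OF aeG _ that]) simp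
        show "E 0 = 0" by (simp add: E_def U_def V_def L2_norm_def)
        show "\<exists>d>0. \<forall>s\<in>G. \<forall>t\<in>G. \<bar>t - s\<bar> < d \<longrightarrow> \<bar>E t - E s\<bar> \<le> \<bar>t - s\<bar> * (2 * growth_const \<sigma> h M n * E s + 2 * growth_err \<sigma> h M n + \<eta>)"
          if "\<eta> > 0" for \<eta>
          unfolding E_def by (rule energy_increment[OF \<sigma> \<Omega> _ _ U V M h that]) (simp_all add: is_interval_1)
      qed (use nonneg t in \<open>auto simp: E_def\<close>)
      also have "2 * growth_const \<sigma> h M n * \<bar>t\<bar> = a + b * sqrt (real n)"
      proof -
        have "sqrt (16 * real n * M\<^sup>2) = 4 * M * sqrt (real n)" using M by (simp add: real_sqrt_mult)
        then show ?thesis unfolding growth_const_def K_def[symmetric] a_def b_def by (simp add: algebra_simps)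
      qed
      also have "2 * growth_err \<sigma> h M n * \<bar>t\<bar> = c / 2 ^ n"
        unfolding growth_err_def K_def[symmetric] c_def by simp
      finally show ?thesis by simp
    qed
    moreover have "(\<lambda>n. c * (exp (a + b * sqrt (real n)) / 2 ^ n)) \<longlonglongrightarrow> 0"
      by (rule tendsto_mult_right_zero[OF exp_sqrt_over_power_tendsto_0[OF ab]])
    ultimately have "E t \<le> 0" by (intro LIMSEQ_le_const) blast+
    then show ?thesis by (simp add: E_def)
  qed
  have "AE t in lebesgue_on ?I. t \<noteq> 0" by (rule AE_lebesgue_on_neq) simp
  then show ?thesis using aeG
  proof eventually_elim
    case (elim t)
    have "(\<lambda>x. U t x - V t x) \<in> L2 \<Omega>"
      using H32_ballD(4)[OF ball(1)[OF elim(2)] \<Omega>] H32_ballD(4)[OF ball(2)[OF elim(2)] \<Omega>] by (rule L2_diff)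
    moreover have "L2_norm \<Omega> (\<lambda>x. U t x - V t x) = 0" using E0[OF elim(2)] by (simp add: E_def)
    ultimately have "AE x in lebesgue_on \<Omega>. U t x - V t x = 0" by (rule L2_norm_eq_0_imp_AE)
    then show ?case using elim(1) by (simp add: U_def V_def)
  qed
qed

end
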